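(* Let $p$ be a prime, $n\ge 2$, $m=p^n$ and $m'=\lfloor m/2\rfloor$. For $r\in\{1,\dots,n-1\}$ and integers $k$ with $1\le k\le p^{n-r}/2$, $\gcd(k,p)=1$, and $k>1$ if $r=1$, define the linear form $$R_{r,k}=-Y_{p^rk}+\frac{p^r-1}{p-1}\,Y_p+\sum_{j\in J_{n-r}}Y_{(jk)_{red}}-\frac{p^r-1}{p-1}\sum_{j\in J_{n-1}}Y_{j_{red}},$$ where $J_s=\{j\in\{1,\dots,m\}: j\equiv 1\pmod{p^s}\}$ and the convention $Y_1=0$ is used. Then these forms $R_{r,k}$ constitute a $\mathbb{Q}$-basis of the $\mathbb{Q}$-vector space of $U$-relations.
   Context: For $k=1,\dots,m'$ let $U_k=\log_2\!\left(\frac{\sin(\pi k/m)}{\sin(\pi/m)}\right)$. For an integer $a\not\equiv0\pmod m$, $a_{red}$ is the unique integer in $\{1,\dots,m'\}$ with $a_{red}\equiv \pm a\pmod m$. A $U$-relation is a linear form $\sum_{k=2}^{m'}c_kY_k$ with $c_k\in\mathbb{Q}$, in the variables $Y_2,\dots,Y_{m'}$, such that $\sum_{k=2}^{m'}c_kU_k=0$; the $U$-relations form a $\mathbb{Q}$-subspace of $\mathbb{Q}Y_2+\dots+\mathbb{Q}Y_{m'}$. Convention: the symbol $Y_1$ denotes $0$. *)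

theory Defs
  imports
    Complex_Main
    "HOL-Library.Poly_Mapping"
    "HOL-Number_Theory.Cong"
    "HOL-Computational_Algebra.Primes"
begin

definition U :: "nat \<Rightarrow> nat \<Rightarrow> real" where
  "U m k = log 2 (sin (pi * real k / real m) / sin (pi / real m))"

text \<open>Meaningful only for \<open>a\<close> not divisible by \<open>m\<close>; see \<open>red_ex1\<close>.\<close>

definition red :: "nat \<Rightarrow> int \<Rightarrow> nat" where
  "red m a = (THE b. b \<in> {1..m div 2} \<and>
     ([int b = a] (mod int m) \<or> [int b = - a] (mod int m)))"

lemma red_ex1:
  fixes m :: nat and a :: int
  assumes "m > 0" and "\<not> [a = 0] (mod int m)"
  shows "\<exists>!b. b \<in> {1..m div 2} \<and>
           ([int b = a] (mod int m) \<or> [int b = - a] (mod int m))"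
proof -
  define c where "c = a mod int m"
  have ca: "[c = a] (mod int m)"
    by (simp add: c_def)
  have c0: "c \<noteq> 0"
    using assms(2) by (simp add: c_def cong_def)
  have c1: "0 < c" "c < int m"
  proof -
    have "0 \<le> c" "c < int m"
      unfolding c_def using assms(1) by simp_all
    thus "0 < c" "c < int m"
      using c0 by linarith+
  qed
  have nca: "[int m - c = - a] (mod int m)"
  proof -
    have "int m dvd int m - (c - a)"
      using dvd_diff[OF dvd_refl ca[unfolded cong_iff_dvd_diff]] .
    thus ?thesis by (simp add: cong_iff_dvd_diff algebra_simps)
  qed
  have mod_eq: "int b = c \<or> int b = int m - c"
    if "1 \<le> b" "b \<le> m div 2" "[int b = a] (mod int m) \<or> [int b = - a] (mod int m)" for b
  proof -
    have bm: "int b < int m" using that(1,2) by auto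
    from that(3) show ?thesis
    proof
      assume "[int b = a] (mod int m)"
      hence "[int b = c] (mod int m)" using ca cong_sym cong_trans by blast
      thus ?thesis using bm c1 by (simp add: cong_def)
    next
      assume "[int b = - a] (mod int m)"
      hence "[int b = int m - c] (mod int m)" using nca cong_sym cong_trans by blast
      moreover have "(int m - c) mod int m = int m - c"
        using c1 by (intro mod_pos_pos_trivial) auto
      ultimately show ?thesis using bm by (simp add: cong_def)
    qed
  qed
  show ?thesis
  proof (cases "2 * c \<le> int m")
    case True
    show ?thesis
    proof (rule ex1I[of _ "nat c"])
      show "nat c \<in> {1..m div 2} \<and> ([int (nat c) = a] (mod int m) \<or> [int (nat c) = - a] (mod int m))"
        using True c1 ca by auto
      fix b assume b: "b \<in> {1..m div 2} \<and> ([int b = a] (mod int m) \<or> [int b = - a] (mod int m))"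
      hence "int b = c \<or> int b = int m - c" using mod_eq by auto
      moreover have "2 * int b \<le> int m" using b by auto
      ultimately show "b = nat c" using True by auto
    qed
  next
    case False
    show ?thesis
    proof (rule ex1I[of _ "nat (int m - c)"])
      show "nat (int m - c) \<in> {1..m div 2} \<and>
          ([int (nat (int m - c)) = a] (mod int m) \<or> [int (nat (int m - c)) = - a] (mod int m))"
        using False c1 nca by auto
      fix b assume b: "b \<in> {1..m div 2} \<and> ([int b = a] (mod int m) \<or> [int b = - a] (mod int m))"
      hence "int b = c \<or> int b = int m - c" using mod_eq by auto
      moreover have "2 * int b \<le> int m" using b by auto
      ultimately show "b = nat (int m - c)" using False by auto
    qed
  qed
qed

text \<open>
  Rational linear forms in variables indexed by natural numbers are finitely supported
  coefficient functions; the form \<open>\<Sum>k. c\<^sub>k Y\<^sub>k\<close> has \<open>Poly_Mapping.lookup f k = c\<^sub>k\<close>.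
\<close>

type_synonym linform = "nat \<Rightarrow>\<^sub>0 rat"

definition scaleQ :: "rat \<Rightarrow> linform \<Rightarrow> linform" where
  "scaleQ c f = Poly_Mapping.map (\<lambda>x. c * x) f"

lemma lookup_scaleQ [simp]: "Poly_Mapping.lookup (scaleQ c f) k = c * Poly_Mapping.lookup f k"
  unfolding scaleQ_def by transfer (simp add: when_def)

interpretation linform: vector_space scaleQ
  by standard (auto intro!: poly_mapping_eqI simp: Poly_Mapping.lookup_add algebra_simps)

text \<open>Since \<open>U m 1 = 0\<close>, the symbol \<open>Y 1\<close> stands for the zero form; the variables are those with index at least 2.\<close>

definition Y :: "nat \<Rightarrow> linform" where
  "Y k = (if k = 1 then 0 else Poly_Mapping.single k 1)"

definition U_relations :: "nat \<Rightarrow> linform set" where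
  "U_relations m = {f. Poly_Mapping.keys f \<subseteq> {2..m div 2} \<and>
     (\<Sum>k = 2..m div 2. of_rat (Poly_Mapping.lookup f k) * U m k) = 0}"

lemma subspace_U_relations: "linform.subspace (U_relations m)"
proof (rule linform.subspaceI)
  show "0 \<in> U_relations m"
    by (simp add: U_relations_def)
next
  fix f g assume "f \<in> U_relations m" "g \<in> U_relations m"
  thus "f + g \<in> U_relations m"
    using Poly_Mapping.keys_add[of f g]
    by (auto simp: U_relations_def Poly_Mapping.lookup_add of_rat_add distrib_right sum.distrib)
next
  fix c f assume f: "f \<in> U_relations m"
  have "Poly_Mapping.keys (scaleQ c f) \<subseteq> Poly_Mapping.keys f"
    by (auto simp: Poly_Mapping.in_keys_iff)
  thus "scaleQ c f \<in> U_relations m"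
    using f by (auto simp: U_relations_def of_rat_mult mult.assoc simp flip: sum_distrib_left)
qed

definition J :: "nat \<Rightarrow> nat \<Rightarrow> nat \<Rightarrow> nat set" where
  "J p n s = {j \<in> {1..p ^ n}. [j = 1] (mod p ^ s)}"

definition R :: "nat \<Rightarrow> nat \<Rightarrow> nat \<Rightarrow> nat \<Rightarrow> linform" where
  "R p n r k =
     - Y (p ^ r * k)
     + scaleQ ((of_nat p ^ r - 1) / (of_nat p - 1)) (Y p)
     + (\<Sum>j\<in>J p n (n - r). Y (red (p ^ n) (int (j * k))))
     - scaleQ ((of_nat p ^ r - 1) / (of_nat p - 1))
         (\<Sum>j\<in>J p n (n - 1). Y (red (p ^ n) (int j)))"

definition R_index :: "nat \<Rightarrow> nat \<Rightarrow> (nat \<times> nat) set" where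
  "R_index p n = {(r, k). r \<in> {1..n - 1} \<and> 1 \<le> k \<and> real k \<le> real (p ^ (n - r)) / 2 \<and>
     gcd k p = 1 \<and> (r = 1 \<longrightarrow> k > 1)}"

end

theory Submission
  imports
    "HOL-Analysis.Analysis"
    "HOL-Computational_Algebra.Computational_Algebra"
    "HOL-Number_Theory.Number_Theory"
    Defs
begin

text \<open>
  Put \<open>\<zeta> = exp (2\<pi>i/m)\<close> and \<open>\<ell>(a) = ln \<bar>1 - \<zeta>\<^sup>a\<bar>\<close>, so that \<open>U\<^sub>k ln 2 = \<ell>(k) - \<ell>(1)\<close>. Factoring \<open>1 - w\<^sup>q\<close> over
  the \<open>q\<close>-th roots of unity gives \<open>\<ell>(p\<^sup>r k) = \<Sum>\<ell>(jk)\<close> over \<open>j \<in> J\<^bsub>n-r\<^esub>\<close>, which turns every \<open>R\<^bsub>r,k\<^esub>\<close> into a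
  relation. Only \<open>R\<^bsub>r,k\<^esub>\<close> involves \<open>Y\<close> at \<open>p\<^sup>r k\<close>, so these forms are independent and eliminate all variables
  whose index is a multiple of \<open>p\<close> other than \<open>p\<close> itself. It remains to see that the \<open>\<ell>(k)\<close> with \<open>k \<le> m/2\<close>
  prime to \<open>p\<close> are linearly independent over \<open>\<rat>\<close>.

  Irreducibility of the cyclotomic polynomial makes the rational relations among them stable under
  \<open>k \<mapsto> ak\<close>. Since the units modulo \<open>m\<close> up to sign form a cyclic group, of order \<open>N\<close> and with generator \<open>g\<close>
  say, a discrete Fourier transform reduces the claim to \<open>\<Sum>\<^sub>i w\<^sup>i \<ell>(g\<^sup>i) \<noteq> 0\<close> for every \<open>N\<close>-th root of unity \<open>w\<close>.
  For \<open>w = 1\<close> this sum is \<open>ln p / 2\<close>. For \<open>w = -1\<close> its vanishing would make \<open>\<surd>p\<close> rational. For all other \<open>w\<close>,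
  \<open>L(1,\<chi>)\<close> is a multiple of it for an even character \<open>\<chi>\<close> with \<open>\<chi>\<^sup>2 \<noteq> 1\<close>, and \<open>L(1,\<chi>) \<noteq> 0\<close> follows from
  \<open>3 + 4 cos \<theta> + cos 2\<theta> \<ge> 0\<close>.
\<close>

section \<open>Nonvanishing of \<open>L(1,\<chi>)\<close> when \<open>\<chi>\<^sup>2\<close> is nonprincipal\<close>

lemma norm_sum_periodic_le:
  fixes f :: "nat \<Rightarrow> 'a :: real_normed_vector"
  assumes "m > 0" and per: "\<And>n. f (n + m) = f n" and zero: "(\<Sum>a<m. f a) = 0"
    and bound: "\<And>n. norm (f n) \<le> 1"
  shows "norm (\<Sum>k<n. f k) \<le> real m"
proof (induction n rule: less_induct)
  case (less n)
  show ?case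
  proof (cases "n < m")
    case True
    have "norm (\<Sum>k<n. f k) \<le> (\<Sum>k<n. 1)"
      by (rule sum_norm_le) (use bound in auto)
    with True show ?thesis by simp
  next
    case False
    have "(\<Sum>k<n. f k) = (\<Sum>k<m. f k) + (\<Sum>k=m..<n. f k)"
      using False by (simp add: lessThan_atLeast0 sum.atLeastLessThan_concat)
    also have "(\<Sum>k=m..<n. f k) = (\<Sum>k<n-m. f (k + m))"
      using sum.shift_bounds_nat_ivl[of f 0 m "n - m"] False by (simp add: lessThan_atLeast0)
    finally have "(\<Sum>k<n. f k) = (\<Sum>k<n-m. f k)" by (simp add: zero per)
    with less[of "n - m"] False \<open>m > 0\<close> show ?thesis by simp
  qed
qed

lemma sum_by_parts_lessThan:
  fixes f :: "nat \<Rightarrow> 'a :: real_normed_algebra_1" and u :: "nat \<Rightarrow> 'a"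
  shows "(\<Sum>k<n. f k * u k) =
    (\<Sum>k<n. f k) * u n + (\<Sum>k<n. (\<Sum>j\<le>k. f j) * (u k - u (Suc k)))"
proof (induction n)
  case (Suc n)
  show ?case
    unfolding sum.lessThan_Suc Suc.IH lessThan_Suc_atMost [symmetric]
    by (simp add: algebra_simps)
qed auto

text \<open>Summation by parts moves the differences onto \<open>u\<close>, while the partial sums
  of \<open>f\<close> stay bounded by \<open>m\<close>. So the series is at most \<open>m\<close>
  times the total variation of \<open>u\<close>, of which \<open>v\<close> is any summable majorant.
  The estimates for nonprincipal characters below are instances with different weights
  \<open>u\<close>.\<close>

lemma periodic_sum_variation_bound:
  fixes f :: "nat \<Rightarrow> complex" and u :: "nat \<Rightarrow> real"
  assumes "m > 0" and per: "\<And>n. f (n + m) = f n" and zero: "(\<Sum>a<m. f a) = 0"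
    and bound: "\<And>n. norm (f n) \<le> 1"
    and u0: "u \<longlonglongrightarrow> 0" and v: "\<And>n. \<bar>u n - u (Suc n)\<bar> \<le> v n" and sv: "summable v"
  shows "summable (\<lambda>n. f n * of_real (u n))"
    and "norm (suminf (\<lambda>n. f n * of_real (u n))) \<le> real m * suminf v"
proof -
  define g where "g k = (\<Sum>j\<le>k. f j) * (of_real (u k) - of_real (u (Suc k)))" for k
  note B = norm_sum_periodic_le[OF assms(1-4)]
  have g_le: "norm (g k) \<le> real m * v k" for k
  proof -
    have "norm (g k) = norm (\<Sum>j\<le>k. f j) * \<bar>u k - u (Suc k)\<bar>"
      by (simp add: g_def norm_mult flip: of_real_diff)
    also have "\<dots> \<le> real m * v k"
      using B[of "Suc k"] v[of k] by (intro mult_mono) (auto simp: lessThan_Suc_atMost)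
    finally show ?thesis .
  qed
  have sm: "summable (\<lambda>k. real m * v k)" using sv by (rule summable_mult)
  have sg: "summable g" by (rule summable_comparison_test'[OF sm, of 0]) (use g_le in auto)
  have "(\<lambda>n. (\<Sum>k<n. f k) * complex_of_real (u n)) \<longlonglongrightarrow> 0"
  proof (rule Lim_null_comparison)
    show "\<forall>\<^sub>F n in sequentially. norm ((\<Sum>k<n. f k) * complex_of_real (u n)) \<le> real m * \<bar>u n\<bar>"
      using B by (intro always_eventually allI) (auto simp: norm_mult intro!: mult_right_mono)
    show "(\<lambda>n. real m * \<bar>u n\<bar>) \<longlonglongrightarrow> 0"
      using tendsto_mult[OF tendsto_const[of "real m"] tendsto_rabs[OF u0]] by simp
  qed
  from tendsto_add[OF this summable_LIMSEQ[OF sg]]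
  have "(\<lambda>n. f n * of_real (u n)) sums suminf g"
    unfolding sums_def sum_by_parts_lessThan[of f "\<lambda>k. of_real (u k)"] by (simp add: g_def)
  then have eq: "suminf (\<lambda>n. f n * of_real (u n)) = suminf g"
    and s: "summable (\<lambda>n. f n * of_real (u n))" by (auto simp: sums_iff)
  show "summable (\<lambda>n. f n * of_real (u n))" by (fact s)
  have "norm (suminf g) \<le> (suminf (\<lambda>k. real m * v k))"
    by (rule norm_suminf_le[OF g_le sm])
  with eq show "norm (suminf (\<lambda>n. f n * of_real (u n))) \<le> real m * suminf v"
    using suminf_mult[OF sv] by simp
qed

section \<open>Euler products of completely multiplicative functions\<close>

lemma infsum_coprime_to_primes:
  fixes a :: "nat \<Rightarrow> complex"
  assumes mult: "\<And>x y. a (x * y) = a x * a y" and sm: "(\<lambda>n. norm (a n)) summable_on UNIV"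
    and "finite P" and "\<And>q. q \<in> P \<Longrightarrow> prime q"
  shows "infsum a {n. \<forall>q\<in>P. \<not> q dvd n} = (\<Prod>q\<in>P. 1 - a q) * infsum a UNIV"
  using assms(3,4)
proof (induction P rule: finite_induct)
  case (insert q P)
  define A where "A = {n. \<forall>q\<in>P. \<not> q dvd n}"
  have s: "a summable_on B" for B
    using sm Infinite_Sum.abs_summable_summable summable_on_subset_banach by blast
  have q: "prime q" "\<And>r. r \<in> P \<Longrightarrow> prime r" using insert by auto
  \<comment> \<open>The sieve step: as \<open>q\<close> is a prime outside \<open>P\<close>, the
    multiples of \<open>q\<close> in \<open>A\<close> are exactly the \<open>q * k\<close> with
    \<open>k\<close> in \<open>A\<close>. They carry \<open>a q\<close> times the sum over
    \<open>A\<close>, so removing them leaves the factor \<open>1 - a q\<close>.\<close>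
  have A: "A = {n. \<forall>r\<in>insert q P. \<not> r dvd n} \<union> (\<lambda>k. q * k) ` A"
  proof (intro equalityI subsetI)
    fix n assume n: "n \<in> A"
    show "n \<in> {n. \<forall>r\<in>insert q P. \<not> r dvd n} \<union> (\<lambda>k. q * k) ` A"
    proof (cases "q dvd n")
      case True
      then obtain k where k: "n = q * k" by auto
      with n have "k \<in> A" by (auto simp: A_def)
      with k show ?thesis by auto
    qed (use n in \<open>auto simp: A_def\<close>)
  next
    fix n assume "n \<in> {n. \<forall>r\<in>insert q P. \<not> r dvd n} \<union> (\<lambda>k. q * k) ` A"
    moreover have "\<not> r dvd q * k" if "k \<in> A" "r \<in> P" for r k
      using that q insert.hyps prime_dvd_mult_iff[of r q k] primes_dvd_imp_eq[of r q]
      by (auto simp: A_def)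
    ultimately show "n \<in> A" by (auto simp: A_def)
  qed
  have "infsum a A = infsum a {n. \<forall>r\<in>insert q P. \<not> r dvd n} + infsum a ((\<lambda>k. q * k) ` A)"
    by (subst A, rule infsum_Un_disjoint) (auto simp: s)
  also have "infsum a ((\<lambda>k. q * k) ` A) = infsum (a \<circ> (\<lambda>k. q * k)) A"
    by (rule infsum_reindex) (use q prime_gt_0_nat in \<open>auto intro!: inj_onI\<close>)
  also have "\<dots> = a q * infsum a A"
    by (simp add: o_def mult infsum_cmult_right' s)
  finally have "infsum a A - a q * infsum a A = infsum a {n. \<forall>r\<in>insert q P. \<not> r dvd n}"
    by (metis add_diff_cancel_right')
  then have "infsum a {n. \<forall>r\<in>insert q P. \<not> r dvd n} = (1 - a q) * infsum a A"
    unfolding left_diff_distrib mult_1 by (rule sym)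
  also have "infsum a A = (\<Prod>q\<in>P. 1 - a q) * infsum a UNIV"
    unfolding A_def by (rule insert.IH) (use q in auto)
  finally show ?case using insert.hyps by simp
qed auto

text \<open>The numbers without a prime factor up to \<open>N\<close> are 1 and some numbers above
  \<open>N\<close>, so the sieved sum differs from 1 by at most a tail of the series. Stating the
  Euler product for the reciprocal avoids infinite products and divisions.\<close>

lemma euler_product_inverse_tendsto:
  fixes a :: "nat \<Rightarrow> complex"
  assumes mult: "\<And>x y. a (x * y) = a x * a y" and "a 0 = 0" and "a 1 = 1"
    and sm: "summable (\<lambda>n. norm (a n))"
  shows "(\<lambda>N. (\<Prod>q | prime q \<and> q \<le> N. 1 - a q) * suminf a) \<longlonglongrightarrow> 1"
proof -
  have abs: "(\<lambda>n. norm (a n)) summable_on UNIV"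
    using sm by (simp add: summable_on_UNIV_nonneg_real_iff)
  have s: "a summable_on B" for B
    using abs Infinite_Sum.abs_summable_summable summable_on_subset_banach by blast
  have su: "infsum a UNIV = suminf a"
    using has_sum_imp_sums[OF has_sum_infsum[OF s]] by (simp add: sums_iff)
  have "(\<lambda>N. (\<Prod>q | prime q \<and> q \<le> N. 1 - a q) * suminf a - 1) \<longlonglongrightarrow> 0"
  proof (rule Lim_null_comparison)
    show "\<forall>\<^sub>F N in sequentially. norm ((\<Prod>q | prime q \<and> q \<le> N. 1 - a q) * suminf a - 1)
        \<le> (suminf (\<lambda>n. norm (a (n + Suc N))))"
    \<comment> \<open>From 2 on the prime 2 belongs to \<open>P\<close>, which keeps 0 out of
      \<open>C\<close>.\<close>
    proof (intro eventually_sequentiallyI[of 2])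
      fix N :: nat assume N: "N \<ge> 2"
      define P where "P = {q. prime q \<and> q \<le> N}"
      define C where "C = {n. \<forall>q\<in>P. \<not> q dvd n}"
      have fin: "finite P" unfolding P_def by simp
      have C: "C = insert 1 (C \<inter> {N<..})"
      proof (intro equalityI subsetI)
        fix n assume n: "n \<in> C"
        show "n \<in> insert 1 (C \<inter> {N<..})"
        proof (cases "n = 1")
          case False
          then obtain q where q: "prime q" "q dvd n" using prime_factor_nat by blast
          have "n \<noteq> 0"
            using n N two_is_prime_nat by (cases n) (auto simp: C_def P_def)
          with q have "q \<le> n" by (auto dest: dvd_imp_le)
          moreover have "q > N" using n q not_le by (auto simp: C_def P_def)
          ultimately show ?thesis using n by auto
        qed auto
      qed (auto simp: C_def P_def)
      have "(\<Prod>q\<in>P. 1 - a q) * suminf a = infsum a C"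
        using infsum_coprime_to_primes[OF mult abs fin] by (simp add: C_def P_def su)
      also have "infsum a C = 1 + infsum a (C \<inter> {N<..})"
        by (subst C, subst infsum_insert) (use s N assms in auto)
      finally have "norm ((\<Prod>q\<in>P. 1 - a q) * suminf a - 1) = norm (infsum a (C \<inter> {N<..}))"
        by simp
      also have "\<dots> \<le> infsum (\<lambda>n. norm (a n)) (C \<inter> {N<..})"
        using abs by (intro norm_infsum_bound summable_on_subset_banach[OF abs]) auto
      also have "\<dots> \<le> infsum (\<lambda>n. norm (a n)) {N<..}"
        using abs by (intro infsum_mono_neutral summable_on_subset_banach[OF abs]) auto
      also have "{N<..} = range (\<lambda>n. n + Suc N)"
      proof (intro equalityI subsetI)
        fix n assume "n \<in> {N<..}"
        then have "n = (n - Suc N) + Suc N" by auto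
        then show "n \<in> range (\<lambda>n. n + Suc N)" by blast
      qed auto
      also have "infsum (\<lambda>n. norm (a n)) (range (\<lambda>n. n + Suc N)) = infsum (\<lambda>n. norm (a (n + Suc N))) UNIV"
        by (subst infsum_reindex) (auto simp: o_def intro!: injI)
      also have "\<dots> = (suminf (\<lambda>n. norm (a (n + Suc N))))"
      proof -
        have "(\<lambda>n. norm (a (n + Suc N))) summable_on UNIV"
          using sm summable_iff_shift[of "\<lambda>n. norm (a n)" "Suc N"]
          by (simp add: summable_on_UNIV_nonneg_real_iff)
        from has_sum_imp_sums[OF has_sum_infsum[OF this]] show ?thesis by (simp add: sums_iff)
      qed
      finally show "norm ((\<Prod>q | prime q \<and> q \<le> N. 1 - a q) * suminf a - 1)
        \<le> (suminf (\<lambda>n. norm (a (n + Suc N))))" by (simp add: P_def)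
    qed
    show "(\<lambda>N. suminf (\<lambda>n. norm (a (n + Suc N)))) \<longlonglongrightarrow> 0"
      using LIMSEQ_Suc[OF suminf_exist_split2[OF sm]] by simp
  qed
  then show ?thesis by (simp add: LIM_zero_iff)
qed

text \<open>Real part of the Mercator series. The term at \<open>n = 0\<close> is 0 because division
  by zero yields 0.\<close>

lemma ln_norm_one_minus_sums:
  fixes w :: complex
  assumes "norm w < 1"
  shows "(\<lambda>n. - (Re (w ^ n) / real n)) sums ln (norm (1 - w))"
proof -
  have "(\<lambda>n. - ((- (- w)) ^ n) / of_nat n) sums ln (1 + (- w))"
    by (rule Ln_series') (use assms in simp)
  then have "(\<lambda>n. Re (- (w ^ n) / of_nat n)) sums Re (ln (1 - w))"
    by (intro sums_Re) simp
  moreover have "1 - w \<noteq> 0" using assms by auto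
  ultimately show ?thesis by (simp add: Re_divide_of_nat)
qed

text \<open>The logarithm of the product is minus a series of nonnegative multiples of 3 + 4 cos t +
  cos 2t = 2 (1 + cos t)^2, where t is \<open>n\<close> times the argument of \<open>z\<close>. The
  case \<open>z = 0\<close> serves the primes dividing the modulus.\<close>

lemma three_four_one:
  fixes z :: complex and r :: real
  assumes "norm z = 1 \<or> z = 0" and "0 \<le> r" "r < 1"
  shows "norm ((1 - of_real r) ^ 3 * (1 - z * of_real r) ^ 4 * (1 - z\<^sup>2 * of_real r)) \<le> 1"
proof (cases "z = 0")
  case True
  have "norm (1 - complex_of_real r) = 1 - r"
    using assms norm_of_real[of "1 - r", where ?'a = complex] by simp
  then show ?thesis using True assms by (simp add: norm_power power_le_one)
next
  case False
  with assms have z: "norm z = 1" by auto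
  define A where "A = norm (1 - complex_of_real r)"
  define B where "B = norm (1 - z * of_real r)"
  define C where "C = norm (1 - z\<^sup>2 * of_real r)"
  have n: "norm (complex_of_real r) < 1" "norm (z * of_real r) < 1" "norm (z\<^sup>2 * of_real r) < 1"
    using assms z by (auto simp: norm_mult norm_power)
  have pos: "A > 0" "B > 0" "C > 0"
    using n unfolding A_def B_def C_def by (metis less_irrefl norm_one right_minus_eq zero_less_norm_iff)+
  have "(\<lambda>n. 3 * (- (Re (of_real r ^ n) / real n)) + 4 * (- (Re ((z * of_real r) ^ n) / real n))
       + (- (Re ((z\<^sup>2 * of_real r) ^ n) / real n))) sums (3 * ln A + 4 * ln B + ln C)"
    unfolding A_def B_def C_def
    by (intro sums_add sums_mult ln_norm_one_minus_sums n)
  moreover have "3 * (- (Re (of_real r ^ n) / real n)) + 4 * (- (Re ((z * of_real r) ^ n) / real n))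
       + (- (Re ((z\<^sup>2 * of_real r) ^ n) / real n)) \<le> 0" for n
  proof -
    define x where "x = z ^ n"
    have x: "(Re x)\<^sup>2 + (Im x)\<^sup>2 = 1"
      using z by (simp add: x_def norm_power flip: cmod_power2)
    have "3 + 4 * Re x + Re (x\<^sup>2) = 2 * (1 + Re x)\<^sup>2"
      using x by (simp add: power2_eq_square algebra_simps)
    then have "0 \<le> (3 + 4 * Re x + Re (x\<^sup>2)) * r ^ n / real n"
      using assms by simp
    also have "(3 + 4 * Re x + Re (x\<^sup>2)) * r ^ n / real n = 3 * (Re (of_real r ^ n) / real n)
        + 4 * (Re ((z * of_real r) ^ n) / real n) + (Re ((z\<^sup>2 * of_real r) ^ n) / real n)"
      by (simp add: x_def power_mult_distrib power_mult [symmetric] mult.commute[of 2]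
            ring_distribs add_divide_distrib flip: of_real_power)
    finally show ?thesis by simp
  qed
  ultimately have "3 * ln A + 4 * ln B + ln C \<le> 0"
    by (rule sums_le[OF _ _ sums_zero, rotated]) 
  moreover have "ln (A ^ 3 * B ^ 4 * C) = 3 * ln A + 4 * ln B + ln C"
    using pos by (simp add: ln_mult ln_realpow)
  ultimately have "A ^ 3 * B ^ 4 * C \<le> 1"
    using pos by (metis ln_le_zero_iff mult_pos_pos zero_less_power)
  then show ?thesis by (simp add: A_def B_def C_def norm_mult norm_power)
qed

text \<open>Mean value theorem for \<open>w\<close>. The factor \<open>s - 1\<close> will show that
  a series vanishing at 1 is of order \<open>s - 1\<close> nearby; the exponent -3/2 is a summable
  substitute for ln t / t^2.\<close>

lemma powr_variation_le:
  fixes s t :: real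
  assumes s: "1 < s" "s \<le> 2" and t: "1 \<le> t"
  shows "\<bar>(1 / t - t powr -s) - (1 / (t + 1) - (t + 1) powr -s)\<bar> \<le> 5 * (s - 1) * t powr (-3/2)"
proof -
  define w where "w x = 1 / x - x powr -s" for x :: real
  define w' where "w' x = - 1 / x\<^sup>2 + s * x powr (- s - 1)" for x :: real
  have der: "(w has_real_derivative w' x) (at x)" if "x > 0" for x
    unfolding w_def w'_def using that
    by (auto intro!: derivative_eq_intros simp: power2_eq_square)
  obtain x where x: "t < x" "x < t + 1" "w (t + 1) - w t = (t + 1 - t) * w' x"
    using MVT2[of t "t + 1" w w'] der t by auto
  have x1: "x > 1" using x t by simp
  have "x powr (- s - 1) = x powr (1 - s) / x\<^sup>2"
    using x1 by (simp add: powr_diff powr_minus divide_simps power2_eq_square)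
  then have "w' x = ((s - 1) - s * (1 - x powr (1 - s))) / x\<^sup>2"
    by (simp add: w'_def right_diff_distrib diff_divide_distrib add_divide_distrib)
  \<comment> \<open>Here 1 - x^(1-s) is at most (s - 1) ln x, hence at most 2 (s - 1) sqrt x. With
    \<open>s \<le> 2\<close> and 1 \<le> sqrt x the constants add up to 1 + 4 = 5.\<close>
  moreover have "\<bar>(s - 1) - s * (1 - x powr (1 - s))\<bar> \<le> 5 * (s - 1) * sqrt x"
  proof -
    have e: "1 - x powr (1 - s) \<le> (s - 1) * ln x"
      using exp_ge_add_one_self[of "(1 - s) * ln x"] x1 by (simp add: powr_def algebra_simps)
    have e0: "1 - x powr (1 - s) \<ge> 0"
      using powr_mono[of "1 - s" 0 x] s x1 by simp
    have "ln (sqrt x) \<le> sqrt x - 1"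
      using x1 by (intro ln_le_minus_one) auto
    then have l: "ln x \<le> 2 * sqrt x" using x1 by (simp add: ln_sqrt)
    have "\<bar>(s - 1) - s * (1 - x powr (1 - s))\<bar> \<le> (s - 1) + s * (1 - x powr (1 - s))"
      using e0 s by (simp add: abs_le_iff)
    also have "s * (1 - x powr (1 - s)) \<le> 2 * ((s - 1) * ln x)"
      using e e0 s by (intro mult_mono) auto
    also have "(s - 1) * ln x \<le> (s - 1) * (2 * sqrt x)"
      using l s by (intro mult_left_mono) auto
    also have "(s - 1) + 2 * ((s - 1) * (2 * sqrt x)) \<le> (s - 1) * sqrt x + 2 * ((s - 1) * (2 * sqrt x))"
      using s x1 by simp
    finally show ?thesis by (simp add: algebra_simps)
  qed
  ultimately have "\<bar>w' x\<bar> \<le> 5 * (s - 1) * sqrt x / x\<^sup>2"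
    by (simp add: divide_right_mono)
  also have "sqrt x / x\<^sup>2 = x powr (-3/2)"
  proof -
    have "x powr (-3/2) = x powr (1/2) / x powr 2"
      by (simp flip: powr_diff)
    then show ?thesis using x1 by (simp add: powr_half_sqrt)
  qed
  then have "5 * (s - 1) * sqrt x / x\<^sup>2 = 5 * (s - 1) * x powr (-3/2)"
    by (metis times_divide_eq_right)
  also have "x powr (-3/2) \<le> t powr (-3/2)"
    using x t by (intro powr_mono2') auto
  finally have "\<bar>w' x\<bar> \<le> 5 * (s - 1) * t powr (-3/2)"
    using s by simp
  then show ?thesis using x(3) by (simp add: w_def)
qed

text \<open>Comparison with the integral of x^(-s), done by the mean value theorem and telescoping.
  The bound says that the pole at 1 is at most simple.\<close>

lemma suminf_powr_le:
  fixes s :: real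
  assumes s: "s > 1"
  shows "summable (\<lambda>n. real (Suc n) powr -s)" "(suminf (\<lambda>n. real (Suc n) powr -s)) \<le> 1 + 1 / (s - 1)"
proof -
  show sm: "summable (\<lambda>n. real (Suc n) powr -s)"
    using summable_Suc_iff[of "\<lambda>n. real n powr -s"] s by (simp add: summable_real_powr_iff)
  have step: "real (Suc (Suc n)) powr -s \<le> (real (Suc n) powr (1 - s) - real (Suc (Suc n)) powr (1 - s)) / (s - 1)"
    for n
  proof -
    define w where "w x = - (x powr (1 - s))" for x :: real
    have "(w has_real_derivative (s - 1) * x powr -s) (at x)" if "x > 0" for x
      unfolding w_def using that by (auto intro!: derivative_eq_intros simp: algebra_simps)
    then obtain x where x: "real (Suc n) < x" "x < real (Suc (Suc n))"
      "w (real (Suc (Suc n))) - w (real (Suc n)) = (real (Suc (Suc n)) - real (Suc n)) * ((s - 1) * x powr -s)"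
      using MVT2[of "real (Suc n)" "real (Suc (Suc n))" w "\<lambda>x. (s - 1) * x powr -s"] by auto
    have "real (Suc (Suc n)) powr -s \<le> x powr -s"
      using x s by (intro powr_mono2') auto
    also have "x powr -s = (real (Suc n) powr (1 - s) - real (Suc (Suc n)) powr (1 - s)) / (s - 1)"
      using x(3) s by (simp add: w_def field_simps)
    finally show ?thesis .
  qed
  have part: "(\<Sum>k<Suc n. real (Suc k) powr -s) \<le> 1 + (1 - real (Suc n) powr (1 - s)) / (s - 1)" for n
  proof (induction n)
    case (Suc n)
    have "(\<Sum>k<Suc (Suc n). real (Suc k) powr -s)
        \<le> 1 + (1 - real (Suc n) powr (1 - s)) / (s - 1)
          + (real (Suc n) powr (1 - s) - real (Suc (Suc n)) powr (1 - s)) / (s - 1)"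
      using add_mono[OF Suc.IH step[of n]] by simp
    also have "\<dots> = 1 + (1 - real (Suc (Suc n)) powr (1 - s)) / (s - 1)"
      by (simp add: diff_divide_distrib)
    finally show ?case .
  qed simp
  show "(suminf (\<lambda>n. real (Suc n) powr -s)) \<le> 1 + 1 / (s - 1)"
  proof (rule suminf_le_const[OF sm])
    fix n
    have "(\<Sum>k<n. real (Suc k) powr -s) \<le> (\<Sum>k<Suc n. real (Suc k) powr -s)"
      by simp
    also have "\<dots> \<le> 1 + (1 - real (Suc n) powr (1 - s)) / (s - 1)" by (rule part)
    also have "\<dots> \<le> 1 + 1 / (s - 1)"
      using s by (simp add: divide_right_mono)
    finally show "(\<Sum>k<n. real (Suc k) powr -s) \<le> 1 + 1 / (s - 1)" .
  qed
qed

text \<open>By \<open>three_four_one\<close> the reciprocal Euler factors, taken with exponents 3, 4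
  and 1, have a product of norm at most 1; multiplied by the corresponding powers of the series it
  tends to 1.\<close>

lemma dirichlet_series_product_ge_1:
  fixes \<psi> :: "nat \<Rightarrow> complex" and s :: real
  defines "D \<equiv> \<lambda>f :: nat \<Rightarrow> complex. suminf (\<lambda>n. f (Suc n) * of_real (real (Suc n) powr -s))"
  assumes mult: "\<And>x y. \<psi> (x * y) = \<psi> x * \<psi> y" and "\<psi> 1 = 1"
    and norm: "\<And>n. norm (\<psi> n) = 1 \<or> \<psi> n = 0" and s: "s > 1"
  shows "norm (D (\<lambda>_. 1) ^ 3 * D \<psi> ^ 4 * D (\<lambda>n. (\<psi> n)\<^sup>2)) \<ge> 1"
proof -
  define E where "E f N = (\<Prod>q | prime q \<and> q \<le> N. 1 - f q * complex_of_real (real q powr -s))"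
    for f :: "nat \<Rightarrow> complex" and N :: nat
  have lim: "(\<lambda>N. E f N * D f) \<longlonglongrightarrow> 1"
    if f: "\<And>x y. f (x * y) = f x * f y" "f 1 = 1" "\<And>n. norm (f n) \<le> 1" for f
  proof -
    define a where "a n = f n * complex_of_real (real n powr -s)" for n
    have sm: "summable (\<lambda>n. norm (a n))"
    proof (rule summable_comparison_test'[of "\<lambda>n. real n powr -s" 0])
      show "summable (\<lambda>n. real n powr -s)" using s by (simp add: summable_real_powr_iff)
      show "norm (norm (a n)) \<le> real n powr -s" for n
        using mult_right_mono[OF f(3)[of n], of "real n powr -s"] by (simp add: a_def norm_mult)
    qed
    have "a (x * y) = a x * a y" for x y
      by (simp add: a_def f powr_mult)
    then have "(\<lambda>N. (\<Prod>q | prime q \<and> q \<le> N. 1 - a q) * suminf a) \<longlonglongrightarrow> 1"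
      by (rule euler_product_inverse_tendsto) (use sm f(2) in \<open>auto simp: a_def\<close>)
    moreover have "suminf a = D f"
      using suminf_split_head[OF summable_norm_cancel[OF sm]] unfolding a_def D_def by simp
    ultimately show ?thesis by (simp add: a_def E_def)
  qed
  have n1: "norm (\<psi> n) \<le> 1" "norm ((\<psi> n)\<^sup>2) \<le> 1" for n
    using norm[of n] by (auto simp: norm_power)
  have "(\<lambda>N. (E (\<lambda>_. 1) N * D (\<lambda>_. 1)) ^ 3 * (E \<psi> N * D \<psi>) ^ 4 * (E (\<lambda>n. (\<psi> n)\<^sup>2) N * D (\<lambda>n. (\<psi> n)\<^sup>2)))
      \<longlonglongrightarrow> 1 ^ 3 * 1 ^ 4 * 1"
    using assms n1 by (intro tendsto_mult tendsto_power lim) (auto simp: power_mult_distrib)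
  then have "(\<lambda>N. norm ((E (\<lambda>_. 1) N * D (\<lambda>_. 1)) ^ 3 * (E \<psi> N * D \<psi>) ^ 4
      * (E (\<lambda>n. (\<psi> n)\<^sup>2) N * D (\<lambda>n. (\<psi> n)\<^sup>2)))) \<longlonglongrightarrow> 1"
    using tendsto_norm by fastforce
  then show ?thesis
  proof (rule tendsto_upperbound, intro always_eventually allI)
    fix N
    have "E (\<lambda>_. 1) N ^ 3 * E \<psi> N ^ 4 * E (\<lambda>n. (\<psi> n)\<^sup>2) N =
      (\<Prod>q | prime q \<and> q \<le> N. (1 - of_real (real q powr -s)) ^ 3
        * (1 - \<psi> q * of_real (real q powr -s)) ^ 4 * (1 - (\<psi> q)\<^sup>2 * of_real (real q powr -s)))"
      unfolding E_def by (simp add: prod.distrib prod_power_distrib)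
    also have "norm \<dots> \<le> 1"
      unfolding prod_norm [symmetric]
    proof (intro prod_le_1 conjI norm_ge_zero three_four_one norm)
      fix q assume "q \<in> {q. prime q \<and> q \<le> N}"
      then have "q > 1" using prime_gt_1_nat by auto
      then show "real q powr -s < 1"
        using powr_less_one[of "real q" "-s"] s by auto
    qed auto
    finally have E: "norm (E (\<lambda>_. 1) N ^ 3 * E \<psi> N ^ 4 * E (\<lambda>n. (\<psi> n)\<^sup>2) N) \<le> 1" .
    have "norm ((E (\<lambda>_. 1) N * D (\<lambda>_. 1)) ^ 3 * (E \<psi> N * D \<psi>) ^ 4
        * (E (\<lambda>n. (\<psi> n)\<^sup>2) N * D (\<lambda>n. (\<psi> n)\<^sup>2)))
      = norm (E (\<lambda>_. 1) N ^ 3 * E \<psi> N ^ 4 * E (\<lambda>n. (\<psi> n)\<^sup>2) N)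
        * norm (D (\<lambda>_. 1) ^ 3 * D \<psi> ^ 4 * D (\<lambda>n. (\<psi> n)\<^sup>2))"
      by (simp add: norm_mult power_mult_distrib)
    also have "\<dots> \<le> 1 * norm (D (\<lambda>_. 1) ^ 3 * D \<psi> ^ 4 * D (\<lambda>n. (\<psi> n)\<^sup>2))"
      by (intro mult_right_mono E norm_ge_zero)
    finally show "norm ((E (\<lambda>_. 1) N * D (\<lambda>_. 1)) ^ 3 * (E \<psi> N * D \<psi>) ^ 4
        * (E (\<lambda>n. (\<psi> n)\<^sup>2) N * D (\<lambda>n. (\<psi> n)\<^sup>2)))
      \<le> norm (D (\<lambda>_. 1) ^ 3 * D \<psi> ^ 4 * D (\<lambda>n. (\<psi> n)\<^sup>2))" by simp
  qed simp
qed

lemma L_one_summable: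
  fixes \<psi> :: "nat \<Rightarrow> complex"
  assumes "m > 0" and per: "\<And>n. \<psi> (n + m) = \<psi> n" and zero: "(\<Sum>a<m. \<psi> (Suc a)) = 0"
    and "\<And>n. norm (\<psi> n) \<le> 1"
  shows "summable (\<lambda>n. \<psi> (Suc n) * of_real (1 / real (Suc n)))"
proof (rule periodic_sum_variation_bound(1)[of m "\<lambda>n. \<psi> (Suc n)"])
  show "(\<lambda>n. 1 / real (Suc n)) \<longlonglongrightarrow> 0" by (rule LIMSEQ_inverse_real_of_nat[unfolded inverse_eq_divide])
  show "\<bar>1 / real (Suc n) - 1 / real (Suc (Suc n))\<bar> \<le> real (Suc n) powr -2" for n
    by (simp add: powr_minus divide_simps power2_eq_square)
  show "summable (\<lambda>n. real (Suc n) powr -2)" by (rule suminf_powr_le) simp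
qed (use assms per[of "Suc _"] in auto)

text \<open>
  A zero at \<open>s = 1\<close> would enter with multiplicity four, against the triple pole of the factor with
  the trivial character, contradicting \<open>dirichlet_series_product_ge_1\<close>.
\<close>

theorem L_one_nonzero:
  fixes \<psi> :: "nat \<Rightarrow> complex"
  assumes m: "m > 0" and mult: "\<And>x y. \<psi> (x * y) = \<psi> x * \<psi> y" and "\<psi> 1 = 1"
    and norm: "\<And>n. norm (\<psi> n) = 1 \<or> \<psi> n = 0"
    and per: "\<And>n. \<psi> (n + m) = \<psi> n" and zero: "(\<Sum>a<m. \<psi> (Suc a)) = 0"
    and zero2: "(\<Sum>a<m. (\<psi> (Suc a))\<^sup>2) = 0"
  shows "(suminf (\<lambda>n. \<psi> (Suc n) * of_real (1 / real (Suc n)))) \<noteq> 0"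
proof
  assume L: "(suminf (\<lambda>n. \<psi> (Suc n) * of_real (1 / real (Suc n)))) = 0"
  define D where "D f s = (suminf (\<lambda>n. f (Suc n) * complex_of_real (real (Suc n) powr -s)))" for f s
  define c where "c = (suminf (\<lambda>n. real (Suc n) powr (-3/2)))"
  have sm: "summable (\<lambda>n. real (Suc n) powr (-3/2))"
    using suminf_powr_le(1)[of "3/2"] by simp
  have c0: "c \<ge> 0" unfolding c_def by (intro suminf_nonneg sm) simp
  have n1: "norm (\<psi> n) \<le> 1" "norm ((\<psi> n)\<^sup>2) \<le> 1" for n
    using norm[of n] by (auto simp: norm_power)
  have per': "\<psi> (Suc (n + m)) = \<psi> (Suc n)" for n using per[of "Suc n"] by simp
  have lim: "(\<lambda>n. real (Suc n) powr -s) \<longlonglongrightarrow> 0" if "s > 0" for s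
    using filterlim_compose[OF filterlim_real_sequentially filterlim_Suc] that
    by (intro tendsto_neg_powr) auto
  have lim1: "(\<lambda>n. 1 / real (Suc n)) \<longlonglongrightarrow> 0"
    by (rule LIMSEQ_inverse_real_of_nat[unfolded inverse_eq_divide])
  have b1: "norm (D (\<lambda>_. 1) s) \<le> 2 / (s - 1)" if s: "1 < s" "s \<le> 2" for s
  proof -
    have "D (\<lambda>_. 1) s = of_real (suminf (\<lambda>n. real (Suc n) powr -s))"
      unfolding D_def using suminf_powr_le(1)[OF s(1)] by (simp add: suminf_of_real)
    then have "norm (D (\<lambda>_. 1) s) = (suminf (\<lambda>n. real (Suc n) powr -s))"
      using suminf_nonneg[OF suminf_powr_le(1)[OF s(1)]] by simp
    also have "\<dots> \<le> 1 + 1 / (s - 1)" by (rule suminf_powr_le) fact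
    also have "\<dots> = s / (s - 1)" using s by (simp add: field_simps)
    also have "\<dots> \<le> 2 / (s - 1)" using s by (intro divide_right_mono) auto
    finally show ?thesis .
  qed
  \<comment> \<open>The weights decrease from 1 to 0, so their total variation is 1 for every
    \<open>s\<close>.\<close>
  have b2: "norm (D (\<lambda>n. (\<psi> n)\<^sup>2) s) \<le> real m" if s: "1 < s" "s \<le> 2" for s
  proof -
    define u where "u n = real (Suc n) powr -s" for n
    have u: "u \<longlonglongrightarrow> 0" unfolding u_def using s by (intro lim) auto
    have "\<bar>u n - u (Suc n)\<bar> \<le> u n - u (Suc n)" for n
      using s by (auto simp: u_def intro!: powr_mono2')
    from periodic_sum_variation_bound(2)[of m "\<lambda>n. (\<psi> (Suc n))\<^sup>2", OF m _ zero2 n1(2) u this]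
    have "norm (suminf (\<lambda>n. (\<psi> (Suc n))\<^sup>2 * complex_of_real (u n))) \<le> real m * (suminf (\<lambda>n. u n - u (Suc n)))"
      using telescope_summable'[OF u] per' by simp
    also have "(suminf (\<lambda>n. u n - u (Suc n))) = 1"
      using telescope_sums'[OF u] by (simp add: sums_iff u_def)
    finally show ?thesis by (simp add: D_def u_def)
  qed
  \<comment> \<open>Subtracting from the series at 1, which vanishes by assumption, replaces the
    weight by \<open>u\<close>, whose variation is of order \<open>s - 1\<close>.\<close>
  have b3: "norm (D \<psi> s) \<le> real m * 5 * c * (s - 1)" if s: "1 < s" "s \<le> 2" for s
  proof -
    define u where "u n = 1 / real (Suc n) - real (Suc n) powr -s" for n
    have u: "u \<longlonglongrightarrow> 0"
      unfolding u_def using s tendsto_diff[OF lim1 lim[of s]] by simp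
    have v: "\<bar>u n - u (Suc n)\<bar> \<le> 5 * (s - 1) * real (Suc n) powr (-3/2)" for n
      using powr_variation_le[OF s, of "real (Suc n)"] by (simp add: u_def add_ac)
    note P = periodic_sum_variation_bound[of m "\<lambda>n. \<psi> (Suc n)", OF m per' zero n1(1) u v summable_mult[OF sm]]
    have "(suminf (\<lambda>n. \<psi> (Suc n) * complex_of_real (1 / real (Suc n)))) - (suminf (\<lambda>n. \<psi> (Suc n) * complex_of_real (u n)))
       = (suminf (\<lambda>n. \<psi> (Suc n) * complex_of_real (1 / real (Suc n)) - \<psi> (Suc n) * complex_of_real (u n)))"
      by (rule suminf_diff[OF L_one_summable[OF m per zero n1(1)] P(1)])
    also have "\<dots> = D \<psi> s"
      unfolding D_def u_def by (simp add: algebra_simps)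
    finally have "norm (D \<psi> s) = norm (suminf (\<lambda>n. \<psi> (Suc n) * complex_of_real (u n)))"
      using L by (metis diff_0 norm_minus_cancel)
    also note P(2)
    also have "(suminf (\<lambda>n. 5 * (s - 1) * real (Suc n) powr (-3/2))) = 5 * (s - 1) * c"
      unfolding c_def by (rule suminf_mult[OF sm])
    finally show ?thesis by (simp add: mult_ac)
  qed
  define K where "K = 8 * (real m * 5 * c) ^ 4 * real m"
  have gen: "(2 / t) ^ 3 * (a * t) ^ 4 * b = 8 * a ^ 4 * b * t" if "t \<noteq> 0" for a b t :: real
    using that by (simp add: field_simps power3_eq_cube power4_eq_xxxx)
  have K0: "K \<ge> 0" unfolding K_def using c0 by simp
  have main: "1 \<le> K * (s - 1)" if s: "1 < s" "s \<le> 2" for s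
  proof -
    have "1 \<le> norm (D (\<lambda>_. 1) s ^ 3 * D \<psi> s ^ 4 * D (\<lambda>n. (\<psi> n)\<^sup>2) s)"
      unfolding D_def by (rule dirichlet_series_product_ge_1) (use assms s in auto)
    also have "\<dots> = norm (D (\<lambda>_. 1) s) ^ 3 * norm (D \<psi> s) ^ 4 * norm (D (\<lambda>n. (\<psi> n)\<^sup>2) s)"
      by (simp add: norm_mult norm_power)
    also have "\<dots> \<le> (2 / (s - 1)) ^ 3 * (real m * 5 * c * (s - 1)) ^ 4 * real m"
      using s c0 by (intro mult_mono power_mono b1 b2 b3) auto
    also have "\<dots> = K * (s - 1)"
      using s by (subst gen) (auto simp: K_def)
    finally show ?thesis .
  qed
  \<comment> \<open>The choice \<open>s = 1 + 1 / (K + 1)\<close> makes the right-hand side of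
    \<open>main\<close> smaller than 1.\<close>
  have "1 \<le> K * (1 / (K + 1))"
    using main[of "1 + 1 / (K + 1)"] K0 by (simp add: field_simps)
  then show False using K0 by (simp add: field_simps)
qed

text \<open>Abel's limit theorem with a rate: the difference has weights (1 - x^n)/n, which decrease
  from 1 - x to 0 and so have total variation 1 - x.\<close>

lemma L_one_abel:
  fixes \<psi> :: "nat \<Rightarrow> complex" and x :: real
  assumes m: "m > 0" and per: "\<And>n. \<psi> (n + m) = \<psi> n" and zero: "(\<Sum>a<m. \<psi> (Suc a)) = 0"
    and norm: "\<And>n. norm (\<psi> n) \<le> 1" and x: "0 \<le> x" "x < 1"
  shows "norm ((suminf (\<lambda>n. \<psi> (Suc n) * of_real (1 / real (Suc n)))) -
    (suminf (\<lambda>n. \<psi> (Suc n) * of_real (x ^ Suc n / real (Suc n))))) \<le> real m * (1 - x)"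
proof -
  define u where "u n = (1 - x ^ Suc n) / real (Suc n)" for n
  have u: "u \<longlonglongrightarrow> 0"
  proof (rule Lim_null_comparison)
    show "\<forall>\<^sub>F n in sequentially. norm (u n) \<le> 1 / real (Suc n)"
      using x power_le_one[of x] by (intro always_eventually allI) (auto simp: u_def divide_right_mono simp del: power_Suc)
    show "(\<lambda>n. 1 / real (Suc n)) \<longlonglongrightarrow> 0" by (rule LIMSEQ_inverse_real_of_nat[unfolded inverse_eq_divide])
  qed
  have "u (Suc n) \<le> u n" for n
  proof -
    \<comment> \<open>\<open>u n\<close> is \<open>1 - x\<close> times the average of 1, x, ...,
      x^n. The next power is at most this average, so the averages decrease.\<close>
    have "real (Suc n) * x ^ Suc n \<le> (\<Sum>k<Suc n. x ^ k)"
      using sum_bounded_below[of "{..<Suc n}" "x ^ Suc n" "\<lambda>k. x ^ k"] x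
      by (simp add: power_decreasing del: sum.lessThan_Suc power_Suc)
    then have "(1 - x) * (real (Suc n) * x ^ Suc n) \<le> (1 - x) * (\<Sum>k<Suc n. x ^ k)"
      using x by (intro mult_left_mono) auto
    also have "\<dots> = 1 - x ^ Suc n"
      using one_diff_power_eq[of x "Suc n"] by simp
    finally show ?thesis unfolding u_def by (simp add: field_simps)
  qed
  then have v: "\<bar>u n - u (Suc n)\<bar> \<le> u n - u (Suc n)" for n by simp
  have per': "\<psi> (Suc (n + m)) = \<psi> (Suc n)" for n using per[of "Suc n"] by simp
  note P = periodic_sum_variation_bound[of m "\<lambda>n. \<psi> (Suc n)", OF m per' zero norm u v telescope_summable'[OF u]]
  have "(suminf (\<lambda>n. \<psi> (Suc n) * of_real (1 / real (Suc n)))) - (suminf (\<lambda>n. \<psi> (Suc n) * complex_of_real (u n)))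
     = (suminf (\<lambda>n. \<psi> (Suc n) * of_real (1 / real (Suc n)) - \<psi> (Suc n) * complex_of_real (u n)))"
    by (rule suminf_diff[OF L_one_summable[OF m per zero norm] P(1)])
  also have "\<dots> = (suminf (\<lambda>n. \<psi> (Suc n) * of_real (x ^ Suc n / real (Suc n))))"
    unfolding u_def by (simp add: diff_divide_distrib right_diff_distrib)
  finally have "(suminf (\<lambda>n. \<psi> (Suc n) * of_real (1 / real (Suc n)))) -
    (suminf (\<lambda>n. \<psi> (Suc n) * of_real (x ^ Suc n / real (Suc n)))) = (suminf (\<lambda>n. \<psi> (Suc n) * complex_of_real (u n)))"
    by (simp add: algebra_simps)
  moreover have "(suminf (\<lambda>n. u n - u (Suc n))) = 1 - x"
    using telescope_sums'[OF u] by (simp add: sums_iff u_def)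
  ultimately show ?thesis using P(2) by simp
qed

section \<open>Distribution relations\<close>

definition zeta :: "nat \<Rightarrow> nat \<Rightarrow> complex" where
  "zeta m a = cis (2 * pi * real a / real m)"

lemma zeta_0 [simp]: "zeta m 0 = 1"
  by (simp add: zeta_def)

lemma norm_zeta [simp]: "norm (zeta m a) = 1"
  by (simp add: zeta_def)

lemma zeta_add: "zeta m (a + b) = zeta m a * zeta m b"
  by (simp add: zeta_def cis_mult add_divide_distrib ring_distribs)

lemma zeta_mult: "zeta m (a * k) = zeta m a ^ k"
  unfolding zeta_def Complex.DeMoivre by (simp add: mult_ac)

lemma zeta_eq_1_iff:
  assumes "m > 0"
  shows "zeta m a = 1 \<longleftrightarrow> m dvd a"
proof -
  have per: "zeta m (m * k) = 1" for k
    using assms cis_multiple_2pi[of "real k"] by (simp add: zeta_def mult_ac)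
  have "zeta m a = zeta m (m * (a div m) + a mod m)" by simp
  also have "\<dots> = zeta m (a mod m)" by (simp only: zeta_add per mult_1)
  finally have eq: "zeta m a = zeta m (a mod m)" .
  have "inj_on (\<lambda>k. cis (2 * pi * real k / real m)) {..<m}"
    using Complex.bij_betw_roots_unity[OF assms] by (simp add: bij_betw_def)
  from inj_on_eq_iff[OF this, of "a mod m" 0] have "zeta m (a mod m) = 1 \<longleftrightarrow> a mod m = 0"
    using assms by (simp add: zeta_def)
  with eq show ?thesis by (simp add: dvd_eq_mod_eq_0)
qed

lemma zeta_self [simp]: "m > 0 \<Longrightarrow> zeta m (m * k) = 1" "m > 0 \<Longrightarrow> zeta m (k * m) = 1"
  "m > 0 \<Longrightarrow> zeta m m = 1"
  by (simp_all add: zeta_eq_1_iff)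

lemma zeta_cancel:
  assumes "q > 0"
  shows "zeta (q * m) (q * a) = zeta m a"
  unfolding zeta_def using assms by (intro arg_cong[where f = cis]) (simp add: field_simps)

text \<open>The polynomial X^q - 1 splits into distinct linear factors. Its factorisation is
  evaluated at 1/w and multiplied by w^q, which is why \<open>w = 0\<close> is treated
  apart.\<close>

lemma prod_one_minus_zeta:
  assumes "q > 0"
  shows "(\<Prod>t<q. 1 - w * zeta q t) = 1 - w ^ q"
proof (cases "w = 0")
  case True
  with assms show ?thesis by (simp add: zero_power)
next
  case False
  define P :: "complex poly" where "P = Polynomial.monom 1 q - 1"
  have deg: "degree P = q"
    unfolding P_def using assms by (subst diff_conv_add_uminus, subst degree_add_eq_left) (auto simp: degree_monom_eq)
  have lc: "lead_coeff P = 1"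
    using assms deg by (simp add: P_def)
  have root: "poly P x = 0 \<longleftrightarrow> x ^ q = 1" for x
    by (simp add: P_def poly_monom)
  have "rsquarefree P"
    unfolding rsquarefree_roots
  proof (intro allI notI)
    fix a assume a: "poly P a = 0 \<and> poly (pderiv P) a = 0"
    then have "a ^ q = 1" using root by simp
    moreover have "a = 0"
      using a assms by (simp add: P_def pderiv_diff pderiv_monom poly_monom)
    ultimately show False using assms by (simp add: zero_power)
  qed
  from complex_poly_decompose_rsquarefree[OF this]
  have "P = (\<Prod>z | z ^ q = 1. [:-z, 1:])"
    by (simp add: lc root)
  also have "\<dots> = (\<Prod>t<q. [:-zeta q t, 1:])"
    unfolding zeta_def by (rule prod.reindex_bij_betw [OF Complex.bij_betw_roots_unity[OF assms], symmetric])
  finally have "poly P (1 / w) = (\<Prod>t<q. 1 / w - zeta q t)"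
    by (simp add: poly_prod)
  then have "w ^ q * ((1 / w) ^ q - 1) = (\<Prod>t<q. w) * (\<Prod>t<q. 1 / w - zeta q t)"
    by (simp add: P_def poly_monom)
  also have "\<dots> = (\<Prod>t<q. w * (1 / w - zeta q t))"
    by (simp only: prod.distrib)
  also have "\<dots> = (\<Prod>t<q. 1 - w * zeta q t)"
    using False by (simp add: right_diff_distrib)
  finally show ?thesis using False
    by (simp add: right_diff_distrib power_one_over)
qed

text \<open>The junk value \<open>ln 0 = 0\<close> occurs exactly for multiples of \<open>m\<close>.\<close>

definition ell :: "nat \<Rightarrow> nat \<Rightarrow> real" where
  "ell m a = ln (norm (1 - zeta m a))"

lemma ell_add_period [simp]: "m > 0 \<Longrightarrow> ell m (a + m) = ell m a"
  by (simp add: ell_def zeta_add)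

text \<open>As \<open>t\<close> varies, \<open>zeta (q * k) (a + t * k)\<close> runs through a fixed
  number times all \<open>q\<close>-th roots of unity, so the product formula applies. Since
  \<open>k\<close> does not divide \<open>a\<close>, all factors are nonzero and the logarithm of
  the product splits.\<close>

lemma ell_distribution:
  assumes "q > 0" "k > 0" and nd: "\<not> k dvd a"
  shows "(\<Sum>t<q. ell (q * k) (a + t * k)) = ell (q * k) (q * a)"
proof -
  have z: "zeta (q * k) (a + t * k) = zeta (q * k) a * zeta q t" for t
    using zeta_cancel[OF \<open>k > 0\<close>, of q t] by (simp add: zeta_add mult.commute)
  have "\<not> q * k dvd a + t * k" for t
    using nd dvd_add_left_iff[of k "t * k" a] by (auto dest: dvd_mult_right)
  then have nz: "norm (1 - zeta (q * k) (a + t * k)) > 0" for t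
    using assms zeta_eq_1_iff[of "q * k"] by force
  have "(\<Sum>t<q. ell (q * k) (a + t * k)) = ln (\<Prod>t<q. norm (1 - zeta (q * k) (a + t * k)))"
    unfolding ell_def using nz by (intro ln_prod [symmetric]) auto
  also have "(\<Prod>t<q. norm (1 - zeta (q * k) (a + t * k))) = norm (1 - zeta (q * k) a ^ q)"
    by (simp add: prod_norm z prod_one_minus_zeta[OF \<open>q > 0\<close>])
  also have "zeta (q * k) a ^ q = zeta (q * k) (q * a)"
    by (simp add: zeta_mult [symmetric] mult.commute)
  finally show ?thesis by (simp add: ell_def)
qed

section \<open>Sums of periodic functions over one period\<close>

lemma periodic_mult:
  fixes f :: "nat \<Rightarrow> 'a"
  assumes "\<And>n. f (n + m) = f n"
  shows "f (n + k * m) = f n"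
  by (induction k) (simp_all add: assms add.assoc [symmetric] add.commute[of m] add.left_commute)

lemma periodic_mod:
  fixes f :: "nat \<Rightarrow> 'a"
  assumes "\<And>n. f (n + m) = f n"
  shows "f (n mod m) = f n"
  using periodic_mult[of f m, OF assms, of "n mod m" "n div m"] by (simp add: mult.commute)

lemma periodic_cong:
  fixes f :: "nat \<Rightarrow> 'a"
  assumes "\<And>n. f (n + m) = f n" "[a = b] (mod m)"
  shows "f a = f b"
  using periodic_mod[of f m, OF assms(1)] assms(2) unfolding cong_def by metis

lemma sum_periodic_reindex:
  fixes f :: "nat \<Rightarrow> 'a :: comm_monoid_add"
  assumes m: "m > 0" and per: "\<And>n. f (n + m) = f n"
    and inj: "\<And>a b. a < m \<Longrightarrow> b < m \<Longrightarrow> [g a = g b] (mod m) \<Longrightarrow> a = b"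
  shows "(\<Sum>a<m. f (g a)) = (\<Sum>a<m. f a)"
proof -
  have i: "inj_on (\<lambda>a. g a mod m) {..<m}"
    by (intro inj_onI inj) (simp_all add: cong_def)
  have sub: "(\<lambda>a. g a mod m) ` {..<m} \<subseteq> {..<m}" using m by auto
  have "bij_betw (\<lambda>a. g a mod m) {..<m} {..<m}"
    unfolding bij_betw_def using i endo_inj_surj[OF _ sub i] by auto
  from sum.reindex_bij_betw[OF this, of f] show ?thesis
    using periodic_mod[of f m, OF per] by simp
qed

lemma sum_periodic_shift:
  fixes f :: "nat \<Rightarrow> 'a :: comm_monoid_add"
  assumes "m > 0" and "\<And>n. f (n + m) = f n"
  shows "(\<Sum>a<m. f (a + t)) = (\<Sum>a<m. f a)"
  by (rule sum_periodic_reindex) (use assms in \<open>auto simp: cong_add_rcancel_nat cong_less_modulus_unique_nat\<close>)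

lemma sum_periodic_dilate:
  fixes f :: "nat \<Rightarrow> 'a :: comm_monoid_add"
  assumes "m > 0" and "\<And>n. f (n + m) = f n" and "coprime v m"
  shows "(\<Sum>a<m. f (v * a)) = (\<Sum>a<m. f a)"
  by (rule sum_periodic_reindex)
    (use assms in \<open>auto simp: cong_mult_lcancel_nat cong_less_modulus_unique_nat\<close>)

lemma sum_zeta:
  assumes "m > 0"
  shows "(\<Sum>b<m. zeta m (j * b)) = (if m dvd j then of_nat m else 0)"
proof (cases "m dvd j")
  case True
  then have "zeta m (j * b) = 1" for b
    using zeta_eq_1_iff[OF assms] by simp
  with True show ?thesis by simp
next
  case False
  then have "zeta m j \<noteq> 1" using zeta_eq_1_iff[OF assms] by simp
  moreover have "(1 - zeta m j) * (\<Sum>b<m. zeta m j ^ b) = 1 - zeta m j ^ m"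
    by (simp add: one_diff_power_eq)
  moreover have "zeta m j ^ m = 1"
    using zeta_eq_1_iff[OF assms] by (simp flip: zeta_mult)
  ultimately show ?thesis using False by (simp add: zeta_mult)
qed

text \<open>Orthogonality of cosines by the product-to-sum formula. The multiplier
  \<open>m - 1\<close> stands for -1, as exponents are natural numbers.\<close>

lemma sum_Re_zeta_mult:
  assumes "m > 0"
  shows "(\<Sum>b<m. Re (zeta m (a * b)) * Re (zeta m (k * b)))
    = (if m dvd a + k then real m / 2 else 0) + (if [a = k] (mod m) then real m / 2 else 0)"
proof -
  have "Re (zeta m (a * b)) * Re (zeta m (k * b)) =
      (Re (zeta m ((a + k) * b)) + Re (zeta m ((a + (m - 1) * k) * b))) / 2" for b
  proof -
    have "zeta m ((m - 1) * k * b) * zeta m (k * b) = zeta m (m * (k * b))"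
      unfolding zeta_add [symmetric] using assms by (cases m) (auto simp: algebra_simps)
    then have "zeta m ((m - 1) * k * b) * zeta m (k * b) = cnj (zeta m (k * b)) * zeta m (k * b)"
      using assms complex_norm_square[of "zeta m (k * b)"] by (simp add: mult.commute)
    then have "zeta m ((m - 1) * k * b) = cnj (zeta m (k * b))"
      by (metis mult_cancel_right norm_zeta norm_zero zero_neq_one)
    then have "zeta m ((a + (m - 1) * k) * b) = zeta m (a * b) * cnj (zeta m (k * b))"
      by (simp add: zeta_add ring_distribs)
    moreover have "zeta m ((a + k) * b) = zeta m (a * b) * zeta m (k * b)"
      by (simp add: zeta_add ring_distribs)
    ultimately show ?thesis by simp
  qed
  then have "(\<Sum>b<m. Re (zeta m (a * b)) * Re (zeta m (k * b)))
      = (Re (\<Sum>b<m. zeta m ((a + k) * b)) + Re (\<Sum>b<m. zeta m ((a + (m - 1) * k) * b))) / 2"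
    by (simp add: sum.distrib add_divide_distrib flip: sum_divide_distrib)
  moreover have "m dvd a + (m - 1) * k \<longleftrightarrow> [a = k] (mod m)"
  proof -
    have "[a + (m - 1) * k = 0] (mod m) \<longleftrightarrow> [a + (m - 1) * k + k = 0 + k] (mod m)"
      by (simp only: cong_add_rcancel_nat)
    also have "a + (m - 1) * k + k = a + m * k"
      using assms by (cases m) auto
    finally show ?thesis by (simp add: cong_0_iff) (simp add: cong_def)
  qed
  ultimately show ?thesis
    by (simp only: sum_zeta[OF assms]) simp
qed

section \<open>Conjugate roots of unity\<close>

definition int_poly_eval :: "int poly \<Rightarrow> complex \<Rightarrow> complex" where
  "int_poly_eval F z = poly (map_poly of_int F) z"

lemma int_poly_eval_0 [simp]: "int_poly_eval 0 z = 0"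
  by (simp add: int_poly_eval_def)

lemma int_poly_eval_pCons [simp]: "int_poly_eval (pCons a F) z = of_int a + z * int_poly_eval F z"
  by (simp add: int_poly_eval_def map_poly_pCons)

lemma int_poly_eval_1 [simp]: "int_poly_eval 1 z = 1"
  by (simp add: one_pCons)

lemma int_poly_eval_add [simp]: "int_poly_eval (F + G) z = int_poly_eval F z + int_poly_eval G z"
  by (induction F G rule: poly_induct2) (simp_all add: algebra_simps)

lemma int_poly_eval_smult [simp]: "int_poly_eval (Polynomial.smult c F) z = of_int c * int_poly_eval F z"
  by (induction F) (simp_all add: algebra_simps)

lemma int_poly_eval_mult [simp]: "int_poly_eval (F * G) z = int_poly_eval F z * int_poly_eval G z"
  by (induction F) (simp_all add: algebra_simps)

lemma int_poly_eval_diff [simp]: "int_poly_eval (F - G) z = int_poly_eval F z - int_poly_eval G z"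
  using int_poly_eval_add[of "F - G" G z] by (simp add: algebra_simps)

lemma int_poly_eval_power [simp]: "int_poly_eval (F ^ k) z = int_poly_eval F z ^ k"
  by (induction k) simp_all

lemma int_poly_eval_prod [simp]: "int_poly_eval (\<Prod>i\<in>A. F i) z = (\<Prod>i\<in>A. int_poly_eval (F i) z)"
  by (induction A rule: infinite_finite_induct) simp_all

lemma int_poly_eval_monom [simp]: "int_poly_eval (Polynomial.monom c k) z = of_int c * z ^ k"
  by (induction k) (simp_all add: monom_0 monom_Suc)

text \<open>Divisibility by the constant polynomial \<open>[:int p:]\<close> expresses congruence
  modulo \<open>p\<close>. The inner binomial coefficients of a \<open>p\<close>-th power vanish
  modulo \<open>p\<close>, and \<open>p\<close>-th powers preserve congruences, which carries the
  induction.\<close>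

lemma freshman_dream_dvd:
  fixes u :: "int poly"
  assumes "prime p"
  shows "[:int p:] dvd (u + 1) ^ p ^ k - (u ^ p ^ k + 1)"
proof (induction k)
  case (Suc k)
  define x where "x = u ^ p ^ k"
  have p0: "p > 0" using assms prime_gt_0_nat by blast
  have "(x + 1) ^ p = (\<Sum>i\<le>p. of_nat (p choose i) * x ^ i * 1 ^ (p - i))"
    by (rule binomial_ring)
  also have "\<dots> = x ^ p + 1 + (\<Sum>i\<in>{1..<p}. of_nat (p choose i) * x ^ i)"
  proof -
    have "{..p} = insert p (insert 0 {1..<p})" using p0 by auto
    then show ?thesis using p0 by simp
  qed
  finally have "(x + 1) ^ p - (x ^ p + 1) = (\<Sum>i\<in>{1..<p}. of_nat (p choose i) * x ^ i)"
    by simp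
  also have "[:int p:] dvd \<dots>"
  proof (intro dvd_sum dvd_mult2)
    fix i assume "i \<in> {1..<p}"
    then have "p dvd (p choose i)" using assms by (intro dvd_choose_prime) auto
    then have "int p dvd int (p choose i)" by simp
    then show "[:int p:] dvd of_nat (p choose i)"
      by (simp add: of_nat_poly const_poly_dvd_iff coeff_pCons split: nat.split)
  qed
  finally have 1: "[:int p:] dvd (x + 1) ^ p - (x ^ p + 1)" .
  have "(u + 1) ^ p ^ k - (x + 1) dvd ((u + 1) ^ p ^ k) ^ p - (x + 1) ^ p"
    unfolding power_diff_sumr2 by simp
  with Suc.IH have "[:int p:] dvd ((u + 1) ^ p ^ k) ^ p - (x + 1) ^ p"
    unfolding x_def by (rule dvd_trans)
  then have "[:int p:] dvd (((u + 1) ^ p ^ k) ^ p - (x + 1) ^ p) + ((x + 1) ^ p - (x ^ p + 1))"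
    using 1 by (rule dvd_add)
  also have "\<dots> = ((u + 1) ^ p ^ k) ^ p - (x ^ p + 1)"
    by (simp only: add_diff_eq diff_add_cancel)
  finally show ?case
    by (simp only: x_def power_Suc2 power_mult)
qed simp

text \<open>Eisenstein's argument: at the first index \<open>j\<close> where \<open>K\<close> has a
  coefficient prime to \<open>p\<close>, the product has one too, so \<open>d \<le> j\<close>. Such
  a \<open>j\<close> exists because the leading coefficient of \<open>K\<close> is a unit.\<close>

lemma eisenstein_degree_le:
  fixes G K :: "int poly"
  assumes "prime p" and low: "\<And>i. i < d \<Longrightarrow> int p dvd Polynomial.coeff (G * K) i"
    and "lead_coeff (G * K) = 1" and "\<not> int p dvd Polynomial.coeff G 0"
  shows "d \<le> degree K"
proof -
  have pr: "prime (int p)" using assms by simp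
  have "lead_coeff K dvd 1"
    using assms(3) unfolding lead_coeff_mult by (metis dvd_triv_right)
  then have ex: "\<not> int p dvd Polynomial.coeff K (degree K)"
    using pr dvd_trans not_prime_unit by blast
  define j where "j = (LEAST j. \<not> int p dvd Polynomial.coeff K j)"
  have j: "\<not> int p dvd Polynomial.coeff K j" unfolding j_def using ex by (rule LeastI)
  have below: "int p dvd Polynomial.coeff K i" if "i < j" for i
    using not_less_Least that unfolding j_def by blast
  have "Polynomial.coeff (G * K) j = Polynomial.coeff G 0 * Polynomial.coeff K j + (\<Sum>i\<in>{1..j}. Polynomial.coeff G i * Polynomial.coeff K (j - i))"
  proof -
    have "{..j} = insert 0 {1..j}" by auto
    then show ?thesis unfolding coeff_mult by simp
  qed
  moreover have "int p dvd (\<Sum>i\<in>{1..j}. Polynomial.coeff G i * Polynomial.coeff K (j - i))"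
    by (intro dvd_sum dvd_mult below) auto
  moreover have "\<not> int p dvd Polynomial.coeff G 0 * Polynomial.coeff K j"
    using pr j assms(4) by (simp add: prime_dvd_mult_iff)
  ultimately have "\<not> int p dvd Polynomial.coeff (G * K) j"
    by (simp add: dvd_add_left_iff)
  with low have "d \<le> j" by (meson not_le)
  also have "j \<le> degree K" unfolding j_def using ex by (rule Least_le)
  finally show ?thesis .
qed

section \<open>Irreducibility of the cyclotomic polynomial of prime power order\<close>

locale cyclotomic_prime_power =
  fixes p n m :: nat
  assumes p: "prime p" and n: "n \<ge> 1" and m: "m = p ^ n"
begin

text \<open>The cyclotomic polynomial of order \<open>m\<close>: 1 + X + ... + X^(p-1) at
  X^(p^(n-1)).\<close>

definition cyclo :: "int poly" where
  "cyclo = (\<Sum>i<p. Polynomial.monom 1 (i * p ^ (n - 1)))"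

lemma p_pos: "p > 0" and p_gt_1: "p > 1"
  using p prime_gt_0_nat prime_gt_1_nat by blast+

lemma m_eq: "m = p ^ (n - 1) * p" "m = p * p ^ (n - 1)"
  using n by (simp_all add: m flip: power_Suc power_Suc2)

lemma cyclo_times: "(Polynomial.monom 1 (p ^ (n - 1)) - 1) * cyclo = Polynomial.monom 1 m - 1"
proof -
  have "cyclo = (\<Sum>i<p. Polynomial.monom 1 (p ^ (n - 1)) ^ i)"
    by (simp add: cyclo_def monom_power mult.commute)
  then show ?thesis
    using power_diff_1_eq[of "Polynomial.monom (1::int) (p ^ (n - 1))" p]
    by (simp add: monom_power m_eq)
qed

lemma degree_monom_diff_1: "k > 0 \<Longrightarrow> degree (Polynomial.monom (1::int) k - 1) = k"
  by (subst diff_conv_add_uminus, subst degree_add_eq_left) (auto simp: degree_monom_eq)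

lemma lead_coeff_monom_diff_1: "k > 0 \<Longrightarrow> lead_coeff (Polynomial.monom (1::int) k - 1) = 1"
  by (simp add: degree_monom_diff_1)

lemma lead_coeff_cyclo: "lead_coeff cyclo = 1"
proof -
  have "lead_coeff (Polynomial.monom (1::int) (p ^ (n - 1)) - 1) * lead_coeff cyclo = 1"
    unfolding lead_coeff_mult [symmetric] cyclo_times
    using p_pos by (intro lead_coeff_monom_diff_1) (simp add: m)
  then show ?thesis using p_pos by (subst (asm) lead_coeff_monom_diff_1) auto
qed

lemma cyclo_root:
  assumes "\<not> p dvd a"
  shows "int_poly_eval cyclo (zeta m a) = 0"
proof -
  have m0: "m > 0" using p_pos by (simp add: m)
  have "\<not> m dvd a * p ^ (n - 1)"
    using assms p_pos by (simp add: m_eq(2))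
  then have "zeta m a ^ p ^ (n - 1) \<noteq> 1"
    using zeta_eq_1_iff[OF m0] by (simp flip: zeta_mult)
  moreover have "zeta m a ^ m = 1"
    using m0 by (simp flip: zeta_mult)
  ultimately show ?thesis
    using arg_cong[OF cyclo_times, of "\<lambda>F. int_poly_eval F (zeta m a)"] by simp
qed

text \<open>An Eisenstein polynomial at \<open>p\<close>.\<close>

definition shifted :: "int poly" where
  "shifted = pcompose cyclo [:1, 1:]"

lemma coeff_shifted_0: "Polynomial.coeff shifted 0 = int p"
proof -
  have "Polynomial.coeff shifted 0 = poly cyclo 1"
    by (simp add: shifted_def poly_pcompose flip: poly_0_coeff_0)
  then show ?thesis by (simp add: cyclo_def poly_sum poly_monom)
qed

lemma shifted_times: "([:1, 1:] ^ p ^ (n - 1) - 1) * shifted = [:1, 1:] ^ m - 1"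
proof -
  have "pcompose (Polynomial.monom 1 k) r = r ^ k" for k and r :: "int poly"
    by (induction k) (simp_all add: monom_0 monom_Suc pcompose_pCons)
  then show ?thesis
    using arg_cong[OF cyclo_times, of "\<lambda>F. pcompose F [:1, 1:]"]
    by (simp add: shifted_def pcompose_mult pcompose_diff pcompose_1)
qed

text \<open>With q = p^(n-1), modulo \<open>p\<close> the first factor in
  \<open>shifted_times\<close> is X^q and the right-hand side is X^m. So \<open>shifted\<close> is
  congruent to X^(m-q).\<close>

lemma p_dvd_coeff_shifted:
  assumes "i < m - p ^ (n - 1)"
  shows "int p dvd Polynomial.coeff shifted i"
proof -
  define q where "q = p ^ (n - 1)"
  have qm: "q \<le> m" unfolding q_def m by (intro power_increasing) (use p_pos in auto)
  have d: "[:int p:] dvd [:1, 1:] ^ p ^ k - (Polynomial.monom 1 (p ^ k) + 1)" for k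
    using freshman_dream_dvd[OF p, of "[:0, 1:]" k] by (simp add: one_pCons monom_altdef)
  have "[:int p:] dvd ([:1, 1:] ^ q - 1) * shifted - Polynomial.monom 1 q * shifted"
    unfolding left_diff_distrib [symmetric]
    using d[of "n - 1"] by (intro dvd_mult2) (simp add: q_def algebra_simps)
  moreover have "[:int p:] dvd ([:1, 1:] ^ m - 1) - Polynomial.monom 1 m"
    using d[of n] by (simp add: m algebra_simps)
  ultimately have "[:int p:] dvd Polynomial.monom 1 q * shifted - Polynomial.monom 1 m"
    using dvd_diff[of "[:int p:]" "([:1, 1:] ^ m - 1) - Polynomial.monom 1 m"
        "([:1, 1:] ^ q - 1) * shifted - Polynomial.monom 1 q * shifted"]
    by (simp add: shifted_times [folded q_def])
  then have "int p dvd Polynomial.coeff (Polynomial.monom 1 q * shifted - Polynomial.monom 1 m) (i + q)"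
    unfolding const_poly_dvd_iff by blast
  then show ?thesis
    using assms qm by (auto simp: q_def coeff_monom_mult coeff_monom split: if_splits)
qed

lemma degree_cyclo: "degree cyclo = m - p ^ (n - 1)"
proof -
  have q: "p ^ (n - 1) > 0" and m0: "m > 0" using p_pos by (auto simp: m)
  have "Polynomial.monom 1 (p ^ (n - 1)) - 1 \<noteq> (0 :: int poly)"
    using lead_coeff_monom_diff_1[OF q] by (metis coeff_0 zero_neq_one)
  moreover have "cyclo \<noteq> 0" using lead_coeff_cyclo by force
  ultimately have "degree (Polynomial.monom (1::int) (p ^ (n - 1)) - 1) + degree cyclo = m"
    using arg_cong[OF cyclo_times, of degree] degree_monom_diff_1[OF m0]
    by (simp add: degree_mult_eq)
  then show ?thesis using degree_monom_diff_1[OF q] by simp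
qed

text \<open>The constant coefficient of \<open>shifted\<close> is \<open>p\<close>, so
  \<open>p\<close> cannot divide those of both factors. If it does not divide that of one factor,
  Eisenstein's bound gives the full degree to the other. The substitution of X + 1 keeps
  degrees.\<close>

lemma cyclo_factor_trivial:
  assumes "cyclo = G * K"
  shows "degree G = 0 \<or> degree K = 0"
proof -
  define G' K' where "G' = pcompose G [:1, 1:]" and "K' = pcompose K [:1, 1:]"
  have deg: "degree G' = degree G" "degree K' = degree K"
    by (simp_all add: G'_def K'_def degree_pcompose)
  have eq: "G' * K' = shifted"
    by (simp add: G'_def K'_def shifted_def assms pcompose_mult)
  have "lead_coeff shifted = 1"
    unfolding shifted_def using lead_coeff_cyclo by (subst lead_coeff_comp) auto
  then have lc: "lead_coeff (G' * K') = 1" "lead_coeff (K' * G') = 1"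
    using eq by (simp_all only: mult.commute)
  have low: "int p dvd Polynomial.coeff (G' * K') i" "int p dvd Polynomial.coeff (K' * G') i" if "i < m - p ^ (n - 1)" for i
    using p_dvd_coeff_shifted[OF that] eq by (simp_all only: mult.commute)
  have nz: "G \<noteq> 0" "K \<noteq> 0" using assms lead_coeff_cyclo by force+
  have dsum: "degree G + degree K = m - p ^ (n - 1)"
    using degree_cyclo nz by (simp add: assms degree_mult_eq)
  have "Polynomial.coeff G' 0 * Polynomial.coeff K' 0 = int p"
    using coeff_shifted_0 by (simp add: eq [symmetric] flip: poly_0_coeff_0)
  have "\<not> (int p dvd Polynomial.coeff G' 0 \<and> int p dvd Polynomial.coeff K' 0)"
  proof
    assume "int p dvd Polynomial.coeff G' 0 \<and> int p dvd Polynomial.coeff K' 0"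
    then have "int p * int p dvd Polynomial.coeff G' 0 * Polynomial.coeff K' 0"
      by (intro mult_dvd_mono) auto
    then have "int p * int p dvd int p * 1"
      by (simp only: \<open>Polynomial.coeff G' 0 * Polynomial.coeff K' 0 = int p\<close> mult_1_right)
    then have "int p dvd 1" using p_pos by (subst (asm) dvd_mult_cancel_left) auto
    then show False using p_gt_1 by simp
  qed
  then consider "\<not> int p dvd Polynomial.coeff G' 0" | "\<not> int p dvd Polynomial.coeff K' 0" by blast
  then show ?thesis
  proof cases
    case 1
    have "m - p ^ (n - 1) \<le> degree K'"
      by (rule eisenstein_degree_le[OF p low(1) lc(1) 1])
    then show ?thesis using dsum deg by simp
  next
    case 2
    have "m - p ^ (n - 1) \<le> degree G'"
      by (rule eisenstein_degree_le[OF p low(2) lc(2) 2])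
    then show ?thesis using dsum deg by simp
  qed
qed

text \<open>An integer polynomial of least degree vanishing at the root, made primitive, divides
  \<open>cyclo\<close> and, up to a constant, \<open>F\<close>. By irreducibility it agrees with
  \<open>cyclo\<close> up to a constant, so it vanishes at the conjugate root, and \<open>F\<close>
  with it.\<close>

lemma conjugate_root:
  assumes F: "int_poly_eval F (zeta m 1) = 0" and a: "\<not> p dvd a"
  shows "int_poly_eval F (zeta m a) = 0"
proof -
  let ?z = "zeta m 1"
  have c0: "cyclo \<noteq> 0" using lead_coeff_cyclo by force
  have cz: "int_poly_eval cyclo ?z = 0" using p_gt_1 by (intro cyclo_root) auto
  obtain S0 where S0: "S0 \<noteq> 0 \<and> int_poly_eval S0 ?z = 0"
    and min0: "\<And>G. G \<noteq> 0 \<and> int_poly_eval G ?z = 0 \<Longrightarrow> degree S0 \<le> degree G"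
    using ex_has_least_nat[of "\<lambda>G. G \<noteq> 0 \<and> int_poly_eval G ?z = 0" cyclo degree] c0 cz by blast
  define S where "S = primitive_part S0"
  have "int_poly_eval (Polynomial.smult (content S0) S) ?z = 0"
    using S0 by (simp only: S_def content_times_primitive_part)
  then have Sz: "int_poly_eval S ?z = 0" using S0 by simp
  have S: "S \<noteq> 0" "content S = 1" "degree S = degree S0" using S0 by (auto simp: S_def)
  \<comment> \<open>Pseudo-division leaves a remainder of smaller degree that vanishes at the same
    point; by minimality it is 0.\<close>
  have div: "\<exists>a Q. a \<noteq> 0 \<and> Polynomial.smult a G = S * Q" if G: "int_poly_eval G ?z = 0" for G
  proof -
    obtain a Q where aQ: "a \<noteq> 0" "Polynomial.smult a G = S * Q + pseudo_mod G S"
      using pseudo_mod(1)[OF S(1), of G] by blast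
    have "int_poly_eval (pseudo_mod G S) ?z = 0"
      using arg_cong[OF aQ(2), of "\<lambda>F. int_poly_eval F ?z"] G Sz by simp
    then have "pseudo_mod G S = 0"
      using pseudo_mod(2)[OF S(1), of G] min0[of "pseudo_mod G S"] S(3) by force
    with aQ show ?thesis by auto
  qed
  obtain c Q where cQ: "c \<noteq> 0" "Polynomial.smult c cyclo = S * Q" using div[OF cz] by blast
  \<comment> \<open>Gauss's lemma: \<open>cyclo\<close> is monic and \<open>S\<close> primitive, so
    comparing contents shows that \<open>c\<close> divides \<open>Q\<close>.\<close>
  have "content cyclo dvd lead_coeff cyclo" by (rule content_dvd_coeff)
  then have "is_unit (content cyclo)" by (simp add: lead_coeff_cyclo)
  then have "content cyclo = 1"
    by (metis is_unit_normalize normalize_content)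
  then have "content Q = \<bar>c\<bar>"
    using arg_cong[OF cQ(2), of content] S(2) by (simp add: content_mult)
  then have "[:c:] dvd Q" by (simp add: const_poly_dvd_iff_dvd_content)
  then obtain H where H: "Q = Polynomial.smult c H" by (auto elim!: dvdE)
  then have "Polynomial.smult c cyclo = Polynomial.smult c (S * H)" using cQ by simp
  then have "Polynomial.smult c (cyclo - S * H) = 0" by (simp only: smult_diff_right diff_self)
  then have eq: "cyclo = S * H" using cQ(1) by simp
  have "degree S \<noteq> 0"
  proof
    assume "degree S = 0"
    then obtain s where "S = [:s:]" by (rule degree_eq_zeroE)
    with S(1) Sz show False by simp
  qed
  with cyclo_factor_trivial[OF eq] obtain h where h: "H = [:h:]" by (metis degree_eq_zeroE)
  with eq c0 have "h \<noteq> 0" by auto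
  moreover have "int_poly_eval S (zeta m a) * of_int h = 0"
    using cyclo_root[OF a] unfolding eq h by auto
  ultimately have Sa: "int_poly_eval S (zeta m a) = 0" by auto
  obtain b Q' where b: "b \<noteq> 0" "Polynomial.smult b F = S * Q'" using div[OF F] by blast
  have "int_poly_eval (Polynomial.smult b F) (zeta m a) = 0"
    by (simp only: b(2) int_poly_eval_mult Sa mult_zero_left)
  with b(1) show ?thesis by simp
qed

end

section \<open>Residues up to sign\<close>

text \<open>The minus sign is encoded by a vanishing sum, so that all residues stay natural
  numbers.\<close>

definition cong_pm :: "nat \<Rightarrow> nat \<Rightarrow> nat \<Rightarrow> bool" where
  "cong_pm m a b \<longleftrightarrow> [a = b] (mod m) \<or> [a + b = 0] (mod m)"

lemma cong_pm_refl [simp]: "cong_pm m a a"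
  by (simp add: cong_pm_def)

lemma cong_pm_iff_int:
  "cong_pm m a b \<longleftrightarrow> [int a = int b] (mod int m) \<or> [int a = - int b] (mod int m)"
proof -
  have "[a + b = 0] (mod m) \<longleftrightarrow> int m dvd int a + int b"
    by (simp add: cong_0_iff flip: int_dvd_int_iff)
  then show ?thesis
    by (simp add: cong_pm_def cong_iff_dvd_diff flip: cong_int_iff)
qed

lemma cong_pm_sym: "cong_pm m a b \<Longrightarrow> cong_pm m b a"
  by (auto simp: cong_pm_def add.commute cong_sym_eq)

lemma cong_pm_mult:
  assumes "cong_pm m a b" "cong_pm m c d"
  shows "cong_pm m (a * c) (b * d)"
  using assms cong_mult[of "int a" _ "int m" "int c"] unfolding cong_pm_iff_int by fastforce

lemma cong_pm_trans:
  assumes "cong_pm m a b" "cong_pm m b c"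
  shows "cong_pm m a c"
proof -
  have "[- int b = - int c] (mod int m) \<longleftrightarrow> [int b = int c] (mod int m)"
    "[- int b = int c] (mod int m) \<longleftrightarrow> [int b = - int c] (mod int m)"
    using cong_minus_minus_iff[of "int b" "int c" "int m"] cong_minus_minus_iff[of "int b" "- int c" "int m"]
    by simp_all
  then show ?thesis using assms cong_trans unfolding cong_pm_iff_int by blast
qed

lemma cong_pm_power: "cong_pm m a b \<Longrightarrow> cong_pm m (a ^ k) (b ^ k)"
  by (induction k) (auto intro: cong_pm_mult)

lemma cong_pm_cancel:
  assumes "cong_pm m (c * a) (c * b)" "coprime c m"
  shows "cong_pm m a b"
proof -
  have "[c * (a + b) = c * 0] (mod m) \<longleftrightarrow> [a + b = 0] (mod m)"
    using assms(2) by (rule cong_mult_lcancel_nat)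
  then show ?thesis
    using assms by (simp add: cong_pm_def cong_mult_lcancel_nat ring_distribs)
qed

lemma zeta_cong: "m > 0 \<Longrightarrow> [a = b] (mod m) \<Longrightarrow> zeta m a = zeta m b"
  by (rule periodic_cong[of "zeta m"]) (simp_all add: zeta_add)

lemma zeta_cong_neg:
  assumes "m > 0" "[a + b = 0] (mod m)"
  shows "zeta m a = cnj (zeta m b)"
proof -
  have "zeta m a * zeta m b = zeta m 0"
    unfolding zeta_add [symmetric] by (rule zeta_cong) (use assms in auto)
  also have "\<dots> = cnj (zeta m b) * zeta m b"
    using complex_norm_square[of "zeta m b"] by (simp add: mult.commute)
  finally show ?thesis by (metis mult_cancel_right norm_zeta norm_zero zero_neq_one)
qed

lemma ell_cong_pm:
  assumes "m > 0" "cong_pm m a b"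
  shows "ell m a = ell m b"
proof -
  have "norm (1 - cnj z) = norm (1 - z)" for z
    by (metis complex_cnj_diff complex_cnj_one complex_mod_cnj)
  then show ?thesis
    using assms zeta_cong[of m a b] zeta_cong_neg[of m a b] by (auto simp: cong_pm_def ell_def)
qed

text \<open>The factor 1 - x has to be cancelled as a polynomial, because the value wanted is the
  one at x = 1. The geometric sum that remains of 1 - x^q equals \<open>q\<close> there.\<close>

lemma prod_one_minus_zeta_nontrivial:
  assumes "q > 0"
  shows "(\<Prod>t\<in>{1..<q}. 1 - zeta q t) = of_nat q"
proof -
  define P where "P = (\<Prod>t\<in>{1..<q}. [:1, - zeta q t:])"
  define Q :: "complex poly" where "Q = (\<Sum>i<q. Polynomial.monom 1 i)"
  have "poly ([:1, -1:] * P) x = poly ([:1, -1:] * Q) x" for x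
  proof -
    have "{..<q} = insert 0 {1..<q}" using assms by auto
    then have "1 - x ^ q = (1 - x) * (\<Prod>t\<in>{1..<q}. 1 - x * zeta q t)"
      using prod_one_minus_zeta[OF assms, of x] by simp
    moreover have "1 - x ^ q = (1 - x) * (\<Sum>i<q. x ^ i)"
      by (rule one_diff_power_eq)
    ultimately show ?thesis
      unfolding P_def Q_def poly_mult poly_prod poly_sum poly_monom by auto
  qed
  then have "[:1, -1:] * P = [:1, -1:] * Q"
    by (subst poly_eq_poly_eq_iff [symmetric]) auto
  then have "poly P 1 = poly Q 1" by (subst (asm) mult_cancel_left) simp
  then show ?thesis by (simp add: P_def Q_def poly_prod poly_sum poly_monom)
qed

section \<open>Sums over the units modulo \<open>m\<close>\<close>

context cyclotomic_prime_power
begin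

lemma m_gt_1: "m > 1"
  using p_gt_1 n unfolding m by (intro one_less_power) auto

lemma m_pos: "m > 0"
  using m_gt_1 by simp

lemma coprime_iff: "coprime v m \<longleftrightarrow> \<not> p dvd v"
proof -
  have "coprime v m \<longleftrightarrow> coprime v p" unfolding m using n by (simp add: coprime_power_right_iff)
  also have "\<dots> \<longleftrightarrow> \<not> p dvd v"
    using p by (metis coprime_absorb_left coprime_commute not_prime_unit prime_imp_coprime)
  finally show ?thesis .
qed

lemma cong_pm_dvd_iff:
  assumes "cong_pm m a b"
  shows "p dvd a \<longleftrightarrow> p dvd b"
proof -
  have "p dvd m" using n by (simp add: m)
  show ?thesis
    using assms unfolding cong_pm_def
  proof
    assume "[a = b] (mod m)"
    then show ?thesis using cong_dvd_modulus_nat[OF _ \<open>p dvd m\<close>] cong_dvd_iff by blast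
  next
    assume "[a + b = 0] (mod m)"
    then have "p dvd a + b" using \<open>p dvd m\<close> dvd_trans by (auto simp: cong_0_iff)
    then show ?thesis using dvd_add_left_iff[of p b a] dvd_add_right_iff[of p a b] by blast
  qed
qed

lemma unit_not_dvd: "\<not> p dvd v \<Longrightarrow> \<not> m dvd v"
  using n unfolding m by (metis dvd_power dvd_trans not_less_eq_eq One_nat_def neq0_conv not_one_le_zero)

text \<open>Grouped by residues modulo \<open>p\<close>, the units of each class contribute
  \<open>ell m (q * u)\<close> by the distribution relation. These are the logarithms of |1 - w| for
  the nontrivial \<open>p\<close>-th roots of unity w, whose product is \<open>p\<close>.\<close>

lemma sum_ell_units: "(\<Sum>v | v < m \<and> \<not> p dvd v. ell m v) = ln p"
proof -
  define q where "q = p ^ (n - 1)"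
  have q: "q > 0" using p_pos by (simp add: q_def)
  have mq: "m = q * p" using m_eq by (simp add: q_def)
  have "(\<Sum>v | v < m \<and> \<not> p dvd v. ell m v) = (\<Sum>v<m. if p dvd v then 0 else ell m v)"
    by (intro sum.mono_neutral_cong_left) auto
  also have "\<dots> = (\<Sum>t<q. \<Sum>v\<in>{t * p..<t * p + p}. if p dvd v then 0 else ell m v)"
    by (simp add: mq sum.nat_group)
  also have "\<dots> = (\<Sum>t<q. \<Sum>u<p. if p dvd u then 0 else ell m (u + t * p))"
  proof (rule sum.cong [OF refl])
    fix t
    show "(\<Sum>v\<in>{t * p..<t * p + p}. if p dvd v then 0 else ell m v)
       = (\<Sum>u<p. if p dvd u then 0 else ell m (u + t * p))"
      using sum.shift_bounds_nat_ivl[of "\<lambda>v. if p dvd v then 0 else ell m v" 0 "t * p" p]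
      by (simp add: lessThan_atLeast0 add.commute cong: if_cong)
  qed
  also have "\<dots> = (\<Sum>u<p. \<Sum>t<q. if p dvd u then 0 else ell m (u + t * p))"
    by (rule sum.swap)
  also have "\<dots> = (\<Sum>u\<in>{1..<p}. ell m (q * u))"
  proof (rule sum.mono_neutral_cong_right)
    show "\<forall>u\<in>{..<p} - {1..<p}. (\<Sum>t<q. if p dvd u then 0 else ell m (u + t * p)) = 0"
      by (auto simp: not_less_eq_eq)
  next
    fix u assume u: "u \<in> {1..<p}"
    then have "\<not> p dvd u" by (auto dest: dvd_imp_le)
    then show "(\<Sum>t<q. if p dvd u then 0 else ell m (u + t * p)) = ell m (q * u)"
      using ell_distribution[OF q p_pos, of u] by (simp add: mq)
  qed auto
  also have "\<dots> = (\<Sum>u\<in>{1..<p}. ln (norm (1 - zeta p u)))"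
    using zeta_cancel[OF q] by (simp add: ell_def mq)
  also have "\<dots> = ln (\<Prod>u\<in>{1..<p}. norm (1 - zeta p u))"
  proof -
    have "zeta p u \<noteq> 1" if "u \<in> {1..<p}" for u
      using that zeta_eq_1_iff[OF p_pos] by (auto dest: dvd_imp_le)
    then show ?thesis by (intro ln_prod [symmetric]) auto
  qed
  also have "(\<Prod>u\<in>{1..<p}. norm (1 - zeta p u)) = real p"
    using prod_one_minus_zeta_nontrivial[OF p_pos] by (simp add: prod_norm)
  finally show ?thesis .
qed

text \<open>The sum over all residues minus that over the multiples of \<open>p\<close>: both are
  complete sums over roots of unity, hence 0 or the number of terms.\<close>

lemma sum_zeta_units_int: "(\<Sum>a | a < m \<and> \<not> p dvd a. zeta m a ^ k) \<in> \<int>"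
proof -
  define q where "q = p ^ (n - 1)"
  have q: "q > 0" using p_pos by (simp add: q_def)
  have mq: "m = p * q" using m_eq by (simp add: q_def)
  have split: "{..<m} = {a. a < m \<and> \<not> p dvd a} \<union> (\<lambda>b. p * b) ` {..<q}"
    using p_pos by (auto simp: mq elim!: dvdE)
  have "(\<Sum>a<m. zeta m a ^ k) = (\<Sum>a | a < m \<and> \<not> p dvd a. zeta m a ^ k) + (\<Sum>a\<in>(\<lambda>b. p * b) ` {..<q}. zeta m a ^ k)"
    by (subst split, rule sum.union_disjoint) auto
  also have "(\<Sum>a\<in>(\<lambda>b. p * b) ` {..<q}. zeta m a ^ k) = (\<Sum>b<q. zeta m (p * b) ^ k)"
    by (rule sum.reindex_cong[of "\<lambda>b. p * b"]) (use p_pos in \<open>auto simp: inj_on_def\<close>)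
  also have "\<dots> = (\<Sum>b<q. zeta q (k * b))"
    unfolding mq zeta_cancel[OF p_pos] by (simp add: zeta_mult mult.commute[of k])
  finally have "(\<Sum>a | a < m \<and> \<not> p dvd a. zeta m a ^ k) = (\<Sum>a<m. zeta m (k * a)) - (\<Sum>b<q. zeta q (k * b))"
    by (simp add: zeta_mult [symmetric] mult.commute)
  then show ?thesis
    unfolding sum_zeta[OF m_pos] sum_zeta[OF q] by auto
qed

text \<open>The trace of an algebraic integer of the cyclotomic field. Its integrality will rule out
  that all conjugates equal the square root of \<open>p\<close>.\<close>

lemma sum_int_poly_eval_units_int: "(\<Sum>a | a < m \<and> \<not> p dvd a. int_poly_eval F (zeta m a)) \<in> \<int>"
proof -
  have "(\<Sum>a | a < m \<and> \<not> p dvd a. int_poly_eval F (zeta m a))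
     = (\<Sum>a | a < m \<and> \<not> p dvd a. \<Sum>k\<le>degree F. of_int (Polynomial.coeff F k) * zeta m a ^ k)"
    by (simp add: int_poly_eval_def poly_altdef degree_map_poly coeff_map_poly)
  also have "\<dots> = (\<Sum>k\<le>degree F. of_int (Polynomial.coeff F k) * (\<Sum>a | a < m \<and> \<not> p dvd a. zeta m a ^ k))"
    by (subst sum.swap) (simp add: sum_distrib_left)
  also have "\<dots> \<in> \<int>"
    by (intro Ints_sum Ints_mult Ints_of_int sum_zeta_units_int)
  finally show ?thesis .
qed

text \<open>Since \<open>m - 1 \<equiv> -1\<close>, its value at \<open>\<zeta>\<^sup>a\<close> is the product of the \<open>\<bar>1 - \<zeta>\<^bsup>ak\<^esup>\<bar>\<close> to the power \<open>2 e k\<close>.\<close>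

definition norm_poly :: "nat set \<Rightarrow> (nat \<Rightarrow> nat) \<Rightarrow> int poly" where
  "norm_poly K e = (\<Prod>k\<in>K. ((1 - Polynomial.monom 1 k) * (1 - Polynomial.monom 1 ((m - 1) * k))) ^ e k)"

lemma int_poly_eval_norm_poly:
  assumes fin: "finite K" and nd: "\<And>k. k \<in> K \<Longrightarrow> \<not> m dvd a * k"
  shows "int_poly_eval (norm_poly K e) (zeta m a) = of_real (exp (2 * (\<Sum>k\<in>K. real (e k) * ell m (a * k))))"
proof -
  have "(1 - zeta m a ^ k) * (1 - zeta m a ^ ((m - 1) * k)) = of_real (exp (2 * ell m (a * k)))"
    if k: "k \<in> K" for k
  proof -
    have "a * ((m - 1) * k) + a * k = m * (a * k)"
      using m_pos by (cases m) (auto simp: algebra_simps)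
    then have "zeta m (a * ((m - 1) * k)) = cnj (zeta m (a * k))"
      by (intro zeta_cong_neg m_pos) (simp add: cong_0_iff)
    then have "(1 - zeta m a ^ k) * (1 - zeta m a ^ ((m - 1) * k)) = (1 - zeta m (a * k)) * cnj (1 - zeta m (a * k))"
      by (simp add: zeta_mult)
    also have "\<dots> = of_real ((norm (1 - zeta m (a * k)))\<^sup>2)"
      by (simp only: complex_norm_square)
    also have "norm (1 - zeta m (a * k)) = exp (ell m (a * k))"
      using nd[OF k] zeta_eq_1_iff[OF m_pos] by (simp add: ell_def)
    finally show ?thesis by (simp add: exp_double)
  qed
  then have "int_poly_eval (norm_poly K e) (zeta m a) = (\<Prod>k\<in>K. of_real (exp (2 * ell m (a * k))) ^ e k)"
    by (simp add: norm_poly_def)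
  also have "\<dots> = of_real (\<Prod>k\<in>K. exp (real (e k) * (2 * ell m (a * k))))"
    by (simp add: exp_of_nat_mult)
  also have "\<dots> = of_real (exp (2 * (\<Sum>k\<in>K. real (e k) * ell m (a * k))))"
    using fin by (simp add: exp_sum [symmetric] sum_distrib_left mult_ac)
  finally show ?thesis .
qed

text \<open>Exponentiated, the relation says that two integer polynomials, formed from the positive
  and the negative coefficients, agree at \<zeta>. They then agree at its conjugate, and since both
  values there are real exponentials, the exponents agree.\<close>

lemma conjugate_ell_relation:
  fixes c :: "nat \<Rightarrow> int"
  assumes fin: "finite K" and unit: "\<And>k. k \<in> K \<Longrightarrow> \<not> p dvd k"
    and rel: "(\<Sum>k\<in>K. of_int (c k) * ell m k) = 0" and a: "\<not> p dvd a"
  shows "(\<Sum>k\<in>K. of_int (c k) * ell m (a * k)) = 0"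
proof -
  define P Q where "P = norm_poly K (\<lambda>k. nat (c k))" and "Q = norm_poly K (\<lambda>k. nat (- c k))"
  have diff: "(\<Sum>k\<in>K. real (nat (c k)) * ell m (b * k)) - (\<Sum>k\<in>K. real (nat (- c k)) * ell m (b * k))
      = (\<Sum>k\<in>K. of_int (c k) * ell m (b * k))" for b
    unfolding sum_subtractf [symmetric] left_diff_distrib [symmetric]
    by (intro sum.cong refl) (auto simp: of_nat_nat)
  have nd: "\<not> m dvd b * k" if "\<not> p dvd b" "k \<in> K" for b k
    using that unit p by (intro unit_not_dvd) (auto simp: prime_dvd_mult_iff)
  have "int_poly_eval (P - Q) (zeta m b) = 0 \<longleftrightarrow> (\<Sum>k\<in>K. of_int (c k) * ell m (b * k)) = 0"
    if "\<not> p dvd b" for b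
    using int_poly_eval_norm_poly[OF fin nd[OF that]] by (simp add: P_def Q_def flip: diff)
  moreover have "\<not> p dvd 1" using p by auto
  ultimately show ?thesis using rel a conjugate_root[of "P - Q" a] by simp
qed

end

section \<open>Even characters and logarithms of cyclotomic numbers\<close>

text \<open>Even Dirichlet characters modulo \<open>m\<close>, primitive or not; the residue
  \<open>m - 1\<close> stands for -1.\<close>

locale prime_power_character = cyclotomic_prime_power +
  fixes \<psi> :: "nat \<Rightarrow> complex"
  assumes mult: "\<psi> (a * b) = \<psi> a * \<psi> b"
    and zero_iff: "\<psi> a = 0 \<longleftrightarrow> p dvd a"
    and norm: "\<not> p dvd a \<Longrightarrow> norm (\<psi> a) = 1"
    and per: "\<psi> (a + m) = \<psi> a"
    and even: "\<psi> (m - 1) = 1"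
begin

text \<open>Cosines suffice because the character is even.\<close>

definition fourier :: "nat \<Rightarrow> complex" where
  "fourier b = (\<Sum>a<m. \<psi> a * of_real (Re (zeta m (a * b)))) / of_nat m"

text \<open>The aim is \<open>twist 1 \<noteq> 0\<close>; the other arguments arise from the Fourier
  expansion of the character.\<close>

definition twist :: "nat \<Rightarrow> complex" where
  "twist a = (\<Sum>v<m. cnj (\<psi> v) * of_real (ell m (a * v)))"

lemma one: "\<psi> 1 = 1"
proof -
  have "\<psi> 1 * (\<psi> 1 - 1) = 0" using mult[of 1 1] by (simp add: algebra_simps)
  moreover have "\<psi> 1 \<noteq> 0" using zero_iff[of 1] p by auto
  ultimately show ?thesis by simp
qed

lemma cnj_mult_self: "\<not> p dvd v \<Longrightarrow> cnj (\<psi> v) * \<psi> v = 1"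
  using norm[of v] by (simp add: complex_norm_square [symmetric] mult.commute)

lemma zeta_per: "zeta m (k * (a + m)) = zeta m (k * a)" "zeta m ((a + m) * k) = zeta m (a * k)"
  using m_pos by (simp_all add: zeta_add ring_distribs)

lemma ell_per: "ell m (k * (a + m)) = ell m (k * a)"
  by (simp add: ell_def zeta_per)

lemma twist_unit_mult:
  assumes "\<not> p dvd u"
  shows "twist (u * a) = \<psi> u * twist a"
proof -
  have "twist (u * a) = (\<Sum>v<m. \<psi> u * (cnj (\<psi> (u * v)) * of_real (ell m (a * (u * v)))))"
    unfolding twist_def
  proof (intro sum.cong refl)
    fix v
    have "\<psi> u * (cnj (\<psi> (u * v)) * of_real (ell m (a * (u * v))))
        = (cnj (\<psi> u) * \<psi> u) * (cnj (\<psi> v) * of_real (ell m (u * a * v)))"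
      by (simp only: mult complex_cnj_mult mult_ac)
    then show "cnj (\<psi> v) * of_real (ell m (u * a * v))
        = \<psi> u * (cnj (\<psi> (u * v)) * of_real (ell m (a * (u * v))))"
      by (simp only: cnj_mult_self[OF assms] mult_1)
  qed
  also have "\<dots> = \<psi> u * (\<Sum>v<m. cnj (\<psi> (u * v)) * of_real (ell m (a * (u * v))))"
    by (simp add: sum_distrib_left)
  also have "(\<Sum>v<m. cnj (\<psi> (u * v)) * of_real (ell m (a * (u * v)))) = twist a"
    unfolding twist_def using assms coprime_iff
    by (intro sum_periodic_dilate[where f = "\<lambda>v. cnj (\<psi> v) * of_real (ell m (a * v))"] m_pos)
      (auto simp: per ell_per)
  finally show ?thesis .
qed

text \<open>
  \<open>twist\<close> is an eigenfunction of the units; the distribution relation extends this to powers of \<open>p\<close>,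
  so no reduction to primitive characters is needed.
\<close>

lemma twist_prime_power:
  assumes "s < n"
  shows "\<exists>c. twist (p ^ s) = c * twist 1"
proof -
  define q k where "q = p ^ s" and "k = p ^ (n - s)"
  have mqk: "m = q * k" using assms by (simp add: m q_def k_def flip: power_add)
  have pos: "q > 0" "k > 0" using m_pos by (simp_all add: mqk)
  have pk: "p dvd k" using assms by (simp add: k_def)
  have per2: "\<psi> (a + m + b) = \<psi> (a + b)" for a b using per[of "a + b"] by (simp add: add_ac)
  define c where "c = (\<Sum>t<q. cnj (\<psi> (1 + t * k)))"
  have perk: "\<psi> (a + q * k) = \<psi> a" for a using per[of a] by (simp add: mqk)
  \<comment> \<open>For a unit \<open>w\<close>, multiplication by \<open>w\<close> permutes the
    residues \<open>t\<close> modulo \<open>q\<close>, so the \<open>w + t * k\<close> may be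
    replaced by \<open>w * (1 + t * k)\<close>. For a multiple \<open>w\<close> of \<open>p\<close>
    both sides vanish, since \<open>p\<close> divides \<open>k\<close>.\<close>
  have inner: "(\<Sum>t<q. cnj (\<psi> (w + (q - t) * k))) = c * cnj (\<psi> w)" for w
  proof (cases "p dvd w")
    case True
    then have "\<psi> (w + x * k) = 0" for x using pk by (simp add: zero_iff)
    moreover have "\<psi> w = 0" using True by (simp add: zero_iff)
    ultimately show ?thesis by simp
  next
    case False
    have "coprime w q"
      using False coprime_iff[of w] unfolding mqk by simp
    have "(\<Sum>t<q. cnj (\<psi> (w + (q - t) * k))) = (\<Sum>t<q. cnj (\<psi> (w + (t + 1) * k)))"
      by (rule sum.reindex_bij_witness[of _ "\<lambda>t. q - 1 - t" "\<lambda>t. q - 1 - t"])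
        (auto simp: Suc_diff_Suc simp flip: mult_Suc)
    also have "\<dots> = (\<Sum>t<q. cnj (\<psi> (w + t * k)))"
      by (rule sum_periodic_shift[where f = "\<lambda>t. cnj (\<psi> (w + t * k))"])
        (use pos perk in \<open>auto simp: ring_distribs simp flip: add.assoc\<close>)
    also have "\<dots> = (\<Sum>t<q. cnj (\<psi> (w + (w * t) * k)))"
      by (rule sum_periodic_dilate[where f = "\<lambda>t. cnj (\<psi> (w + t * k))", symmetric])
        (use pos perk \<open>coprime w q\<close> in \<open>auto simp: ring_distribs simp flip: add.assoc\<close>)
    also have "\<dots> = (\<Sum>t<q. cnj (\<psi> w) * cnj (\<psi> (1 + t * k)))"
      by (intro sum.cong refl) (simp add: algebra_simps flip: complex_cnj_mult mult)
    finally show ?thesis by (simp add: c_def sum_distrib_left mult.commute)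
  qed
  have "twist q = (\<Sum>v<m. \<Sum>t<q. cnj (\<psi> v) * of_real (ell m (v + t * k)))"
    unfolding twist_def
  proof (intro sum.cong refl)
    fix v
    show "cnj (\<psi> v) * of_real (ell m (q * v)) = (\<Sum>t<q. cnj (\<psi> v) * of_real (ell m (v + t * k)))"
    proof (cases "p dvd v")
      case False
      then have "\<not> k dvd v" using pk dvd_trans by blast
      from ell_distribution[OF pos this] show ?thesis
        by (simp add: mqk flip: sum_distrib_left of_real_sum)
    qed (simp add: zero_iff[THEN iffD2])
  qed
  also have "\<dots> = (\<Sum>t<q. \<Sum>v<m. cnj (\<psi> v) * of_real (ell m (v + t * k)))"
    by (rule sum.swap)
  \<comment> \<open>The variable is shifted by \<open>t * k\<close>; as \<open>m = q * k\<close>,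
    the term \<open>(q - t) * k\<close> stands for its negative.\<close>
  also have "\<dots> = (\<Sum>t<q. \<Sum>w<m. cnj (\<psi> (w + (q - t) * k)) * of_real (ell m w))"
  proof (rule sum.cong [OF refl])
    fix t assume t: "t \<in> {..<q}"
    have "cnj (\<psi> v) = cnj (\<psi> (v + t * k + (q - t) * k))" for v
    proof -
      have "v + t * k + (q - t) * k = v + m"
        using t by (simp add: mqk flip: add_mult_distrib)
      then show ?thesis by (simp only: per)
    qed
    then have "(\<Sum>v<m. cnj (\<psi> v) * of_real (ell m (v + t * k)))
      = (\<Sum>v<m. cnj (\<psi> (v + t * k + (q - t) * k)) * of_real (ell m (v + t * k)))"
      by (intro sum.cong refl) metis
    also have "\<dots> = (\<Sum>w<m. cnj (\<psi> (w + (q - t) * k)) * of_real (ell m w))"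
      by (rule sum_periodic_shift[where f = "\<lambda>w. cnj (\<psi> (w + (q - t) * k)) * of_real (ell m w)"])
        (simp_all add: m_pos per2)
    finally show "(\<Sum>v<m. cnj (\<psi> v) * of_real (ell m (v + t * k)))
      = (\<Sum>w<m. cnj (\<psi> (w + (q - t) * k)) * of_real (ell m w))" .
  qed
  also have "\<dots> = (\<Sum>w<m. \<Sum>t<q. cnj (\<psi> (w + (q - t) * k)) * of_real (ell m w))"
    by (rule sum.swap)
  also have "\<dots> = (\<Sum>w<m. c * (cnj (\<psi> w) * of_real (ell m w)))"
    by (simp add: inner mult.assoc flip: sum_distrib_right)
  also have "\<dots> = c * twist 1"
    by (simp add: twist_def sum_distrib_left)
  finally show ?thesis unfolding q_def by blast
qed

lemma twist_eq_0:
  assumes "twist 1 = 0" and "\<not> m dvd b"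
  shows "twist b = 0"
proof -
  have "b \<noteq> 0" using assms(2) by (metis dvd_0_right)
  define s where "s = multiplicity p b"
  obtain u where u: "b = p ^ s * u" "\<not> p dvd u"
    using multiplicity_decompose'[of b p] \<open>b \<noteq> 0\<close> p prime_gt_1_nat[OF p] unfolding s_def
    by (metis not_prime_unit)
  have "s < n"
  proof (rule ccontr)
    assume "\<not> s < n"
    then have "m dvd p ^ s" unfolding m by (simp add: le_imp_power_dvd)
    with u assms show False by auto
  qed
  have "twist b = \<psi> u * twist (p ^ s)"
    using twist_unit_mult[OF u(2), of "p ^ s"] u(1) by (simp add: mult.commute)
  with twist_prime_power[OF \<open>s < n\<close>] assms show ?thesis by auto
qed

lemma fourier_unit_mult:
  assumes "\<not> p dvd v"
  shows "fourier (b * v) = cnj (\<psi> v) * fourier b"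
proof -
  have "(\<Sum>a<m. \<psi> a * of_real (Re (zeta m (a * (b * v)))))
      = (\<Sum>a<m. cnj (\<psi> v) * (\<psi> (v * a) * of_real (Re (zeta m ((v * a) * b)))))"
  proof (intro sum.cong refl)
    fix a
    have "cnj (\<psi> v) * (\<psi> (v * a) * of_real (Re (zeta m ((v * a) * b))))
        = (cnj (\<psi> v) * \<psi> v) * (\<psi> a * of_real (Re (zeta m (a * (b * v)))))"
      by (simp only: mult mult_ac)
    then show "\<psi> a * of_real (Re (zeta m (a * (b * v))))
        = cnj (\<psi> v) * (\<psi> (v * a) * of_real (Re (zeta m ((v * a) * b))))"
      by (simp only: cnj_mult_self[OF assms] mult_1)
  qed
  also have "\<dots> = cnj (\<psi> v) * (\<Sum>a<m. \<psi> (v * a) * of_real (Re (zeta m ((v * a) * b))))"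
    by (simp add: sum_distrib_left)
  also have "(\<Sum>a<m. \<psi> (v * a) * of_real (Re (zeta m ((v * a) * b))))
      = (\<Sum>a<m. \<psi> a * of_real (Re (zeta m (a * b))))"
    using assms coprime_iff
    by (intro sum_periodic_dilate[where f = "\<lambda>a. \<psi> a * of_real (Re (zeta m (a * b)))"] m_pos)
      (auto simp: per zeta_per)
  finally show ?thesis by (simp add: fourier_def)
qed

text \<open>Orthogonality yields the mean of the values at \<open>k\<close> and \<open>- k\<close>,
  which coincide for an even character.\<close>

lemma fourier_inversion: "(\<Sum>b<m. fourier b * of_real (Re (zeta m (k * b)))) = \<psi> k"
proof -
  have delta: "(\<Sum>a<m. f a * (if [a = j] (mod m) then c else 0)) = f j * c"
    if "\<And>a. f (a + m) = f a" for f :: "nat \<Rightarrow> complex" and j c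
  proof -
    have "(\<Sum>a<m. f a * (if [a = j] (mod m) then c else 0)) = (\<Sum>a<m. if a = j mod m then f a * c else 0)"
      by (intro sum.cong refl) (auto simp: cong_def)
    also have "\<dots> = f (j mod m) * c" using m_pos by simp
    also have "f (j mod m) = f j" by (rule periodic_mod) (rule that)
    finally show ?thesis .
  qed
  have dvd: "m dvd a + k \<longleftrightarrow> [a = (m - 1) * k] (mod m)" for a
  proof -
    have "[a = (m - 1) * k] (mod m) \<longleftrightarrow> [a + k = (m - 1) * k + k] (mod m)"
      by (simp only: cong_add_rcancel_nat)
    also have "(m - 1) * k + k = m * k" using m_pos by (cases m) auto
    finally show ?thesis by (simp add: cong_def dvd_eq_mod_eq_0)
  qed
  have "(\<Sum>b<m. fourier b * of_real (Re (zeta m (k * b))))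
    = (\<Sum>b<m. \<Sum>a<m. \<psi> a / of_nat m * of_real (Re (zeta m (a * b)) * Re (zeta m (k * b))))"
    unfolding fourier_def sum_divide_distrib sum_distrib_right
    by (intro sum.cong refl) simp
  also have "\<dots> = (\<Sum>a<m. \<psi> a / of_nat m * of_real (\<Sum>b<m. Re (zeta m (a * b)) * Re (zeta m (k * b))))"
    by (subst sum.swap) (simp add: sum_distrib_left)
  also have "\<dots> = (\<Sum>a<m. \<psi> a * (if [a = (m - 1) * k] (mod m) then 1 / 2 else 0)
      + \<psi> a * (if [a = k] (mod m) then 1 / 2 else 0))"
    unfolding sum_Re_zeta_mult[OF m_pos] dvd using m_pos
    by (intro sum.cong refl) (auto simp: field_simps)
  also have "\<dots> = \<psi> ((m - 1) * k) * (1 / 2) + \<psi> k * (1 / 2)"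
    unfolding sum.distrib by (simp only: delta[of \<psi>, OF per])
  finally show ?thesis by (simp add: mult even[simplified])
qed

text \<open>The value of the L-series at 1 is \<open>- T\<close>, by letting x tend to 1 in the
  power series with coefficients \<psi>(k)/k. Averaging \<open>T\<close> over the units expresses it
  through the numbers \<open>twist b\<close>, which all vanish for \<open>b\<close> not divisible by
  \<open>m\<close> if \<open>twist 1\<close> does.\<close>

lemma twist_nonzero:
  assumes zero: "(\<Sum>a<m. \<psi> a) = 0" and zero2: "(\<Sum>a<m. (\<psi> a)\<^sup>2) = 0"
  shows "twist 1 \<noteq> 0"
proof
  assume tw: "twist 1 = 0"
  have fourier0: "fourier 0 = 0" using zero by (simp add: fourier_def)
  define T where "T = (\<Sum>b<m. fourier b * of_real (ell m b))"
  \<comment> \<open>Replacing \<open>b\<close> by \<open>v * b\<close> permutes the residues and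
    only brings out the factor \<open>cnj (\<psi> v)\<close> from the Fourier coefficient.\<close>
  have T: "T = (\<Sum>b<m. fourier b * (cnj (\<psi> v) * of_real (ell m (b * v))))" if v: "\<not> p dvd v" for v
  proof -
    have "T = (\<Sum>b<m. fourier (v * b) * of_real (ell m (v * b)))"
      unfolding T_def using v coprime_iff m_pos
      by (intro sum_periodic_dilate[where f = "\<lambda>b. fourier b * of_real (ell m b)", symmetric])
        (auto simp: fourier_def zeta_per)
    then show ?thesis
      using fourier_unit_mult[OF v] by (simp add: mult_ac)
  qed
  have "T = 0"
  proof -
    have "(\<Sum>v | v < m \<and> \<not> p dvd v. T)
        = (\<Sum>v | v < m \<and> \<not> p dvd v. \<Sum>b<m. fourier b * (cnj (\<psi> v) * of_real (ell m (b * v))))"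
      by (intro sum.cong refl T) auto
    also have "\<dots> = (\<Sum>v<m. \<Sum>b<m. fourier b * (cnj (\<psi> v) * of_real (ell m (b * v))))"
      by (intro sum.mono_neutral_left) (auto simp: zero_iff[THEN iffD2])
    also have "\<dots> = (\<Sum>b<m. fourier b * twist b)"
      by (subst sum.swap) (simp add: twist_def sum_distrib_left)
    also have "\<dots> = 0"
    proof (intro sum.neutral ballI)
      fix b assume "b \<in> {..<m}"
      then show "fourier b * twist b = 0"
        using fourier0 twist_eq_0[OF tw, of b] nat_dvd_not_less[of b m] by (cases "b = 0") auto
    qed
    finally have "of_nat (card {v. v < m \<and> \<not> p dvd v}) * T = 0" by simp
    moreover have "1 \<in> {v. v < m \<and> \<not> p dvd v}" using m_gt_1 p by auto
    then have "card {v. v < m \<and> \<not> p dvd v} \<noteq> 0" by (subst card_0_eq) auto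
    ultimately show "T = 0" by simp
  qed
  define F where "F x = (suminf (\<lambda>k. \<psi> (Suc k) * complex_of_real (x ^ Suc k / real (Suc k))))" for x
  define L where "L = (suminf (\<lambda>k. \<psi> (Suc k) * complex_of_real (1 / real (Suc k))))"
  define G where "G x = - (\<Sum>b<m. fourier b * of_real (ln (norm (1 - of_real x * zeta m b))))" for x
  have n1: "norm (\<psi> a) \<le> 1" for a using zero_iff[of a] norm[of a] by (cases "p dvd a") auto
  have shift: "(\<Sum>a<m. \<psi> (Suc a)) = 0" "(\<Sum>a<m. (\<psi> (Suc a))\<^sup>2) = 0"
    using sum_periodic_shift[of m \<psi> 1] sum_periodic_shift[of m "\<lambda>a. (\<psi> a)\<^sup>2" 1] m_pos zero zero2
    by (auto simp: per)
  \<comment> \<open>Expanding each logarithm and applying \<open>fourier_inversion\<close> to every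
    coefficient turns the finite sum into the power series.\<close>
  have FG: "F x = G x" if x: "0 \<le> x" "x < 1" for x
  proof -
    have "(\<lambda>k. fourier b * of_real (Re ((of_real x * zeta m b) ^ k) / real k)) sums
        (fourier b * of_real (- ln (norm (1 - of_real x * zeta m b))))" for b
    proof -
      have "norm (of_real x * zeta m b) < 1" using x by (simp add: norm_mult)
      from sums_minus[OF ln_norm_one_minus_sums[OF this]] show ?thesis
        by (intro sums_mult sums_of_real) simp
    qed
    then have "(\<lambda>k. \<Sum>b<m. fourier b * of_real (Re ((of_real x * zeta m b) ^ k) / real k)) sums
        (\<Sum>b<m. fourier b * of_real (- ln (norm (1 - of_real x * zeta m b))))"
      by (rule sums_sum)
    moreover have "(\<Sum>b<m. fourier b * of_real (Re ((of_real x * zeta m b) ^ k) / real k))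
        = \<psi> k * of_real (x ^ k / real k)" for k
    proof -
      have "(\<Sum>b<m. fourier b * of_real (Re ((of_real x * zeta m b) ^ k) / real k))
         = (\<Sum>b<m. fourier b * of_real (Re (zeta m (k * b)))) * of_real (x ^ k / real k)"
        unfolding sum_distrib_right
        by (intro sum.cong refl)
          (simp add: power_mult_distrib zeta_mult [symmetric] mult_ac flip: of_real_power)
      then show ?thesis by (simp only: fourier_inversion)
    qed
    ultimately have "(\<lambda>k. \<psi> k * of_real (x ^ k / real k)) sums G x"
      by (simp add: G_def sum_negf)
    then have "(\<lambda>k. \<psi> (Suc k) * of_real (x ^ Suc k / real (Suc k))) sums G x"
      by (subst sums_Suc_iff) simp
    then show ?thesis by (simp add: F_def sums_iff)
  qed
  have "(G \<longlongrightarrow> - T) (at_left 1)"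
    unfolding G_def T_def
  proof (intro tendsto_minus tendsto_sum)
    fix b assume b: "b \<in> {..<m}"
    show "((\<lambda>x. fourier b * of_real (ln (norm (1 - of_real x * zeta m b)))) \<longlongrightarrow> fourier b * of_real (ell m b)) (at_left 1)"
    \<comment> \<open>At \<open>b = 0\<close> the logarithm diverges as x tends to 1, but its
      coefficient is 0 because the character has mean zero.\<close>
    proof (cases "b = 0")
      case True
      then show ?thesis by (simp add: fourier0)
    next
      case False
      then have "zeta m b \<noteq> 1" using b zeta_eq_1_iff[OF m_pos, of b] by (auto dest: dvd_imp_le)
      then have "norm (1 - of_real 1 * zeta m b) \<noteq> 0" by simp
      then have "((\<lambda>x. fourier b * of_real (ln (norm (1 - of_real x * zeta m b))))
          \<longlongrightarrow> fourier b * of_real (ln (norm (1 - of_real 1 * zeta m b)))) (at_left 1)"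
        by (intro tendsto_intros) 
      then show ?thesis by (simp add: ell_def)
    qed
  qed
  moreover have "(G \<longlongrightarrow> L) (at_left 1)"
  proof (rule Lim_transform)
    show "((\<lambda>_. L) \<longlongrightarrow> L) (at_left 1)" by simp
    show "((\<lambda>x. G x - L) \<longlongrightarrow> 0) (at_left (1::real))"
    proof (rule Lim_null_comparison)
      show "\<forall>\<^sub>F x in at_left (1::real). norm (G x - L) \<le> real m * (1 - x)"
      proof (rule eventually_at_leftI[of 0])
        fix x :: real assume x: "x \<in> {0<..<1}"
        then show "norm (G x - L) \<le> real m * (1 - x)"
          using L_one_abel[of m \<psi> x, OF m_pos per shift(1) n1] FG[of x]
          by (simp add: F_def L_def norm_minus_commute)
      qed simp
      have "((\<lambda>x. real m * (1 - x)) \<longlongrightarrow> real m * (1 - 1)) (at_left 1)"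
        by (intro tendsto_intros)
      then show "((\<lambda>x. real m * (1 - x)) \<longlongrightarrow> 0) (at_left 1)" by simp
    qed
  qed
  ultimately have "L = 0"
    using \<open>T = 0\<close> tendsto_unique[of "at_left (1::real)" G] by force
  moreover have "L \<noteq> 0"
    unfolding L_def using norm zero_iff
    by (intro L_one_nonzero[of m \<psi>] m_pos mult one per shift) blast
  ultimately show False by simp
qed

end

section \<open>Rational independence\<close>

context cyclotomic_prime_power
begin

text \<open>The signed powers are distinct units, and there are as many of them as units.\<close>

lemma bij_betw_signed_powers:
  assumes m3: "m \<ge> 3" and g: "\<not> p dvd g"
    and inj: "\<And>i j. i < N \<Longrightarrow> j < N \<Longrightarrow> cong_pm m (g ^ i) (g ^ j) \<Longrightarrow> i = j"
    and card: "2 * N = totient m"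
  shows "bij_betw (\<lambda>(i, b). if b then g ^ i mod m else m - g ^ i mod m)
    ({..<N} \<times> UNIV) {v. v < m \<and> \<not> p dvd v}"
    (is "bij_betw ?f ?A ?B")
proof -
  have cg: "coprime (g ^ i mod m) m" for i
  proof -
    have "coprime g m" using g coprime_iff by simp
    then have "coprime (g ^ i) m" by simp
    then show ?thesis using m_pos by (simp add: coprime_mod_left_iff)
  qed
  have r: "0 < g ^ i mod m" "g ^ i mod m < m" for i
  proof -
    have "g ^ i mod m \<noteq> 0"
    proof
      assume "g ^ i mod m = 0"
      with cg[of i] have "coprime 0 m" by simp
      with m_gt_1 show False by simp
    qed
    then show "0 < g ^ i mod m" "g ^ i mod m < m" using m_pos by auto
  qed
  have pm: "cong_pm m (?f (i, b)) (g ^ i)" for i b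
  proof (cases b)
    case False
    have "[m - g ^ i mod m + g ^ i mod m = 0] (mod m)"
      using r[of i] by (simp add: cong_def)
    then have "[m - g ^ i mod m + g ^ i = 0] (mod m)"
      by (simp add: cong_def mod_simps)
    then show ?thesis using False by (simp add: cong_pm_def)
  qed (simp add: cong_pm_def cong_def)
  have inj_f: "inj_on ?f ?A"
  proof (rule inj_onI)
    fix x y assume xy: "x \<in> ?A" "y \<in> ?A" "?f x = ?f y"
    obtain i b j c where ib: "x = (i, b)" and jc: "y = (j, c)" by (cases x, cases y)
    have ij: "i < N" "j < N" and eq: "?f (i, b) = ?f (j, c)" using xy ib jc by auto
    have "cong_pm m (g ^ i) (g ^ j)"
      by (rule cong_pm_trans[OF cong_pm_sym[OF pm[of i b]]], unfold eq) (rule pm)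
    then have "i = j" using inj ij by blast
    \<comment> \<open>Otherwise this residue would divide \<open>m\<close> while being coprime to
      it, hence be 1, and \<open>m\<close> would be 2.\<close>
    moreover have "g ^ i mod m \<noteq> m - g ^ i mod m"
    proof
      assume "g ^ i mod m = m - g ^ i mod m"
      then have m2: "m = 2 * (g ^ i mod m)" using r[of i] by simp
      then have "g ^ i mod m dvd m" by (metis dvd_triv_right)
      then have "g ^ i mod m = 1"
        using cg[of i] by (metis coprime_absorb_left nat_dvd_1_iff_1)
      with m2 m3 show False by simp
    qed
    ultimately show "x = y" using eq ib jc by (auto split: if_splits)
  qed
  have "?f ` ?A \<subseteq> ?B"
  proof (rule image_subsetI)
    fix x assume "x \<in> ?A"
    obtain i b where x: "x = (i, b)" by (cases x)
    have "coprime (m - g ^ i mod m) m"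
      using cg[of i] r[of i] by (metis coprime_diff_one_left_nat coprime_iff_gcd_eq_1 gcd.commute gcd_diff1_nat gcd_diff2_nat less_imp_le)
    then show "?f x \<in> ?B"
      using cg[of i] r[of i] coprime_iff by (auto simp: x)
  qed
  moreover have "card (?f ` ?A) = card ?B"
  proof -
    have "?B = totatives m"
    proof (rule Set.set_eqI)
      fix v
      have "v \<noteq> 0 \<and> v \<noteq> m" if "coprime v m" using that m_gt_1 by (cases "v = 0") auto
      then show "v \<in> ?B \<longleftrightarrow> v \<in> totatives m"
        unfolding totatives_def using coprime_iff[of v] le_neq_implies_less[of v m] by auto
    qed
    then have "card ?B = totient m" by (simp add: totient_def)
    moreover have "card (?f ` ?A) = 2 * N"
      unfolding card_image[OF inj_f] by (simp add: card_cartesian_product)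
    ultimately show ?thesis using card by simp
  qed
  ultimately have "?f ` ?A = ?B" by (intro card_subset_eq) auto
  then show ?thesis using inj_f by (simp add: bij_betw_def)
qed

text \<open>For odd \<open>p\<close> a primitive root works: squaring removes the sign, and the
  exponents \<open>2 * i\<close> stay below the order. For \<open>p = 2\<close> the number 5 has
  order \<open>2 ^ (n - 2)\<close> when \<open>n \<ge> 3\<close>, and 5^i + 5^j is 2 modulo 4, which
  excludes the minus sign; for \<open>n = 2\<close> only the exponent 0 occurs.\<close>

lemma exists_pm_generator:
  assumes n2: "n \<ge> 2"
  shows "\<exists>g N. N > 0 \<and> \<not> p dvd g \<and> 2 * N = totient m \<and>
    (\<forall>i<N. \<forall>j<N. cong_pm m (g ^ i) (g ^ j) \<longrightarrow> i = j)"
proof (cases "p = 2")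
  case False
  then have odd: "odd p" using p primes_dvd_imp_eq two_is_prime_nat by blast
  have m3: "m > 2"
    using m_gt_1 odd n unfolding m by (metis even_power One_nat_def Suc_leI dvd_refl le_neq_implies_less numeral_2_eq_2)
  obtain g where "\<forall>k>0. residue_primroot (p ^ k) g"
    using residue_primroot_odd_prime_power_exists[OF p odd] by blast
  then have g: "residue_primroot m g" using n by (simp add: m)
  obtain N where N: "totient m = 2 * N" using totient_even[OF m3] by auto
  have cop: "coprime m g" and ord: "ord m g = totient m"
    using g by (auto simp: residue_primroot_def)
  have "i = j" if ij: "i < N" "j < N" and pm: "cong_pm m (g ^ i) (g ^ j)" for i j
  proof -
    have "[(g ^ i)\<^sup>2 = (g ^ j)\<^sup>2] (mod m)"
    proof -
      consider "[int (g ^ i) = int (g ^ j)] (mod int m)" | "[int (g ^ i) = - int (g ^ j)] (mod int m)"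
        using pm unfolding cong_pm_iff_int by blast
      then have "[(int (g ^ i))\<^sup>2 = (int (g ^ j))\<^sup>2] (mod int m)"
        by cases (metis cong_pow, metis cong_pow power2_minus)
      then show ?thesis by (simp flip: cong_int_iff)
    qed
    then have "g ^ (2 * i) mod m = g ^ (2 * j) mod m"
      by (simp add: cong_def mult.commute[of 2] power_mult)
    with inj_on_eq_iff[OF inj_power_mod[OF cop], of "2 * i" "2 * j"] ij N ord
    show "i = j" by simp
  qed
  moreover have "N > 0" using N m_pos by (intro Nat.gr0I) simp
  moreover have "\<not> p dvd g" using cop coprime_iff coprime_commute by blast
  ultimately show ?thesis using N by metis
next
  case True
  have tot: "totient m = 2 * 2 ^ (n - 2)"
  proof -
    have "n - 1 = Suc (n - 2)" using n2 by simp
    then show ?thesis using n by (simp add: m True totient_prime_power)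
  qed
  have "i = j" if ij: "i < 2 ^ (n - 2)" "j < 2 ^ (n - 2)" and pm: "cong_pm m (5 ^ i) (5 ^ j)" for i j :: nat
  proof (cases "n = 2")
    case False
    with n2 have n3: "n \<ge> 3" by simp
    have "ord m (5::nat) = 2 ^ (n - 2)" using ord_twopow_3_5[OF n3, of 5] by (simp add: m True)
    moreover have "coprime m (5::nat)" unfolding m True by (simp add: coprime_power_left_iff)
    moreover have "\<not> [5 ^ i + 5 ^ j = 0] (mod m)"
    proof
      assume "[5 ^ i + 5 ^ j = (0::nat)] (mod m)"
      moreover have "4 dvd m" unfolding m True using n2 le_imp_power_dvd[of 2 n 2] by simp
      ultimately have "[5 ^ i + 5 ^ j = (0::nat)] (mod 4)" by (rule cong_dvd_modulus_nat)
      moreover have "[5 ^ i + 5 ^ j = 1 ^ i + (1::nat) ^ j] (mod 4)"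
        by (intro cong_add cong_pow) (simp_all add: cong_def)
      ultimately show False by (simp add: cong_def)
    qed
    ultimately show ?thesis
      using inj_on_eq_iff[OF inj_power_mod, of m 5 i j] ij pm by (simp add: cong_pm_def cong_def)
  qed (use ij in simp)
  then show ?thesis
    using tot by (intro exI[of _ 5] exI[of _ "2 ^ (n - 2)"]) (auto simp: True)
qed

end

section \<open>The cyclic group of units modulo sign and its characters\<close>

locale pm_generator = cyclotomic_prime_power +
  fixes g N :: nat
  assumes N_pos: "N > 0" and g: "\<not> p dvd g" and n2: "n \<ge> 2"
    and card_N: "2 * N = totient m"
    and inj_g: "i < N \<Longrightarrow> j < N \<Longrightarrow> cong_pm m (g ^ i) (g ^ j) \<Longrightarrow> i = j"
begin

lemma m_ge_3: "m \<ge> 3"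
proof -
  have "2 ^ 2 \<le> p ^ 2" using p_gt_1 by (intro power_mono) auto
  also have "\<dots> \<le> m" unfolding m using n2 p_gt_1 by (intro power_increasing) auto
  finally show ?thesis by simp
qed

lemma bij_signed_powers: "bij_betw (\<lambda>(i, b). if b then g ^ i mod m else m - g ^ i mod m)
    ({..<N} \<times> UNIV) {v. v < m \<and> \<not> p dvd v}"
  using bij_betw_signed_powers[OF m_ge_3 g _ card_N] inj_g by blast

lemma g_power_unit: "\<not> p dvd g ^ i"
  using g p prime_dvd_power by blast

lemma cong_pm_mod: "cong_pm m (v mod m) v"
  by (simp add: cong_pm_def cong_def)

lemma cong_pm_neg_mod:
  assumes "\<not> m dvd v"
  shows "cong_pm m (m - v mod m) v"
proof -
  have "[m - v mod m + v mod m = 0] (mod m)"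
    using m_pos by (simp add: cong_def less_imp_le)
  then have "[m - v mod m + v = 0] (mod m)"
    by (simp add: cong_def mod_simps)
  then show ?thesis by (simp add: cong_pm_def)
qed

text \<open>The discrete logarithm to the base \<open>g\<close>, up to sign.\<close>

definition ind :: "nat \<Rightarrow> nat" where
  "ind v = (THE i. i < N \<and> cong_pm m v (g ^ i))"

lemma ind_unique:
  assumes "i < N" "cong_pm m v (g ^ i)"
  shows "ind v = i"
  unfolding ind_def
proof (rule the_equality)
  fix j assume "j < N \<and> cong_pm m v (g ^ j)"
  with assms show "j = i" using inj_g cong_pm_sym cong_pm_trans by blast
qed (use assms in auto)

lemma ind:
  assumes "\<not> p dvd v"
  shows "ind v < N" "cong_pm m v (g ^ ind v)"
proof -
  have "p dvd m" using n by (simp add: m)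
  then have "\<not> p dvd v mod m" using assms by (simp add: dvd_mod_iff)
  then have "v mod m \<in> (\<lambda>(i, b). if b then g ^ i mod m else m - g ^ i mod m) ` ({..<N} \<times> UNIV)"
    using bij_signed_powers m_pos by (simp only: bij_betw_def) simp
  then obtain x where x: "x \<in> {..<N} \<times> UNIV"
    "v mod m = (case x of (i, b) \<Rightarrow> if b then g ^ i mod m else m - g ^ i mod m)" by blast
  obtain i b where "x = (i, b)" by (cases x)
  with x have i: "i < N" "v mod m = (if b then g ^ i mod m else m - g ^ i mod m)" by auto
  have "cong_pm m (v mod m) (g ^ i)"
    using i(2) cong_pm_mod cong_pm_neg_mod[OF unit_not_dvd[OF g_power_unit]] by metis
  then have "cong_pm m v (g ^ i)"
    using cong_pm_mod cong_pm_sym cong_pm_trans by blast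
  with ind_unique[OF i(1) this] i(1) show "ind v < N" "cong_pm m v (g ^ ind v)" by auto
qed

lemma coprime_g: "coprime g m"
  using g coprime_iff by simp

text \<open>\<open>g ^ N\<close> agrees up to sign with some \<open>g ^ i\<close> below
  \<open>N\<close>; if \<open>i\<close> were positive, cancelling \<open>g\<close> would identify
  two distinct powers below \<open>N\<close>.\<close>

lemma g_power_N: "cong_pm m (g ^ N) 1"
proof -
  define i where "i = ind (g ^ N)"
  have i: "i < N" "cong_pm m (g ^ N) (g ^ i)"
    unfolding i_def using ind[OF g_power_unit] by auto
  have "i = 0"
  proof (rule ccontr)
    assume "i \<noteq> 0"
    then have "cong_pm m (g * g ^ (N - 1)) (g * g ^ (i - 1))"
      using i N_pos by (simp flip: power_Suc)
    then have "cong_pm m (g ^ (N - 1)) (g ^ (i - 1))"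
      using coprime_g by (rule cong_pm_cancel)
    then have "N - 1 = i - 1" using i(1) by (intro inj_g) auto
    with i(1) \<open>i \<noteq> 0\<close> show False by simp
  qed
  with i show ?thesis by simp
qed

lemma g_power_mod: "cong_pm m (g ^ i) (g ^ (i mod N))"
proof -
  have "cong_pm m ((g ^ N) ^ (i div N) * g ^ (i mod N)) (1 ^ (i div N) * g ^ (i mod N))"
    by (intro cong_pm_mult cong_pm_power g_power_N cong_pm_refl)
  then show ?thesis by (simp flip: power_mult power_add)
qed

lemma ell_g_period: "ell m (g ^ (i + N)) = ell m (g ^ i)"
  using ell_cong_pm[OF m_pos g_power_mod[of i]] ell_cong_pm[OF m_pos g_power_mod[of "i + N"]] by simp

lemma sum_units_even:
  fixes F :: "nat \<Rightarrow> 'a :: comm_semiring_1"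
  assumes "\<And>a b. cong_pm m a b \<Longrightarrow> F a = F b"
  shows "(\<Sum>v | v < m \<and> \<not> p dvd v. F v) = 2 * (\<Sum>i<N. F (g ^ i))"
proof -
  have "(\<Sum>v | v < m \<and> \<not> p dvd v. F v)
      = (\<Sum>(i, b)\<in>{..<N} \<times> (UNIV :: bool set). F (if b then g ^ i mod m else m - g ^ i mod m))"
    using sum.reindex_bij_betw[OF bij_signed_powers, of F] by (simp add: case_prod_unfold)
  also have "\<dots> = (\<Sum>(i, b)\<in>{..<N} \<times> (UNIV :: bool set). F (g ^ i))"
    using assms[OF cong_pm_mod] assms[OF cong_pm_neg_mod[OF unit_not_dvd[OF g_power_unit]]]
    by (intro sum.cong refl) auto
  also have "\<dots> = 2 * (\<Sum>i<N. F (g ^ i))"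
    by (simp add: sum.cartesian_product [symmetric] sum_distrib_left UNIV_bool mult_2)
  finally show ?thesis .
qed

text \<open>For an \<open>N\<close>-th root of unity \<open>w\<close> this is the even character
  sending \<open>g\<close> to \<open>w\<close>.\<close>

definition \<psi> :: "complex \<Rightarrow> nat \<Rightarrow> complex" where
  "\<psi> w v = (if p dvd v then 0 else w ^ ind v)"

lemma root_power_mod: "w ^ N = 1 \<Longrightarrow> w ^ i = w ^ (i mod N)" for w :: complex
  by (metis mult_1 power_add power_mult power_one div_mult_mod_eq mult.commute)

lemma \<psi>_eq:
  assumes "w ^ N = 1" "cong_pm m v (g ^ i)" "\<not> p dvd v"
  shows "\<psi> w v = w ^ i"
proof -
  have "ind v = i mod N"
    using assms(2) g_power_mod N_pos cong_pm_trans by (intro ind_unique) auto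
  then show ?thesis using assms root_power_mod[of w i] by (simp add: \<psi>_def)
qed

lemma character:
  assumes w: "w ^ N = 1"
  shows "prime_power_character p n m (\<psi> w)"
proof unfold_locales
  have "norm w ^ N = 1" using w by (simp flip: norm_power)
  then have w1: "norm w = 1" using power_eq_iff_eq_base[of N "norm w" 1] N_pos by simp
  have "p dvd m" using n by (simp add: m)
  show "\<psi> w a = 0 \<longleftrightarrow> p dvd a" for a using w1 by (auto simp: \<psi>_def)
  show "norm (\<psi> w a) = 1" if "\<not> p dvd a" for a using that w1 by (simp add: \<psi>_def norm_power)
  show "\<psi> w (a * b) = \<psi> w a * \<psi> w b" for a b
  proof (cases "p dvd a \<or> p dvd b")
    case False
    then have nd: "\<not> p dvd a" "\<not> p dvd b" "\<not> p dvd a * b"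
      using p by (auto simp: prime_dvd_mult_iff)
    have "cong_pm m (a * b) (g ^ (ind a + ind b))"
      unfolding power_add using ind nd by (intro cong_pm_mult) auto
    from \<psi>_eq[OF w this nd(3)] nd show ?thesis by (simp add: \<psi>_def power_add)
  qed (auto simp: \<psi>_def)
  show "\<psi> w (a + m) = \<psi> w a" for a
  proof (cases "p dvd a")
    case False
    then have nd: "\<not> p dvd a + m" using \<open>p dvd m\<close> by (simp add: dvd_add_left_iff)
    have "cong_pm m (a + m) a" by (simp add: cong_pm_def cong_def)
    then have "cong_pm m (a + m) (g ^ ind a)" using ind(2)[OF False] cong_pm_trans by blast
    from \<psi>_eq[OF w this nd] False show ?thesis by (simp add: \<psi>_def)
  qed (use \<open>p dvd m\<close> in \<open>simp add: \<psi>_def\<close>)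
  show "\<psi> w (m - 1) = 1"
  proof -
    have "cong_pm m (m - 1) (g ^ 0)" using m_pos by (simp add: cong_pm_def cong_def)
    moreover have "\<not> p dvd m - 1"
      using \<open>p dvd m\<close> m_pos p by (metis One_nat_def Suc_pred dvd_add_right_iff not_prime_unit plus_1_eq_Suc add.commute)
    ultimately show ?thesis using \<psi>_eq[OF w, of "m - 1" 0] by simp
  qed
qed

text \<open>The discrete Fourier transform of the logarithms over the units modulo sign, not a
  Dirichlet L-function.\<close>

definition L :: "complex \<Rightarrow> complex" where
  "L w = (\<Sum>i<N. w ^ i * of_real (ell m (g ^ i)))"

lemma \<psi>_cong_pm:
  assumes w: "w ^ N = 1" and ab: "cong_pm m a b"
  shows "\<psi> w a = \<psi> w b"
proof -
  have "p dvd a \<longleftrightarrow> p dvd b" using ab by (rule cong_pm_dvd_iff)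
  moreover have "\<psi> w a = \<psi> w b" if "\<not> p dvd a" "\<not> p dvd b"
    using \<psi>_eq[OF w cong_pm_trans[OF ab ind(2)]] that by (simp add: \<psi>_def)
  ultimately show ?thesis by (auto simp: \<psi>_def)
qed

text \<open>Multiplying the argument by \<open>g\<close> permutes the residues but multiplies the
  sum by \<open>w ^ k\<close>. The exponents 1 and 2 will show that the character and its square are
  nonprincipal.\<close>

lemma sum_\<psi>_power:
  assumes w: "w ^ N = 1" and "w ^ k \<noteq> 1"
  shows "(\<Sum>a<m. \<psi> w a ^ k) = 0"
proof -
  interpret prime_power_character p n m "\<psi> w" by (rule character[OF w])
  have "\<psi> w g = w" using \<psi>_eq[OF w, of g 1] g by simp
  have "k \<noteq> 0" using assms(2) by (intro notI) simp
  have "(\<Sum>a<m. \<psi> w a ^ k) = (\<Sum>a<m. \<psi> w (g * a) ^ k)"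
    by (rule sum_periodic_dilate[where f = "\<lambda>a. \<psi> w a ^ k", symmetric])
      (use m_pos per coprime_g in auto)
  also have "\<dots> = w ^ k * (\<Sum>a<m. \<psi> w a ^ k)"
    by (simp add: mult \<open>\<psi> w g = w\<close> power_mult_distrib sum_distrib_left)
  finally have "(1 - w ^ k) * (\<Sum>a<m. \<psi> w a ^ k) = 0"
    by (simp add: left_diff_distrib)
  then show ?thesis using assms(2) by simp
qed

text \<open>\<open>2 * L w\<close> is \<open>twist 1\<close> for the character belonging to the
  conjugate of \<open>w\<close>, since \<open>twist\<close> conjugates the character.\<close>

lemma L_nonzero_complex:
  assumes w: "w ^ N = 1" and w2: "w\<^sup>2 \<noteq> 1"
  shows "L w \<noteq> 0"
proof -
  define w' where "w' = cnj w"
  have w': "w' ^ N = 1" "w' ^ 2 \<noteq> 1" "w' ^ 1 \<noteq> 1"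
    using w w2 by (auto simp: w'_def simp flip: complex_cnj_power)
  interpret prime_power_character p n m "\<psi> w'" by (rule character[OF w'(1)])
  have "twist 1 = (\<Sum>v | v < m \<and> \<not> p dvd v. cnj (\<psi> w' v) * of_real (ell m v))"
    unfolding twist_def by (intro sum.mono_neutral_cong_right) (auto simp: \<psi>_def)
  also have "\<dots> = 2 * (\<Sum>i<N. cnj (\<psi> w' (g ^ i)) * of_real (ell m (g ^ i)))"
  proof (rule sum_units_even)
    fix a b assume ab: "cong_pm m a b"
    show "cnj (\<psi> w' a) * complex_of_real (ell m a) = cnj (\<psi> w' b) * of_real (ell m b)"
      unfolding \<psi>_cong_pm[OF w'(1) ab] ell_cong_pm[OF m_pos ab] ..
  qed
  also have "\<dots> = 2 * L w"
    unfolding L_def using \<psi>_eq[OF w'(1) cong_pm_refl g_power_unit]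
    by (simp add: w'_def)
  finally show ?thesis
    using twist_nonzero sum_\<psi>_power[OF w'(1,2)] sum_\<psi>_power[OF w'(1,3)] by auto
qed

lemma sum_ell_g: "(\<Sum>i<N. ell m (g ^ i)) = ln p / 2"
  using sum_ell_units sum_units_even[of "ell m", OF ell_cong_pm[OF m_pos]] by simp

lemma L_nonzero_one: "L 1 \<noteq> 0"
proof -
  have "L 1 = of_real (ln p / 2)"
    unfolding L_def by (simp add: sum_ell_g flip: of_real_sum)
  moreover have "ln (real p) / 2 \<noteq> 0" using p_gt_1 by simp
  ultimately show ?thesis by (metis of_real_eq_0_iff)
qed

text \<open>
  If the alternating sum vanishes, the product of the \<open>\<bar>1 - \<zeta>\<^bsup>ak\<^esup>\<bar>\<^sup>2\<close> over the even powers \<open>k\<close> of \<open>g\<close> equals \<open>\<surd>p\<close>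
  for every unit \<open>a\<close>, while the sum of these products over all \<open>a\<close> is an integer.
\<close>

lemma L_nonzero_minus_one:
  assumes N: "(- 1 :: complex) ^ N = 1"
  shows "L (- 1) \<noteq> 0"
proof
  assume L0: "L (- 1) = 0"
  \<comment> \<open>Evenness of \<open>N\<close> makes the signs \<open>s\<close> periodic modulo
    \<open>N\<close>, so the alternating sum may be shifted.\<close>
  have evN: "even N" using N by (metis minus_one_power_iff neg_equal_iff_equal one_neq_neg_one)
  define s where "s i = (- 1 :: real) ^ i" for i :: nat
  have alt: "(\<Sum>i<N. s i * ell m (g ^ i)) = 0"
  proof -
    have "L (- 1) = of_real (\<Sum>i<N. s i * ell m (g ^ i))" by (simp add: L_def s_def)
    with L0 show ?thesis by (metis of_real_eq_0_iff)
  qed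
  define K where "K = (\<lambda>i. g ^ i) ` {i. i < N \<and> even i}"
  have inj: "inj_on (\<lambda>i. g ^ i) {i. i < N \<and> even i}"
    using inj_g by (intro inj_onI) (metis (mono_tags, lifting) cong_pm_refl mem_Collect_eq)
  \<comment> \<open>The sum over even \<open>i\<close> is half of the full sum plus or minus the
    alternating one. Both are shifts of the sums for \<open>a = 1\<close>, whose values are ln p / 2
    and 0.\<close>
  have half: "(\<Sum>k\<in>K. ell m (a * k)) = ln p / 4" if a: "\<not> p dvd a" for a
  proof -
    define j where "j = ind a"
    have "(\<Sum>k\<in>K. ell m (a * k)) = (\<Sum>i | i < N \<and> even i. ell m (a * g ^ i))"
      unfolding K_def by (rule sum.reindex[OF inj, unfolded o_def])
    also have "\<dots> = (\<Sum>i | i < N \<and> even i. ell m (g ^ (i + j)))"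
      using ind(2)[OF a] unfolding j_def power_add mult.commute[of "g ^ _" "g ^ ind a"]
      by (intro sum.cong refl ell_cong_pm m_pos cong_pm_mult cong_pm_refl)
    also have "\<dots> = (\<Sum>i<N. if even i then ell m (g ^ (i + j)) else 0)"
      by (intro sum.mono_neutral_cong_left) auto
    also have "\<dots> = (\<Sum>i<N. (ell m (g ^ (i + j)) + s j * (s (i + j) * ell m (g ^ (i + j)))) / 2)"
      by (intro sum.cong refl) (auto simp: s_def power_add minus_one_power_iff)
    also have "\<dots> = ((\<Sum>i<N. ell m (g ^ (i + j))) + s j * (\<Sum>i<N. s (i + j) * ell m (g ^ (i + j)))) / 2"
      by (simp add: sum.distrib sum_distrib_left flip: sum_divide_distrib)
    also have "(\<Sum>i<N. ell m (g ^ (i + j))) = (\<Sum>i<N. ell m (g ^ i))"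
      by (rule sum_periodic_shift[where f = "\<lambda>i. ell m (g ^ i)"]) (use N_pos ell_g_period in auto)
    also have "(\<Sum>i<N. s (i + j) * ell m (g ^ (i + j))) = (\<Sum>i<N. s i * ell m (g ^ i))"
      by (rule sum_periodic_shift[where f = "\<lambda>i. s i * ell m (g ^ i)"])
        (use N_pos ell_g_period evN in \<open>auto simp: s_def power_add\<close>)
    finally show ?thesis by (simp add: alt sum_ell_g)
  qed
  define F where "F = norm_poly K (\<lambda>_. 1)"
  have Fa: "int_poly_eval F (zeta m a) = of_real (sqrt p)" if a: "\<not> p dvd a" for a
  proof -
    have "int_poly_eval F (zeta m a) = of_real (exp (2 * (\<Sum>k\<in>K. real 1 * ell m (a * k))))"
      unfolding F_def
    proof (rule int_poly_eval_norm_poly)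
      fix k assume "k \<in> K"
      then show "\<not> m dvd a * k"
        using a g_power_unit p by (intro unit_not_dvd) (auto simp: K_def prime_dvd_mult_iff)
    qed (simp add: K_def)
    also have "2 * (\<Sum>k\<in>K. real 1 * ell m (a * k)) = ln (sqrt p)"
      using half[OF a] p_pos by (simp add: ln_sqrt)
    finally show ?thesis using p_pos by simp
  qed
  define c where "c = card {a. a < m \<and> \<not> p dvd a}"
  have "1 \<in> {a. a < m \<and> \<not> p dvd a}" using m_gt_1 p by auto
  then have c0: "c \<noteq> 0" unfolding c_def by (subst card_0_eq) auto
  \<comment> \<open>All conjugates of the value of \<open>F\<close> equal the square root of
    \<open>p\<close>, so an integer trace makes \<open>c\<close> times this root an integer.\<close>
  have "(\<Sum>a | a < m \<and> \<not> p dvd a. int_poly_eval F (zeta m a)) = of_nat c * of_real (sqrt p)"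
    by (simp add: Fa c_def)
  then have "complex_of_real (real c * sqrt p) \<in> \<int>"
    using sum_int_poly_eval_units_int[of F] by simp
  then obtain z where "complex_of_real (real c * sqrt p) = of_int z" by (elim Ints_cases)
  then have z: "real c * sqrt p = of_int z"
    by (metis of_real_eq_iff of_real_of_int_eq)
  have "real ((nat \<bar>z\<bar>)\<^sup>2) = (of_int z)\<^sup>2" by simp
  also have "\<dots> = real (c\<^sup>2 * p)"
    by (simp add: z [symmetric] power_mult_distrib)
  finally have "(nat \<bar>z\<bar>)\<^sup>2 = c\<^sup>2 * p" by (simp only: of_nat_eq_iff)
  moreover from this have "nat \<bar>z\<bar> \<noteq> 0" using c0 p_pos by (intro notI) simp
  moreover have "prime_elem p" using p by simp
  \<comment> \<open>The exponent of \<open>p\<close> is even in a square but odd in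
    \<open>c\<^sup>2 * p\<close>.\<close>
  ultimately have "2 * multiplicity p (nat \<bar>z\<bar>) = 2 * multiplicity p c + 1"
    using c0 p_pos prime_elem_multiplicity_power_distrib[of p "nat \<bar>z\<bar>" 2]
      prime_elem_multiplicity_power_distrib[of p c 2] prime_elem_multiplicity_mult_distrib[of p "c\<^sup>2" p]
    by (simp del: nat_0_iff zero_less_nat_eq)
  then show False by presburger
qed

lemma L_nonzero:
  assumes w: "w ^ N = 1"
  shows "L w \<noteq> 0"
proof (cases "w\<^sup>2 = 1")
  case True
  then have "w = 1 \<or> w = - 1" by (simp add: power2_eq_1_iff)
  then show ?thesis using L_nonzero_one L_nonzero_minus_one w by auto
qed (use L_nonzero_complex w in auto)

text \<open>The coefficients, placed at the exponents \<open>ind k\<close>, form a polynomial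
  \<open>P\<close> of degree below \<open>N\<close>. Nonvanishing of the Fourier transform forces
  \<open>P\<close> to vanish at all \<open>N\<close>-th roots of unity, so
  \<open>P = 0\<close>.\<close>

lemma ell_relation_trivial:
  fixes c :: "nat \<Rightarrow> int"
  assumes rel: "(\<Sum>k | 1 \<le> k \<and> k \<le> m div 2 \<and> \<not> p dvd k. of_int (c k) * ell m k) = 0"
    and k: "1 \<le> k" "k \<le> m div 2" "\<not> p dvd k"
  shows "c k = 0"
proof -
  define K where "K = {k. 1 \<le> k \<and> k \<le> m div 2 \<and> \<not> p dvd k}"
  have fin: "finite K" by (rule finite_subset[of _ "{..m}"]) (auto simp: K_def)
  \<comment> \<open>If \<open>a + b\<close> is a multiple of \<open>m\<close> with both at most m/2,
    then both equal m/2.\<close>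
  have inj: "inj_on ind K"
  proof (rule inj_onI)
    fix a b assume ab: "a \<in> K" "b \<in> K" "ind a = ind b"
    then have "cong_pm m a b"
      using ind(2)[of a] ind(2)[of b] cong_pm_sym cong_pm_trans by (metis (mono_tags, lifting) K_def mem_Collect_eq)
    then consider "[a = b] (mod m)" | "[a + b = 0] (mod m)" by (auto simp: cong_pm_def)
    then show "a = b"
    proof cases
      case 1
      moreover have "a < m" "b < m" using ab m_gt_1 by (auto simp: K_def)
      ultimately show ?thesis using cong_less_modulus_unique_nat by blast
    next
      case 2
      then have "m dvd a + b" by (simp add: cong_0_iff)
      then have "m \<le> a + b" using ab by (intro dvd_imp_le) (auto simp: K_def)
      then show ?thesis using ab by (auto simp: K_def)
    qed
  qed
  define P :: "complex poly" where "P = (\<Sum>k\<in>K. Polynomial.monom (of_int (c k)) (ind k))"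
  have root: "poly P w = 0" if w: "w ^ N = 1" for w
  proof -
    have "w \<noteq> 0" using w N_pos by (intro notI) (simp add: zero_power)
    define w' where "w' = inverse w"
    have w': "w' ^ N = 1" "w' \<noteq> 0" using w \<open>w \<noteq> 0\<close> by (simp_all add: w'_def power_inverse)
    have shift: "(\<Sum>j<N. w' ^ j * of_real (ell m (g ^ (j + i)))) = w ^ i * L w'" for i
    proof -
      have "(\<Sum>j<N. w' ^ j * of_real (ell m (g ^ (j + i))))
          = w ^ i * (\<Sum>j<N. w' ^ (j + i) * of_real (ell m (g ^ (j + i))))"
      proof -
        have "w ^ i * w' ^ i = 1" using \<open>w \<noteq> 0\<close> by (simp add: w'_def flip: power_mult_distrib)
        then have "w ^ i * (w' ^ (j + i) * x) = w' ^ j * x" for j x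
          by (metis (no_types, opaque_lifting) mult.assoc mult.commute mult_1 power_add)
        then show ?thesis by (simp only: sum_distrib_left)
      qed
      also have "(\<Sum>j<N. w' ^ (j + i) * of_real (ell m (g ^ (j + i)))) = L w'"
        unfolding L_def using w' N_pos ell_g_period
        by (intro sum_periodic_shift[where f = "\<lambda>j. w' ^ j * of_real (ell m (g ^ j))"])
          (auto simp: power_add)
      finally show ?thesis .
    qed
    \<comment> \<open>This product is the Fourier transform at \<open>w'\<close> of the relation
      multiplied by the powers of \<open>g\<close>. Each of these relations holds by
      \<open>conjugate_ell_relation\<close>.\<close>
    have "poly P w * L w' = (\<Sum>k\<in>K. of_int (c k) * (\<Sum>j<N. w' ^ j * of_real (ell m (g ^ (j + ind k)))))"
      by (simp add: P_def poly_sum poly_monom shift sum_distrib_right mult.assoc)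
    also have "\<dots> = (\<Sum>j<N. w' ^ j * of_real (\<Sum>k\<in>K. of_int (c k) * ell m (g ^ (j + ind k))))"
      by (simp add: sum_distrib_left mult_ac) (rule sum.swap)
    also have "\<dots> = (\<Sum>j<N. w' ^ j * of_real (\<Sum>k\<in>K. of_int (c k) * ell m (g ^ j * k)))"
    proof -
      have "ell m (g ^ (j + ind k)) = ell m (g ^ j * k)" if "k \<in> K" for j k
      proof -
        have "cong_pm m (g ^ ind k) k" using that cong_pm_sym[OF ind(2)] by (simp add: K_def)
        then show ?thesis
          unfolding power_add by (rule ell_cong_pm[OF m_pos cong_pm_mult[OF cong_pm_refl]])
      qed
      then show ?thesis by (simp cong: sum.cong)
    qed
    also have "\<dots> = 0"
    proof -
      have "(\<Sum>k\<in>K. of_int (c k) * ell m (g ^ j * k)) = 0" for j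
        using conjugate_ell_relation[OF fin _ _ g_power_unit, of c j] rel by (simp add: K_def)
      then show ?thesis by simp
    qed
    finally show ?thesis using L_nonzero[OF w'(1)] by simp
  qed
  have "P = 0"
  proof (rule ccontr)
    assume "P \<noteq> 0"
    then have "card {w. poly P w = 0} \<le> degree P" by (rule card_poly_roots_bound)
    moreover have "degree P < N"
      unfolding P_def using ind(1) N_pos
      by (intro degree_sum_less) (auto simp: K_def intro!: le_less_trans[OF degree_monom_le])
    moreover have "card {w::complex. w ^ N = 1} \<le> card {w. poly P w = 0}"
      using root poly_roots_finite[OF \<open>P \<noteq> 0\<close>] by (intro card_mono) auto
    moreover have "card {w::complex. w ^ N = 1} = N" using N_pos by (intro card_roots_unity_eq)
    ultimately show False by simp
  qed
  have kK: "k \<in> K" using k by (simp add: K_def)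
  have "0 = Polynomial.coeff P (ind k)" using \<open>P = 0\<close> by simp
  also have "\<dots> = (\<Sum>l\<in>K. if l = k then of_int (c l) else 0)"
    unfolding P_def coeff_sum coeff_monom
    using inj_on_eq_iff[OF inj _ kK] by (intro sum.cong refl) auto
  also have "\<dots> = of_int (c k)" using fin kK by simp
  finally show ?thesis by simp
qed

end

theorem ell_independent:
  fixes c :: "nat \<Rightarrow> int"
  assumes "prime p" "n \<ge> 2" "m = p ^ n"
    and "(\<Sum>k | 1 \<le> k \<and> k \<le> m div 2 \<and> \<not> p dvd k. of_int (c k) * ell m k) = 0"
    and "1 \<le> k" "k \<le> m div 2" "\<not> p dvd k"
  shows "c k = 0"
proof -
  interpret cyclotomic_prime_power p n m using assms by unfold_locales auto
  obtain g N where "N > 0" "\<not> p dvd g" "2 * N = totient m"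
    "\<forall>i<N. \<forall>j<N. cong_pm m (g ^ i) (g ^ j) \<longrightarrow> i = j"
    using exists_pm_generator[OF assms(2)] by blast
  then interpret pm_generator p n m g N using assms by unfold_locales auto
  show ?thesis using ell_relation_trivial assms by blast
qed

section \<open>The relations \<open>R\<close>\<close>

lemma common_denominator:
  fixes c :: "'a \<Rightarrow> rat"
  assumes "finite K"
  shows "\<exists>d :: int. d \<noteq> 0 \<and> (\<forall>k\<in>K. \<exists>z. c k * of_int d = of_int z)"
  using assms
proof (induction K rule: finite_induct)
  case (insert x K)
  then obtain d where d: "d \<noteq> 0" "\<And>k. k \<in> K \<Longrightarrow> \<exists>z. c k * of_int d = of_int z" by blast
  obtain a b :: int where ab: "c x = of_int a / of_int b" "b > 0"
    by (cases "c x") (metis Fract_of_int_quotient)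
  have "\<exists>z. c k * of_int (d * b) = of_int z" if "k \<in> insert x K" for k
  proof (cases "k = x")
    case True
    have "c k * of_int (d * b) = of_int (a * d)"
      using ab by (simp add: True)
    then show ?thesis by blast
  next
    case False
    with that d obtain z where "c k * of_int d = of_int z" by blast
    then have "c k * of_int (d * b) = of_int (z * b)"
      by (simp flip: mult.assoc)
    then show ?thesis by blast
  qed
  then show ?case using d(1) ab(2) by (intro exI[of _ "d * b"]) auto
qed (auto intro: exI[of _ 1])

lemma norm_one_minus_cis: "norm (1 - cis x) = 2 * \<bar>sin (x / 2)\<bar>"
proof -
  have "(norm (1 - cis x))\<^sup>2 = (1 - cos x)\<^sup>2 + (sin x)\<^sup>2"
    by (simp add: cmod_power2)
  also have "\<dots> = 2 - 2 * cos x"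
    using sin_cos_squared_add[of x] by (simp add: power2_eq_square algebra_simps)
  also have "cos x = 1 - 2 * (sin (x / 2))\<^sup>2"
    using cos_double_sin[of "x / 2"] by simp
  finally have "(norm (1 - cis x))\<^sup>2 = (2 * \<bar>sin (x / 2)\<bar>)\<^sup>2"
    by (simp add: power_mult_distrib)
  then show ?thesis by (rule power2_eq_imp_eq) auto
qed

text \<open>|1 - e^(ix)| = 2 |sin(x/2)|, and the factors 2 cancel in the quotient of sines.\<close>

lemma U_eq_ell:
  assumes "0 < k" "k < m"
  shows "U m k = (ell m k - ell m 1) / ln 2"
proof -
  have pos: "sin (pi * real a / real m) > 0" if "0 < a" "a < m" for a
    using that by (intro sin_gt_zero) (auto simp: field_simps)
  have e: "ell m a = ln (2 * sin (pi * real a / real m))" if "0 < a" "a < m" for a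
    using pos[OF that] by (simp add: ell_def zeta_def norm_one_minus_cis)
  have "sin (pi / real m) > 0" using pos[of 1] assms by simp
  then show ?thesis
    using e[OF assms] e[of 1] pos[OF assms] assms by (simp add: U_def log_def ln_div ln_mult)
qed

lemma red_correct:
  assumes "m > 0" "\<not> m dvd a"
  shows "red m (int a) \<in> {1..m div 2}" "cong_pm m (red m (int a)) a"
proof -
  have "\<not> [int a = 0] (mod int m)"
    using assms by (simp add: cong_0_iff)
  from theI'[OF red_ex1[OF assms(1) this]]
  show "red m (int a) \<in> {1..m div 2}" "cong_pm m (red m (int a)) a"
    unfolding red_def cong_pm_iff_int by auto
qed

context cyclotomic_prime_power
begin

lemma red_unit:
  assumes "\<not> p dvd a"
  shows "red m (int a) \<in> {1..m div 2}" "\<not> p dvd red m (int a)" "ell m (red m (int a)) = ell m a"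
  using red_correct[OF m_pos unit_not_dvd[OF assms]] cong_pm_dvd_iff assms ell_cong_pm[OF m_pos] by auto

lemma J_eq:
  assumes "r < n"
  shows "J p n (n - r) = (\<lambda>t. 1 + t * p ^ (n - r)) ` {..<p ^ r}"
proof -
  define q where "q = p ^ (n - r)"
  have q: "q > 1" using assms p_gt_1 unfolding q_def by (intro one_less_power) auto
  have mq: "p ^ n = p ^ r * q" using assms by (simp add: q_def flip: power_add)
  show ?thesis
    unfolding q_def [symmetric] J_def
  proof (intro equalityI subsetI)
    fix j assume j: "j \<in> {j \<in> {1..p ^ n}. [j = 1] (mod q)}"
    then have "q dvd j - 1" using cong_to_1_nat by blast
    then obtain t where "j - 1 = q * t" by (rule dvdE)
    then have t: "j = 1 + t * q" using j by (cases j) (auto simp: mult.commute)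
    with j mq have "1 + t * q \<le> p ^ r * q" by auto
    then have "t * q < p ^ r * q" by (simp only: less_eq_Suc_le plus_1_eq_Suc)
    then show "j \<in> (\<lambda>t. 1 + t * q) ` {..<p ^ r}" using t by auto
  next
    fix j assume "j \<in> (\<lambda>t. 1 + t * q) ` {..<p ^ r}"
    then obtain t where t: "j = 1 + t * q" "t < p ^ r" by auto
    have "(t + 1) * q \<le> p ^ r * q" using t(2) by (intro mult_right_mono) auto
    then have "j \<le> p ^ n" using t(1) q mq by simp
    moreover have "[1 + t * q = 1] (mod q)" unfolding cong_def by (rule mod_mult_self1)
    ultimately show "j \<in> {j \<in> {1..p ^ n}. [j = 1] (mod q)}"
      using t(1) by simp
  qed
qed

lemma inj_on_J: "inj_on (\<lambda>t. 1 + t * p ^ (n - r)) A"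
  using p_pos by (auto intro!: inj_onI)

lemma card_J: "r < n \<Longrightarrow> card (J p n (n - r)) = p ^ r"
  unfolding J_eq by (subst card_image[OF inj_on_J]) simp

lemma J_unit:
  assumes "r < n" "j \<in> J p n (n - r)"
  shows "\<not> p dvd j"
proof
  assume "p dvd j"
  moreover have "p dvd p ^ (n - r)" using assms(1) by simp
  ultimately have "[1 = (0::nat)] (mod p)"
    using assms(2) by (metis (mono_tags, lifting) J_def cong_0_iff cong_dvd_modulus_nat cong_sym cong_trans mem_Collect_eq)
  then show False using p_gt_1 by (simp add: cong_0_iff)
qed

text \<open>The indices are \<open>k + (k * t) * p ^ (n - r)\<close>. As \<open>k\<close> is a unit,
  \<open>k * t\<close> may be replaced by \<open>t\<close>, and the distribution relation
  applies.\<close>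

lemma sum_ell_J:
  assumes r: "r < n" and k: "\<not> p dvd k"
  shows "(\<Sum>j\<in>J p n (n - r). ell m (j * k)) = ell m (p ^ r * k)"
proof -
  define q where "q = p ^ (n - r)"
  have mq: "m = p ^ r * q" using r by (simp add: m q_def flip: power_add)
  have "\<not> q dvd k"
    using k r by (metis dvd_power dvd_trans q_def zero_less_diff)
  have "(\<Sum>j\<in>J p n (n - r). ell m (j * k)) = (\<Sum>t<p ^ r. ell m (k + (k * t) * q))"
    unfolding J_eq[OF r] by (subst sum.reindex[OF inj_on_J]) (simp add: q_def algebra_simps)
  also have "\<dots> = (\<Sum>t<p ^ r. ell m (k + t * q))"
  proof (rule sum_periodic_dilate[where f = "\<lambda>t. ell m (k + t * q)"])
    show "coprime k (p ^ r)"
      using k coprime_iff[of k] unfolding mq by simp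
    show "ell m (k + (t + p ^ r) * q) = ell m (k + t * q)" for t
      using ell_add_period[OF m_pos, of "k + t * q"] by (simp add: mq algebra_simps)
  qed (use p_pos in simp)
  also have "\<dots> = ell m (p ^ r * k)"
    using ell_distribution[of "p ^ r" q k] \<open>\<not> q dvd k\<close> p_pos by (simp add: mq q_def)
  finally show ?thesis .
qed

end

section \<open>Linear forms and their values at the numbers \<open>U m k\<close>\<close>

locale U_relation_setup = cyclotomic_prime_power +
  assumes n2: "n \<ge> 2"
begin

definition form_value :: "linform \<Rightarrow> real" where
  "form_value f = (\<Sum>k = 2..m div 2. of_rat (Poly_Mapping.lookup f k) * U m k)"

lemma form_value_add: "form_value (f + h) = form_value f + form_value h"
  by (simp add: form_value_def Poly_Mapping.lookup_add of_rat_add distrib_right sum.distrib)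

lemma form_value_minus: "form_value (- f) = - form_value f"
  by (simp add: form_value_def of_rat_minus sum_negf)

lemma form_value_diff: "form_value (f - h) = form_value f - form_value h"
  using form_value_add[of f "- h"] form_value_minus[of h] by simp

lemma form_value_scale: "form_value (scaleQ c f) = of_rat c * form_value f"
  by (simp add: form_value_def of_rat_mult mult.assoc sum_distrib_left)

lemma form_value_sum: "form_value (\<Sum>i\<in>A. f i) = (\<Sum>i\<in>A. form_value (f i))"
proof (induction A rule: infinite_finite_induct)
  case (insert x A)
  then show ?case by (simp add: form_value_add)
qed (simp_all add: form_value_def)

text \<open>Allowing \<open>k = 1\<close>, where both sides are 0, makes the formula usable for
  reduced indices without a case split.\<close>

lemma form_value_Y:
  assumes "1 \<le> k" "k \<le> m div 2"
  shows "form_value (Y k) = (ell m k - ell m 1) / ln 2"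
proof (cases "k = 1")
  case False
  have "form_value (Y k) = (\<Sum>j = 2..m div 2. if j = k then U m j else 0)"
    unfolding form_value_def using False by (intro sum.cong refl) (auto simp: Y_def lookup_single when_def)
  also have "\<dots> = U m k" using assms False by simp
  finally show ?thesis using U_eq_ell[of k m] assms m_gt_1 by simp
qed (simp add: Y_def form_value_def)

definition V :: "linform set" where
  "V = {f. Poly_Mapping.keys f \<subseteq> {2..m div 2}}"

lemma subspace_V: "linform.subspace V"
proof (rule linform.subspaceI)
  show "f + h \<in> V" if "f \<in> V" "h \<in> V" for f h
    using that Poly_Mapping.keys_add[of f h] by (auto simp: V_def)
  show "scaleQ c f \<in> V" if "f \<in> V" for c f
    using that by (auto simp: V_def Poly_Mapping.in_keys_iff)
qed (simp add: V_def)

lemma Y_in_V: "1 \<le> k \<Longrightarrow> k \<le> m div 2 \<Longrightarrow> Y k \<in> V"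
  by (auto simp: Y_def V_def)

lemma U_relations_eq: "U_relations m = {f \<in> V. form_value f = 0}"
  by (auto simp: U_relations_def V_def form_value_def)

lemma R_indexD:
  assumes "(r, k) \<in> R_index p n"
  shows "1 \<le> r" "r < n" "\<not> p dvd k" "1 \<le> k" "p ^ r * k \<le> m div 2" "p ^ r * k \<noteq> p" "p dvd p ^ r * k"
proof -
  show rk: "1 \<le> r" "r < n" "1 \<le> k" using assms by (auto simp: R_index_def)
  have gcd: "gcd k p = 1" and le: "real k \<le> real (p ^ (n - r)) / 2" and r1: "r = 1 \<Longrightarrow> k > 1"
    using assms by (auto simp: R_index_def)
  show nd: "\<not> p dvd k" using gcd p by (metis gcd_nat.absorb2 not_prime_1)
  have "2 * k \<le> p ^ (n - r)" using le by linarith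
  then have "p ^ r * (2 * k) \<le> p ^ r * p ^ (n - r)" by (rule mult_le_mono2)
  also have "\<dots> = m" using rk by (simp add: m flip: power_add)
  finally show "p ^ r * k \<le> m div 2" by simp
  show "p dvd p ^ r * k" using rk by simp
  show "p ^ r * k \<noteq> p"
  proof
    assume eq: "p ^ r * k = p"
    have "r = 1"
    proof (rule ccontr)
      assume "r \<noteq> 1"
      then have "p ^ 1 < p ^ r" using rk p_gt_1 by (intro power_strict_increasing) auto
      also have "\<dots> \<le> p ^ r * k" using rk by simp
      finally show False using eq by simp
    qed
    then show False using eq r1 p_pos by simp
  qed
qed

lemma R_index_unique:
  assumes "(r, k) \<in> R_index p n" "(r', k') \<in> R_index p n" "p ^ r * k = p ^ r' * k'"
  shows "(r, k) = (r', k')"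
proof -
  have mult: "multiplicity p (p ^ s * l) = s" if "\<not> p dvd l" for s l
    using that p by (intro multiplicity_eqI) (auto simp: p_pos prime_gt_0_nat)
  have "r = r'" using mult[of k r] mult[of k' r'] assms R_indexD by metis
  then show ?thesis using assms(3) p_pos by simp
qed

text \<open>Here \<open>r\<close> is the exponent of \<open>p\<close> in \<open>i\<close> and
  \<open>k\<close> the cofactor. With \<open>R_index_unique\<close>, the pairs correspond exactly to
  the multiples of \<open>p\<close> up to m/2 other than \<open>p\<close>.\<close>

lemma R_index_cover:
  assumes i: "i \<in> {2..m div 2}" "p dvd i" "i \<noteq> p"
  shows "\<exists>(r, k)\<in>R_index p n. i = p ^ r * k"
proof -
  have "i \<noteq> 0" using i by auto
  then obtain k where k: "i = p ^ multiplicity p i * k" "\<not> p dvd k"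
    using multiplicity_decompose'[of i p] p by (metis not_prime_unit)
  define r where "r = multiplicity p i"
  have ik: "i = p ^ r * k" using k r_def by simp
  have "k \<ge> 1" using ik \<open>i \<noteq> 0\<close> by (cases k) auto
  have "r \<ge> 1" using i(2) k(2) ik by (cases r) auto
  have "p ^ r \<le> i" using ik \<open>k \<ge> 1\<close> by simp
  also have "i < p ^ n" using i(1) m_gt_1 by (auto simp: m)
  finally have rn: "r < n" by (rule power_less_imp_less_exp[OF p_gt_1])
  have "2 * i \<le> m" using i(1) by auto
  then have "p ^ r * (2 * k) \<le> p ^ r * p ^ (n - r)"
    using rn by (simp add: ik m flip: power_add)
  then have "2 * k \<le> p ^ (n - r)" using p_pos by simp
  then have "real k \<le> real (p ^ (n - r)) / 2" by (simp add: field_simps flip: of_nat_power)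
  moreover have "gcd k p = 1" using k(2) p by (metis coprime_iff_gcd_eq_1 gcd.commute prime_imp_coprime)
  moreover have "k > 1" if "r = 1" using that ik i(3) \<open>k \<ge> 1\<close> by (cases "k = 1") auto
  ultimately have "(r, k) \<in> R_index p n"
    using \<open>r \<ge> 1\<close> rn \<open>k \<ge> 1\<close> by (auto simp: R_index_def)
  with ik show ?thesis by blast
qed

lemma finite_R_index: "finite (R_index p n)"
proof (rule finite_subset)
  show "R_index p n \<subseteq> {..<n} \<times> {..m}"
  proof
    fix x assume x: "x \<in> R_index p n"
    obtain r k where rk: "x = (r, k)" by (cases x)
    note D = R_indexD[OF x[unfolded rk]]
    have "1 * k \<le> p ^ r * k" using p_pos by (intro mult_le_mono1) simp
    also have "\<dots> \<le> m" using D(5) div_le_dividend by (rule le_trans)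
    finally show "x \<in> {..<n} \<times> {..m}" using D rk by auto
  qed
qed simp

lemma p_le: "p \<le> m div 2"
proof -
  have "2 * p \<le> p * p" using p_gt_1 by simp
  also have "p * p = p ^ 2" by (simp add: power2_eq_square)
  also have "\<dots> \<le> m" unfolding m using n2 p_gt_1 by (intro power_increasing) auto
  finally show ?thesis by simp
qed

lemma lookup_Y: "Poly_Mapping.lookup (Y k) i = (if k = i \<and> i \<noteq> 1 then 1 else 0)"
  by (auto simp: Y_def lookup_single when_def)

text \<open>The other variables in the form are \<open>Y p\<close> and variables whose index is
  prime to \<open>p\<close>.\<close>

lemma lookup_R:
  assumes rk: "(r, k) \<in> R_index p n" and i: "p dvd i" "i \<noteq> p"
  shows "Poly_Mapping.lookup (R p n r k) i = (if p ^ r * k = i then -1 else 0)"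
proof -
  note D = R_indexD[OF rk]
  have i1: "i \<noteq> 1" using i p by auto
  have "Poly_Mapping.lookup (\<Sum>j\<in>J p n (n - r). Y (red (p ^ n) (int (j * k)))) i = 0"
    unfolding lookup_sum
  proof (rule sum.neutral, rule ballI)
    fix j assume "j \<in> J p n (n - r)"
    then have "\<not> p dvd j * k" using J_unit[OF D(2)] D(3) p by (auto simp: prime_dvd_mult_iff)
    from red_unit(2)[OF this] i(1) show "Poly_Mapping.lookup (Y (red (p ^ n) (int (j * k)))) i = 0"
      by (auto simp: lookup_Y m)
  qed
  moreover have "Poly_Mapping.lookup (\<Sum>j\<in>J p n (n - 1). Y (red (p ^ n) (int j))) i = 0"
    unfolding lookup_sum
  proof (rule sum.neutral, rule ballI)
    fix j assume "j \<in> J p n (n - 1)"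
    then have "\<not> p dvd j" using J_unit[of 1] n2 by auto
    from red_unit(2)[OF this] i(1) show "Poly_Mapping.lookup (Y (red (p ^ n) (int j))) i = 0"
      by (auto simp: lookup_Y m)
  qed
  ultimately show ?thesis
    using i i1 by (simp add: R_def Poly_Mapping.lookup_add Poly_Mapping.lookup_minus lookup_Y)
qed

text \<open>By the distribution relation the sum over J cancels the logarithm at
  \<open>p ^ r * k\<close>, and the second sum cancels that at \<open>p\<close>. What remains is a
  multiple of \<open>ell m 1\<close>, and \<open>c\<close> is chosen so that this multiple is
  0.\<close>

lemma R_in_U_relations:
  assumes rk: "(r, k) \<in> R_index p n"
  shows "R p n r k \<in> U_relations m"
proof -
  note D = R_indexD[OF rk]
  define c :: rat where "c = (of_nat p ^ r - 1) / (of_nat p - 1)"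
  define e where "e = ell m"
  have unit: "\<not> p dvd j * k" if "j \<in> J p n (n - r)" for j
    using J_unit[OF D(2) that] D(3) p by (auto simp: prime_dvd_mult_iff)
  have unit1: "\<not> p dvd j" if "j \<in> J p n (n - 1)" for j
    using J_unit[of 1] that n2 by auto
  have pk: "1 \<le> p ^ r * k" using p_pos D by simp
  have R: "R p n r k = - Y (p ^ r * k) + scaleQ c (Y p)
     + (\<Sum>j\<in>J p n (n - r). Y (red m (int (j * k)))) - scaleQ c (\<Sum>j\<in>J p n (n - 1). Y (red m (int j)))"
    by (simp add: R_def c_def m)
  have "R p n r k \<in> V"
    unfolding R using D pk p_le p_pos red_unit(1)[OF unit] red_unit(1)[OF unit1]
    by (intro linform.subspace_diff linform.subspace_add linform.subspace_neg linform.subspace_scale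
        linform.subspace_sum subspace_V Y_in_V) auto
  moreover have "form_value (R p n r k) = 0"
  proof -
    have v1: "(\<Sum>j\<in>J p n (n - r). form_value (Y (red m (int (j * k)))))
        = (e (p ^ r * k) - of_nat (p ^ r) * e 1) / ln 2"
    proof -
      have "(\<Sum>j\<in>J p n (n - r). form_value (Y (red m (int (j * k)))))
         = (\<Sum>j\<in>J p n (n - r). (e (j * k) - e 1) / ln 2)"
        using red_unit[OF unit] form_value_Y unfolding e_def by (intro sum.cong refl) (simp del: of_nat_mult)
      also have "\<dots> = (e (p ^ r * k) - of_nat (p ^ r) * e 1) / ln 2"
        using sum_ell_J[OF D(2,3)] card_J[OF D(2)]
        by (simp add: e_def sum_subtractf flip: sum_divide_distrib)
      finally show ?thesis .
    qed
    have v2: "(\<Sum>j\<in>J p n (n - 1). form_value (Y (red m (int j)))) = (e p - of_nat p * e 1) / ln 2"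
    proof -
      have "(\<Sum>j\<in>J p n (n - 1). form_value (Y (red m (int j)))) = (\<Sum>j\<in>J p n (n - 1). (e j - e 1) / ln 2)"
        using red_unit[OF unit1] form_value_Y unfolding e_def by (intro sum.cong refl) simp
      also have "\<dots> = (e p - of_nat p * e 1) / ln 2"
        using sum_ell_J[of 1 1] card_J[of 1] n2 p_gt_1
        by (simp add: e_def sum_subtractf flip: sum_divide_distrib)
      finally show ?thesis .
    qed
    have c: "of_rat c * (real p - 1) = real p ^ r - 1"
      using p_gt_1 by (simp add: c_def of_rat_divide of_rat_diff of_rat_power)
    have "form_value (R p n r k) = - ((e (p ^ r * k) - e 1) / ln 2) + of_rat c * ((e p - e 1) / ln 2)
        + (e (p ^ r * k) - of_nat (p ^ r) * e 1) / ln 2 - of_rat c * ((e p - of_nat p * e 1) / ln 2)"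
      unfolding R form_value_diff form_value_add form_value_minus form_value_scale form_value_sum v1 v2
      using form_value_Y[OF pk D(5)] form_value_Y[of p] p_le p_pos by (simp add: e_def)
    also have "\<dots> = (of_rat c * (real p - 1) - (real p ^ r - 1)) * e 1 / ln 2"
      by (simp add: diff_divide_distrib add_divide_distrib algebra_simps)
    finally show ?thesis by (simp add: c)
  qed
  ultimately show ?thesis by (simp add: U_relations_eq)
qed

text \<open>Only \<open>p\<close> and indices prime to \<open>p\<close> are left. Expanding
  \<open>ell m p\<close> by the distribution relation gives a relation among logarithms at units,
  whose coefficients vanish by \<open>ell_independent\<close>; their sum shows
  \<open>a p = 0\<close>, and then the other coefficients vanish as well.\<close>

lemma relation_without_multiples:
  assumes h: "h \<in> U_relations m"
    and zero: "\<And>i. i \<in> {2..m div 2} \<Longrightarrow> p dvd i \<Longrightarrow> i \<noteq> p \<Longrightarrow> Poly_Mapping.lookup h i = 0"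
  shows "h = 0"
proof -
  define a where "a = Poly_Mapping.lookup h"
  have out: "a i = 0" if "i \<notin> {2..m div 2}" for i
    using h that by (auto simp: a_def U_relations_def Poly_Mapping.in_keys_iff)
  define K where "K = {k. 1 \<le> k \<and> k \<le> m div 2 \<and> \<not> p dvd k}"
  have fin: "finite K" by (rule finite_subset[of _ "{..m}"]) (auto simp: K_def)
  have one: "1 \<in> K" using m_gt_1 p by (auto simp: K_def)
  define J1 where "J1 = J p n (n - 1)"
  have finJ: "finite J1" by (auto simp: J1_def J_def)
  have unit1: "\<not> p dvd j" if "j \<in> J1" for j using J_unit[of 1 j] that n2 by (auto simp: J1_def)
  have redK: "(\<lambda>j. red m (int j)) ` J1 \<subseteq> K" using red_unit[OF unit1] by (auto simp: K_def)
  \<comment> \<open>A multiplicity is needed because different \<open>j\<close> may have the same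
    reduction: for \<open>m = 4\<close> both 1 and 3 reduce to 1.\<close>
  define N where "N l = card {j \<in> J1. red m (int j) = l}" for l
  have group: "(\<Sum>l\<in>K. of_nat (N l) * F l) = (\<Sum>j\<in>J1. F (red m (int j)))" for F :: "nat \<Rightarrow> 'c :: comm_semiring_1"
    using sum.group[OF finJ fin redK, of "\<lambda>j. F (red m (int j))"]
    by (simp add: N_def)
  \<comment> \<open>\<open>T\<close> collects the terms \<open>- ell m 1\<close> contributed by
    every \<open>U m k\<close>.\<close>
  define T where "T = (\<Sum>k\<in>K. a k) + a p"
  \<comment> \<open>The coefficients of the resulting relation among the \<open>\<ell>(l)\<close>; they add up to \<open>(p - 1) a p\<close>.\<close>
  define c where "c l = a l + a p * of_nat (N l) - (if l = 1 then T else 0)" for l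
  have pK: "p \<notin> K" by (simp add: K_def)
  have "(\<Sum>k = 2..m div 2. of_rat (a k) * U m k) = (\<Sum>k\<in>insert p K. of_rat (a k) * U m k)"
  proof (rule sum.mono_neutral_cong)
    show "of_rat (a i) * U m i = 0" if "i \<in> {2..m div 2} - insert p K" for i
      using that zero[of i] by (auto simp: a_def K_def)
    show "of_rat (a i) * U m i = 0" if "i \<in> insert p K - {2..m div 2}" for i
      using that out[of i] by simp
  qed (use fin in auto)
  also have "\<dots> = of_rat (a p) * U m p + (\<Sum>k\<in>K. of_rat (a k) * U m k)"
    using fin pK by simp
  finally have "of_rat (a p) * U m p + (\<Sum>k\<in>K. of_rat (a k) * U m k) = 0"
    using h by (simp add: U_relations_def a_def)
  moreover have "U m p = (ell m p - ell m 1) / ln 2" using p_le p_pos m_gt_1 by (intro U_eq_ell) auto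
  moreover have "(\<Sum>k\<in>K. of_rat (a k) * U m k) = (\<Sum>k\<in>K. of_rat (a k) * ((ell m k - ell m 1) / ln 2))"
    using m_gt_1 by (intro sum.cong refl) (subst U_eq_ell, auto simp: K_def)
  ultimately have "(of_rat (a p) * (ell m p - ell m 1) + (\<Sum>k\<in>K. of_rat (a k) * (ell m k - ell m 1))) / ln 2 = 0"
    by (simp add: add_divide_distrib sum_divide_distrib)
  then have rel: "of_rat (a p) * (ell m p - ell m 1) + (\<Sum>k\<in>K. of_rat (a k) * (ell m k - ell m 1)) = 0"
    by simp
  have ellp: "ell m p = (\<Sum>l\<in>K. of_nat (N l) * ell m l)"
  proof -
    have "ell m p = (\<Sum>j\<in>J1. ell m j)" using sum_ell_J[of 1 1] n2 p_gt_1 by (simp add: J1_def)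
    also have "\<dots> = (\<Sum>j\<in>J1. ell m (red m (int j)))" using red_unit(3)[OF unit1] by simp
    finally show ?thesis by (simp add: group)
  qed
  have "(\<Sum>l\<in>K. of_rat (c l) * ell m l) = (\<Sum>l\<in>K. of_rat (a l) * ell m l)
      + of_rat (a p) * (\<Sum>l\<in>K. of_nat (N l) * ell m l) - of_rat T * ell m 1"
  proof -
    have "(\<Sum>l\<in>K. of_rat (c l) * ell m l) = (\<Sum>l\<in>K. of_rat (a l) * ell m l
       + of_rat (a p) * (of_nat (N l) * ell m l) - (if l = 1 then of_rat T * ell m 1 else 0))"
      by (intro sum.cong refl) (simp add: c_def of_rat_add of_rat_diff of_rat_mult algebra_simps)
    then show ?thesis
      using fin one by (simp add: sum.distrib sum_subtractf sum_distrib_left)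
  qed
  also have "\<dots> = 0"
    using rel by (simp add: ellp T_def of_rat_add of_rat_sum sum_subtractf sum_distrib_left sum_distrib_right algebra_simps)
  finally have relc: "(\<Sum>l\<in>K. of_rat (c l) * ell m l) = 0" .
  have c0: "c l = 0" if l: "l \<in> K" for l
  proof -
    \<comment> \<open>Clearing denominators, since independence is available for integer
      coefficients.\<close>
    obtain d where d: "d \<noteq> 0" "\<forall>k\<in>K. \<exists>z. c k * of_int d = of_int z"
      using common_denominator[OF fin, of c] by blast
    then obtain z where z: "\<And>k. k \<in> K \<Longrightarrow> c k * of_int d = of_int (z k)" by metis
    have zr: "real_of_int (z k) = of_rat (c k) * of_int d" if "k \<in> K" for k
      using z[OF that] by (metis of_rat_mult of_rat_of_int_eq)
    have "(\<Sum>k\<in>K. of_int (z k) * ell m k) = (\<Sum>k\<in>K. of_rat (c k) * ell m k) * of_int d"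
      unfolding sum_distrib_right by (intro sum.cong refl) (simp add: zr)
    then have "z l = 0"
      using relc l ell_independent[OF p n2 m, of z l] by (simp add: K_def)
    then show ?thesis using z[OF l] d(1) by simp
  qed
  have "0 = (\<Sum>l\<in>K. c l)" using c0 by simp
  also have "\<dots> = (\<Sum>l\<in>K. a l) + a p * (\<Sum>l\<in>K. of_nat (N l)) - T"
    using fin one by (simp add: c_def sum.distrib sum_subtractf sum_distrib_left)
  also have "(\<Sum>l\<in>K. of_nat (N l)) = (of_nat p :: rat)"
    using group[of "\<lambda>_. 1 :: rat"] card_J[of 1] n2 by (simp add: J1_def)
  finally have "a p * (of_nat p - 1) = 0" by (simp add: T_def algebra_simps)
  then have ap: "a p = 0" using p_gt_1 by auto
  have "a i = 0" for i
  proof (cases "i \<in> {2..m div 2}")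
    case True
    show ?thesis
    proof (cases "p dvd i")
      case True
      with zero[of i] \<open>i \<in> {2..m div 2}\<close> ap show ?thesis by (cases "i = p") (auto simp: a_def)
    next
      case False
      then have "c i = 0" using True by (intro c0) (auto simp: K_def)
      with True ap show ?thesis by (simp add: c_def)
    qed
  qed (rule out)
  then show ?thesis by (intro poly_mapping_eqI) (simp add: a_def)
qed

end

section \<open>Independence and spanning\<close>

theorem theorem2:
  fixes p n m :: nat
  assumes "prime p" and "n \<ge> 2" and "m = p ^ n"
  shows "inj_on (\<lambda>(r, k). R p n r k) (R_index p n) \<and>
         linform.independent ((\<lambda>(r, k). R p n r k) ` R_index p n) \<and>
         linform.span ((\<lambda>(r, k). R p n r k) ` R_index p n) = U_relations m"
proof -
  interpret U_relation_setup p n m using assms by unfold_locales auto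
  define R' where "R' = (\<lambda>(r, k). R p n r k)"
  define idx where "idx = (\<lambda>(r :: nat, k). p ^ r * k)"
  \<comment> \<open>On the indices \<open>p ^ r * k\<close> the coefficients of the forms make up
    minus the identity matrix, which yields injectivity and independence.\<close>
  have lookup: "Poly_Mapping.lookup (R' x) (idx y) = (if x = y then -1 else 0)"
    if "x \<in> R_index p n" "y \<in> R_index p n" for x y
  proof -
    obtain r k r' k' where x: "x = (r, k)" and y: "y = (r', k')" by (cases x, cases y)
    have "Poly_Mapping.lookup (R p n r k) (p ^ r' * k') = (if p ^ r * k = p ^ r' * k' then -1 else 0)"
      using that x y R_indexD[of r' k'] by (intro lookup_R) auto
    then show ?thesis
      using R_index_unique[of r k r' k'] that by (auto simp: x y R'_def idx_def)
  qed
  have inj: "inj_on R' (R_index p n)"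
  proof (rule inj_onI)
    fix x y assume xy: "x \<in> R_index p n" "y \<in> R_index p n" and eq: "R' x = R' y"
    have "(if y = x then - 1 else 0) = (if x = x then - 1 else (0 :: rat))"
      unfolding lookup[OF xy(2,1), symmetric] lookup[OF xy(1,1), symmetric] eq ..
    then show "x = y" by (simp split: if_splits)
  qed
  have coeff: "Poly_Mapping.lookup (\<Sum>x\<in>R_index p n. scaleQ (u x) (R' x)) (idx y) = - u y"
    if y: "y \<in> R_index p n" for u y
  proof -
    have "Poly_Mapping.lookup (\<Sum>x\<in>R_index p n. scaleQ (u x) (R' x)) (idx y)
        = (\<Sum>x\<in>R_index p n. if x = y then - u x else 0)"
      unfolding lookup_sum using lookup y by (intro sum.cong refl) simp
    also have "\<dots> = - u y" using y finite_R_index by simp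
    finally show ?thesis .
  qed
  have "linform.independent (R' ` R_index p n)"
  proof
    assume "linform.dependent (R' ` R_index p n)"
    then obtain u where u: "\<exists>v\<in>R' ` R_index p n. u v \<noteq> 0" "(\<Sum>v\<in>R' ` R_index p n. scaleQ (u v) v) = 0"
      using linform.dependent_finite[of "R' ` R_index p n"] finite_R_index by auto
    then obtain y where y: "y \<in> R_index p n" "u (R' y) \<noteq> 0" by blast
    have "(\<Sum>x\<in>R_index p n. scaleQ (u (R' x)) (R' x)) = 0"
      using u(2) by (simp add: sum.reindex[OF inj])
    then show False using coeff[OF y(1), of "\<lambda>x. u (R' x)"] y(2) by simp
  qed
  moreover have "linform.span (R' ` R_index p n) = U_relations m"
  proof
    have R_rel: "R' x \<in> U_relations m" if "x \<in> R_index p n" for x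
      using that R_in_U_relations by (cases x) (auto simp: R'_def)
    then show "linform.span (R' ` R_index p n) \<subseteq> U_relations m"
      by (intro linform.span_minimal subspace_U_relations) auto
    show "U_relations m \<subseteq> linform.span (R' ` R_index p n)"
    proof
      fix f assume f: "f \<in> U_relations m"
      \<comment> \<open>The diagonal coefficients are -1, so adding \<open>S\<close> removes from
        \<open>f\<close> all variables at multiples of \<open>p\<close> other than
        \<open>p\<close>.\<close>
      define S where "S = (\<Sum>x\<in>R_index p n. scaleQ (Poly_Mapping.lookup f (idx x)) (R' x))"
      have "f + S = 0"
      proof (rule relation_without_multiples)
        show "f + S \<in> U_relations m"
          unfolding S_def using f R_rel
          by (intro linform.subspace_add linform.subspace_sum linform.subspace_scale subspace_U_relations)
        fix i assume i: "i \<in> {2..m div 2}" "p dvd i" "i \<noteq> p"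
        then obtain y where "y \<in> R_index p n" "i = idx y"
          using R_index_cover[OF i] by (auto simp: idx_def)
        then show "Poly_Mapping.lookup (f + S) i = 0"
          using coeff by (simp add: S_def Poly_Mapping.lookup_add)
      qed
      then have "f = - S" by (simp add: eq_neg_iff_add_eq_0)
      also have "- S \<in> linform.span (R' ` R_index p n)"
        unfolding S_def
        by (intro linform.span_neg linform.span_sum linform.span_scale linform.span_base imageI)
      finally show "f \<in> linform.span (R' ` R_index p n)" .
    qed
  qed
  ultimately show ?thesis using inj unfolding R'_def by blast
qed

end
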